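(* Let $S\subset\mathbb R^3$ be a smoothly embedded two-sphere, let $\varphi\in\Phi_0(S)$ have conformal factor $e^{2\rho}$, let $X=X_\varphi$, $X_l=\pi_lX$, and let $X^{(L)}=\sum_{l\le L}X_l$ be the degree-$L$ truncation of $X$. Then $$\|X-X^{(L)}\|_{L^2(d\omega)}^2\le\frac{|S|}{2\pi(L+1)(L+2)},\qquad \int_{\mathbb S^2}|X-X^{(L)}|^2\,d\mu_\varphi\le\frac{2\,\sup e^{2\rho}}{(L+1)(L+2)}.$$ The same bounds hold for $d_\varphi=|X_\varphi|$ (with its degree-$L$ truncation $\sum_{l\le L}\pi_ld_\varphi$) in place of $X_\varphi$.
   Context: $\mathbb S^2\subset\mathbb R^3$ is the unit sphere with outward orientation, $d\omega=dA_{\rm round}/4\pi$ the round probability measure. A smoothly embedded two-sphere $S\subset\mathbb R^3$ is oriented by its outward normal, with induced metric $g_S$, area form $dA$ and area $|S|$. $\Phi(S)$ is the set of orientation-preserving diffeomorphisms $\varphi:\mathbb S^2\to S$ with $\varphi^*g_S=e^{2\rho}g_{\rm round}$ for a smooth function $\rho$; $e^{2\rho}$ is the conformal factor of $\varphi$. $\mu_\varphi=|S|^{-1}\varphi^*(dA)$ is a probability measure on $\mathbb S^2$; $\varphi$ is centered if $\int_{\mathbb S^2}u\,d\mu_\varphi(u)=0$; $\Phi_0(S)$ is the set of centered $\varphi\in\Phi(S)$. The conformal center is $\bar c(S)=\int_{\mathbb S^2}\varphi\,d\omega$ for any $\varphi\in\Phi_0(S)$ (independent of the choice), and $X_\varphi(u)=\varphi(u)-\bar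 c(S)$, $d_\varphi(u)=|X_\varphi(u)|$. $\mathcal H_l$ is the space of restrictions to $\mathbb S^2$ of real homogeneous harmonic polynomials of degree $l$ on $\mathbb R^3$, and $\pi_l$ is the $L^2(\mathbb S^2,d\omega)$-orthogonal projection onto $\mathcal H_l$, taken componentwise for $\mathbb R^3$-valued functions. *)

theory Defs
  imports "HOL-Analysis.Analysis"
begin

section \<open>Smooth maps on subsets of Euclidean spaces\<close>

text \<open>
  \<open>Ck_on k U f\<close> is meant for open \<open>U\<close> and finite-dimensional domain: all iterated directional
  derivatives of \<open>f\<close> up to order \<open>k\<close> exist and are continuous on \<open>U\<close>.
\<close>

primrec Ck_on :: "nat \<Rightarrow> 'a::euclidean_space set \<Rightarrow> ('a \<Rightarrow> 'b::real_normed_vector) \<Rightarrow> bool" where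
  "Ck_on 0 U f \<longleftrightarrow> continuous_on U f"
| "Ck_on (Suc k) U f \<longleftrightarrow>
     (\<forall>x\<in>U. f differentiable (at x)) \<and> (\<forall>v. Ck_on k U (\<lambda>x. frechet_derivative f (at x) v))"

text \<open>
  A map on an arbitrary subset of a Euclidean space is smooth if it locally extends to a
  \<open>C\<^sup>\<infinity>\<close> map on an open set of the ambient space. Maps are total functions, only their
  values on \<open>A\<close> matter.
\<close>

definition smooth_map_on :: "'a::euclidean_space set \<Rightarrow> ('a \<Rightarrow> 'b::real_normed_vector) \<Rightarrow> bool" where
  "smooth_map_on A f \<longleftrightarrow>
     (\<forall>x\<in>A. \<exists>V F. open V \<and> x \<in> V \<and> (\<forall>k. Ck_on k V F) \<and> (\<forall>y\<in>A \<inter> V. F y = f y))"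

definition diffeo :: "'a::euclidean_space set \<Rightarrow> 'b::euclidean_space set \<Rightarrow> ('a \<Rightarrow> 'b) \<Rightarrow> bool" where
  "diffeo A B f \<longleftrightarrow> bij_betw f A B \<and> smooth_map_on A f \<and> smooth_map_on B (inv_into A f)"

abbreviation S2 :: "(real^3) set" where
  "S2 \<equiv> sphere 0 1"

text \<open>
  The image of an embedding of the sphere, that is, a subset of \<open>\<real>\<^sup>3\<close> that is diffeomorphic to
  the sphere (the inverse of the embedding is smooth on \<open>S\<close> in the above sense).
\<close>

definition embedded_two_sphere :: "(real^3) set \<Rightarrow> bool" where
  "embedded_two_sphere S \<longleftrightarrow> (\<exists>f. diffeo S2 S f)"


section \<open>The area measure of an embedded surface\<close>

definition local_param :: "(real^3) set \<Rightarrow> (real^2) set \<Rightarrow> (real^2 \<Rightarrow> real^3) \<Rightarrow> bool" where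
  "local_param S U f \<longleftrightarrow> open U \<and> openin (top_of_set S) (f ` U) \<and> diffeo U (f ` U) f"

text \<open>
  \<open>sqrt (det g)\<close> for the coefficients \<open>g\<close> of the induced metric in a local parametrization.
\<close>

definition area_density :: "(real^2 \<Rightarrow> real^3) \<Rightarrow> real^2 \<Rightarrow> real" where
  "area_density f x =
     (let a = frechet_derivative f (at x) (axis 1 1);
          b = frechet_derivative f (at x) (axis 2 1)
      in sqrt ((a \<bullet> a) * (b \<bullet> b) - (a \<bullet> b)\<^sup>2))"

text \<open>
  The integration measure \<open>dA\<close> of the area form on the oriented surface \<open>S\<close>: the unique Borel
  measure on \<open>S\<close> that is given by \<open>sqrt (det g) dx\<^sub>1 dx\<^sub>2\<close> in every local parametrization.
\<close>

definition is_area_measure :: "(real^3) set \<Rightarrow> (real^3) measure \<Rightarrow> bool" where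
  "is_area_measure S M \<longleftrightarrow>
     sets M = sets (restrict_space borel S) \<and>
     (\<forall>U f. local_param S U f \<longrightarrow>
        (\<forall>A\<in>sets M. A \<subseteq> f ` U \<longrightarrow>
           emeasure M A = (\<integral>\<^sup>+x\<in>{x\<in>U. f x \<in> A}. ennreal (area_density f x) \<partial>lborel)))"

definition area_measure :: "(real^3) set \<Rightarrow> (real^3) measure" where
  "area_measure S = (THE M. is_area_measure S M)"

definition area :: "(real^3) set \<Rightarrow> real" where
  "area S = measure (area_measure S) S"

definition round_prob :: "(real^3) measure" where
  "round_prob = scale_measure (ennreal (1 / (4 * pi))) (area_measure S2)"


section \<open>Orientation-preserving conformal diffeomorphisms\<close>

definition tangent_space :: "(real^3) set \<Rightarrow> real^3 \<Rightarrow> (real^3) set" where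
  "tangent_space S p =
     {v. \<exists>(\<gamma>::real \<Rightarrow> real^3) e. e > 0 \<and> smooth_map_on {-e<..<e} \<gamma> \<and> \<gamma> ` {-e<..<e} \<subseteq> S \<and>
         \<gamma> 0 = p \<and> (\<gamma> has_vector_derivative v) (at 0)}"

definition outward_normal :: "(real^3) set \<Rightarrow> real^3 \<Rightarrow> real^3" where
  "outward_normal S p =
     (THE n. norm n = 1 \<and> (\<forall>v\<in>tangent_space S p. n \<bullet> v = 0) \<and>
             (\<forall>\<^sub>F t in at_right 0. p + t *\<^sub>R n \<in> outside S))"

text \<open>
  The differential at \<open>u \<in> S2\<close> of a map on the sphere, computed from its extension that is constant
  along rays. It is meaningful on tangent vectors \<open>v\<close>, i.e. those with \<open>u \<bullet> v = 0\<close>.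
\<close>

definition sphere_diff :: "(real^3 \<Rightarrow> real^3) \<Rightarrow> real^3 \<Rightarrow> real^3 \<Rightarrow> real^3" where
  "sphere_diff \<phi> u = frechet_derivative (\<lambda>x. \<phi> (x /\<^sub>R norm x)) (at u)"

definition orientation_preserving :: "(real^3) set \<Rightarrow> (real^3 \<Rightarrow> real^3) \<Rightarrow> bool" where
  "orientation_preserving S \<phi> \<longleftrightarrow>
     (\<forall>u\<in>S2. \<forall>v w. u \<bullet> v = 0 \<longrightarrow> u \<bullet> w = 0 \<longrightarrow> u \<bullet> cross3 v w > 0 \<longrightarrow>
        outward_normal S (\<phi> u) \<bullet> cross3 (sphere_diff \<phi> u v) (sphere_diff \<phi> u w) > 0)"

text \<open>\<open>\<phi>\<^sup>* g\<^sub>S = e\<^sup>2\<^sup>\<rho> g\<^sub>r\<^sub>o\<^sub>u\<^sub>n\<^sub>d\<close>\<close>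

definition has_conformal_factor :: "(real^3 \<Rightarrow> real^3) \<Rightarrow> (real^3 \<Rightarrow> real) \<Rightarrow> bool" where
  "has_conformal_factor \<phi> \<rho> \<longleftrightarrow>
     smooth_map_on S2 \<rho> \<and>
     (\<forall>u\<in>S2. \<forall>v w. u \<bullet> v = 0 \<longrightarrow> u \<bullet> w = 0 \<longrightarrow>
        sphere_diff \<phi> u v \<bullet> sphere_diff \<phi> u w = exp (2 * \<rho> u) * (v \<bullet> w))"

definition conformal_maps :: "(real^3) set \<Rightarrow> (real^3 \<Rightarrow> real^3) set" where
  "conformal_maps S =
     {\<phi>. diffeo S2 S \<phi> \<and> orientation_preserving S \<phi> \<and> (\<exists>\<rho>. has_conformal_factor \<phi> \<rho>)}"

text \<open>
  The pullback of the measure \<open>dA\<close> under the diffeomorphism \<open>\<phi>\<close> gives \<open>A\<close> the mass \<open>dA (\<phi> ` A)\<close>,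
  so it is the image of \<open>dA\<close> under the inverse of \<open>\<phi>\<close>. For orientation-preserving \<open>\<phi>\<close> this is
  the measure of the pulled back area form.
\<close>

definition pullback_area :: "(real^3) set \<Rightarrow> (real^3 \<Rightarrow> real^3) \<Rightarrow> (real^3) measure" where
  "pullback_area S \<phi> = distr (area_measure S) (restrict_space borel S2) (inv_into S2 \<phi>)"

definition conf_measure :: "(real^3) set \<Rightarrow> (real^3 \<Rightarrow> real^3) \<Rightarrow> (real^3) measure" where
  "conf_measure S \<phi> = scale_measure (ennreal (1 / area S)) (pullback_area S \<phi>)"

definition centered_conformal_maps :: "(real^3) set \<Rightarrow> (real^3 \<Rightarrow> real^3) set" where
  "centered_conformal_maps S =
     {\<phi> \<in> conformal_maps S. (\<integral>u. u \<partial>(conf_measure S \<phi>)) = 0}"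

text \<open>The integral does not depend on the choice of the centered map.\<close>

definition conformal_center :: "(real^3) set \<Rightarrow> real^3" where
  "conformal_center S = (\<integral>u. (SOME \<phi>. \<phi> \<in> centered_conformal_maps S) u \<partial>round_prob)"

definition centered_position :: "(real^3) set \<Rightarrow> (real^3 \<Rightarrow> real^3) \<Rightarrow> real^3 \<Rightarrow> real^3" where
  "centered_position S \<phi> u = \<phi> u - conformal_center S"

definition center_distance :: "(real^3) set \<Rightarrow> (real^3 \<Rightarrow> real^3) \<Rightarrow> real^3 \<Rightarrow> real" where
  "center_distance S \<phi> u = norm (centered_position S \<phi> u)"


section \<open>Spherical harmonics and truncations\<close>

definition laplacian :: "('a::euclidean_space \<Rightarrow> real) \<Rightarrow> 'a \<Rightarrow> real" where
  "laplacian p x =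
     (\<Sum>b\<in>Basis. frechet_derivative (\<lambda>y. frechet_derivative p (at y) b) (at x) b)"

definition spherical_harmonics :: "nat \<Rightarrow> (real^3 \<Rightarrow> real) set" where
  "spherical_harmonics l =
     {restrict p S2 | p. real_polynomial_function p \<and>
        (\<forall>t x. p (t *\<^sub>R x) = t ^ l * p x) \<and> (\<forall>x. laplacian p x = 0)}"

definition harm_proj :: "nat \<Rightarrow> (real^3 \<Rightarrow> real) \<Rightarrow> real^3 \<Rightarrow> real" where
  "harm_proj l f =
     (THE h. h \<in> spherical_harmonics l \<and>
        (\<forall>g\<in>spherical_harmonics l. (\<integral>u. (f u - h u) * g u \<partial>round_prob) = 0))"

definition harm_proj_vec :: "nat \<Rightarrow> (real^3 \<Rightarrow> real^3) \<Rightarrow> real^3 \<Rightarrow> real^3" where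
  "harm_proj_vec l F u = (\<chi> i. harm_proj l (\<lambda>v. F v $ i) u)"

definition truncation :: "nat \<Rightarrow> (real^3 \<Rightarrow> real) \<Rightarrow> real^3 \<Rightarrow> real" where
  "truncation L f u = (\<Sum>l\<le>L. harm_proj l f u)"

definition truncation_vec :: "nat \<Rightarrow> (real^3 \<Rightarrow> real^3) \<Rightarrow> real^3 \<Rightarrow> real^3" where
  "truncation_vec L F u = (\<Sum>l\<le>L. harm_proj_vec l F u)"

end

theory Submission
  imports Defs
begin

text \<open>
  The inequality \<open>(L + 1) (L + 2) \<parallel>f - f\<^sup>(\<^sup>L\<^sup>)\<parallel>\<^sup>2 \<le> \<integral> |\<nabla>f|\<^sup>2 d\<omega>\<close> is Bessel's inequality for the Dirichlet form,
  combined with the density of spherical harmonics. In terms of the three rotation fields \<open>R\<^sub>i\<close>,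
  \<open>|\<nabla>f|\<^sup>2 = \<Sum>\<^sub>i (R\<^sub>i f)\<^sup>2\<close>, and invariance of \<open>d\<omega>\<close> under rotations yields
  \<open>\<integral> \<Sum>\<^sub>i R\<^sub>i f R\<^sub>i h = l (l + 1) \<integral> f h\<close> for \<open>h\<close> in \<open>\<H>\<^sub>l\<close>, for every \<open>f\<close> that is Lipschitz along
  rotations. Conformality gives \<open>\<Sum>\<^sub>i |R\<^sub>i X|\<^sup>2 = 2 e\<^sup>2\<^sup>\<rho>\<close>, whose integral is \<open>|S| / 2 \<pi>\<close>; also
  \<open>|R\<^sub>i d| \<le> |R\<^sub>i X|\<close> away from the at most one zero of \<open>d\<close>. The bounds for \<open>\<mu>\<^sub>\<phi>\<close> follow from
  \<open>d\<mu>\<^sub>\<phi> = (4 \<pi> / |S|) e\<^sup>2\<^sup>\<rho> d\<omega>\<close>.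

  The area measure of \<open>S\<^sup>2\<close> is realised as three times the Lebesgue measure of cones over subsets of the
  sphere, and that of \<open>S\<close> as the image of \<open>e\<^sup>2\<^sup>\<rho> dA\<close> under \<open>\<phi>\<close>.
\<close>

section \<open>Smooth maps and charts\<close>

text \<open>\<open>area_measure\<close> and \<open>harm_proj\<close> are definite descriptions, so
  existence and uniqueness come before any computation. For the area, cones turn the chart formula
  into the change of variables theorem in R^3, and rotation invariance is inherited from Lebesgue
  measure; the factor 3 is the inverse of the integral of t^2 over [0, 1]. For the projections,
  existence rests on the finite dimension of the space of polynomials of a fixed degree, uniqueness
  on the fact that a continuous function with vanishing square integral is zero. The obstacle in the
  analysis is the distance, which need not be differentiable at a zero. Hence both derivatives in
  Green's formula fall on the harmonic polynomial, and the calculus for \<open>f\<close> reduces to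
  the fact that derivatives along rotations integrate to 0. No infinite series occurs: the residual
  beyond degree L is a finite sum over L < l <= L + k plus a remainder that Stone-Weierstrass makes
  small, and l (l + 1) >= (L + 1) (L + 2) in that sum.\<close>

lemma Ck_on_cong:
  assumes "open U" "\<And>x. x \<in> U \<Longrightarrow> f x = g x"
  shows "Ck_on k U f \<longleftrightarrow> Ck_on k U g"
  using assms(2)
proof (induction k arbitrary: f g)
  case 0
  then show ?case by (simp cong: continuous_on_cong)
next
  case (Suc k)
  have d: "(f has_derivative D) (at x) \<longleftrightarrow> (g has_derivative D) (at x)" if "x \<in> U" for x D
    using has_derivative_transform_within_open[OF _ assms(1) that] Suc.prems by metis
  have fd: "frechet_derivative f (at x) = frechet_derivative g (at x)" if "x \<in> U" for x
    unfolding frechet_derivative_def using d[OF that] by simp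
  have "Ck_on k U (\<lambda>x. frechet_derivative f (at x) v) \<longleftrightarrow> Ck_on k U (\<lambda>x. frechet_derivative g (at x) v)" for v
    by (rule Suc.IH) (simp add: fd)
  moreover have "f differentiable (at x) \<longleftrightarrow> g differentiable (at x)" if "x \<in> U" for x
    using d[OF that] by (simp add: differentiable_def)
  ultimately show ?case by simp
qed

text \<open>Derivatives at a point are unique, so an explicit derivative \<open>f'\<close> can
  replace \<open>frechet_derivative\<close>. Closure under algebraic operations and composition
  passes through this rule.\<close>

lemma Ck_on_SucI:
  assumes "open U" "\<And>x. x \<in> U \<Longrightarrow> (f has_derivative f' x) (at x)"
    "\<And>v. Ck_on k U (\<lambda>x. f' x v)"
  shows "Ck_on (Suc k) U f"
proof -
  have "frechet_derivative f (at x) = f' x" if "x \<in> U" for x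
    using frechet_derivative_at[OF assms(2)[OF that]] by simp
  then have "Ck_on k U (\<lambda>x. frechet_derivative f (at x) v)" for v
    using Ck_on_cong[OF assms(1), of "\<lambda>x. frechet_derivative f (at x) v" "\<lambda>x. f' x v" k] assms(3) by simp
  then show ?thesis
    using assms(2) by (auto simp: differentiable_def)
qed

lemma Ck_on_SucD:
  assumes "Ck_on (Suc k) U f"
  shows "x \<in> U \<Longrightarrow> (f has_derivative frechet_derivative f (at x)) (at x)"
    and "Ck_on k U (\<lambda>x. frechet_derivative f (at x) v)"
  using assms by (auto simp: frechet_derivative_works)

lemma Ck_on_Suc_imp: "Ck_on (Suc k) U f \<Longrightarrow> Ck_on k U f"
proof (induction k arbitrary: f)
  case 0
  then show ?case
    by (auto intro!: continuous_at_imp_continuous_on differentiable_imp_continuous_within)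
next
  case (Suc k)
  have "Ck_on k U (\<lambda>x. frechet_derivative f (at x) v)" for v
    by (rule Suc.IH) (use Suc.prems in simp)
  then show ?case using Suc.prems by simp
qed

lemma Ck_on_subset: "Ck_on k U f \<Longrightarrow> V \<subseteq> U \<Longrightarrow> Ck_on k V f"
proof (induction k arbitrary: f)
  case 0
  then show ?case by (auto intro: continuous_on_subset)
next
  case (Suc k)
  then show ?case by (metis Ck_on.simps(2) subsetD)
qed

text \<open>Continuity and differentiability are conditions at each point; this glues the local
  extensions from which \<open>smooth_map_on\<close> is built.\<close>

lemma Ck_on_local:
  assumes "\<And>x. x \<in> U \<Longrightarrow> \<exists>V. open V \<and> x \<in> V \<and> Ck_on k V f"
  shows "Ck_on k U f"
  using assms
proof (induction k arbitrary: f)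
  case 0
  show ?case
    unfolding Ck_on.simps
  proof (rule continuous_at_imp_continuous_on, rule ballI)
    fix x assume "x \<in> U"
    then obtain V where "open V" "x \<in> V" "continuous_on V f" using 0 by auto
    then show "isCont f x" by (simp add: continuous_on_eq_continuous_at)
  qed
next
  case (Suc k)
  have "Ck_on k U (\<lambda>x. frechet_derivative f (at x) v)" for v
  proof (rule Suc.IH)
    fix x assume "x \<in> U"
    then obtain V where V: "open V" "x \<in> V" "Ck_on (Suc k) V f" using Suc.prems by blast
    then show "\<exists>V. open V \<and> x \<in> V \<and> Ck_on k V (\<lambda>x. frechet_derivative f (at x) v)"
      using Ck_on_SucD(2)[OF V(3)] by blast
  qed
  moreover have "f differentiable (at x)" if "x \<in> U" for x
    using Suc.prems[OF that] by auto
  ultimately show ?case by simp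
qed

lemma Ck_on_const: "open U \<Longrightarrow> Ck_on k U (\<lambda>x. c)"
proof (induction k arbitrary: c)
  case (Suc k)
  show ?case
    by (rule Ck_on_SucI[where f' = "\<lambda>x v. 0"]) (use Suc in auto)
qed simp

lemma Ck_on_bounded_linear:
  assumes "open U" "bounded_linear f"
  shows "Ck_on k U f"
proof (cases k)
  case 0
  then show ?thesis using assms(2) by (simp add: linear_continuous_on)
next
  case (Suc k')
  show ?thesis
    unfolding Suc
    by (rule Ck_on_SucI[OF assms(1) bounded_linear_imp_has_derivative[OF assms(2)] Ck_on_const[OF assms(1)]])
qed

lemma Ck_on_add:
  assumes "open U"
  shows "Ck_on k U f \<Longrightarrow> Ck_on k U g \<Longrightarrow> Ck_on k U (\<lambda>x. f x + g x)"
proof (induction k arbitrary: f g)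
  case 0
  then show ?case by (auto intro: continuous_on_add)
next
  case (Suc k)
  show ?case
  proof (rule Ck_on_SucI[OF assms])
    show "((\<lambda>x. f x + g x) has_derivative (\<lambda>v. frechet_derivative f (at x) v + frechet_derivative g (at x) v)) (at x)"
      if "x \<in> U" for x
      by (rule has_derivative_add[OF Ck_on_SucD(1)[OF Suc.prems(1) that] Ck_on_SucD(1)[OF Suc.prems(2) that]])
    show "Ck_on k U (\<lambda>x. frechet_derivative f (at x) v + frechet_derivative g (at x) v)" for v
      by (rule Suc.IH[OF Ck_on_SucD(2)[OF Suc.prems(1)] Ck_on_SucD(2)[OF Suc.prems(2)]])
  qed
qed

lemma Ck_on_sum:
  assumes "open U" "finite I" "\<And>i. i \<in> I \<Longrightarrow> Ck_on k U (f i)"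
  shows "Ck_on k U (\<lambda>x. \<Sum>i\<in>I. f i x)"
  using assms(2,3)
  by (induction I) (auto intro: Ck_on_add[OF assms(1)] Ck_on_const[OF assms(1)])

lemma Ck_on_bilinear:
  assumes "open U" "bounded_bilinear p"
  shows "Ck_on k U f \<Longrightarrow> Ck_on k U g \<Longrightarrow> Ck_on k U (\<lambda>x. p (f x) (g x))"
proof (induction k arbitrary: f g)
  case 0
  then show ?case using bounded_bilinear.continuous_on[OF assms(2)] by auto
next
  case (Suc k)
  have f: "Ck_on k U f" and g: "Ck_on k U g" using Suc.prems Ck_on_Suc_imp by blast+
  show ?case
  proof (rule Ck_on_SucI[OF assms(1)])
    show "((\<lambda>x. p (f x) (g x)) has_derivative (\<lambda>v. p (f x) (frechet_derivative g (at x) v) +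
      p (frechet_derivative f (at x) v) (g x))) (at x)" if "x \<in> U" for x
      by (rule bounded_bilinear.FDERIV[OF assms(2) Ck_on_SucD(1)[OF Suc.prems(1) that] Ck_on_SucD(1)[OF Suc.prems(2) that]])
    show "Ck_on k U (\<lambda>x. p (f x) (frechet_derivative g (at x) v) + p (frechet_derivative f (at x) v) (g x))" for v
      by (rule Ck_on_add[OF assms(1) Suc.IH[OF f Ck_on_SucD(2)[OF Suc.prems(2)]] Suc.IH[OF Ck_on_SucD(2)[OF Suc.prems(1)] g]])
  qed
qed

lemmas Ck_on_scaleR = Ck_on_bilinear[OF _ bounded_bilinear_scaleR]
lemmas Ck_on_mult = Ck_on_bilinear[OF _ bounded_bilinear_mult]
lemmas Ck_on_inner = Ck_on_bilinear[OF _ bounded_bilinear_inner]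

lemma Ck_on_inverse:
  fixes f :: "'a::euclidean_space \<Rightarrow> real"
  assumes "open U" "\<And>x. x \<in> U \<Longrightarrow> f x \<noteq> 0"
  shows "Ck_on k U f \<Longrightarrow> Ck_on k U (\<lambda>x. inverse (f x))"
proof (induction k)
  case 0
  then show ?case using assms(2) by (auto intro!: continuous_on_inverse)
next
  case (Suc k)
  have "Ck_on k U (\<lambda>x. inverse (f x))" using Suc Ck_on_Suc_imp by blast
  note IH = this
  show ?case
  proof (rule Ck_on_SucI[OF assms(1)])
    show "((\<lambda>x. inverse (f x)) has_derivative (\<lambda>v. (- 1) * (inverse (f x) * frechet_derivative f (at x) v * inverse (f x)))) (at x)"
      if "x \<in> U" for x
      using Deriv.has_derivative_inverse[OF assms(2)[OF that] Ck_on_SucD(1)[OF Suc.prems that]] by simp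
    show "Ck_on k U (\<lambda>x. (- 1) * (inverse (f x) * frechet_derivative f (at x) v * inverse (f x)))" for v
      by (intro Ck_on_mult[OF assms(1)] Ck_on_const[OF assms(1)] IH Ck_on_SucD(2)[OF Suc.prems])
  qed
qed

lemma Ck_on_compose:
  fixes G :: "'a::euclidean_space \<Rightarrow> 'b::euclidean_space"
  assumes "open U" "open V" "G ` U \<subseteq> V"
  shows "Ck_on k V F \<Longrightarrow> Ck_on k U G \<Longrightarrow> Ck_on k U (\<lambda>x. F (G x))"
proof (induction k arbitrary: F)
  case 0
  show ?case
    using continuous_on_compose2[OF 0(1)[unfolded Ck_on.simps] 0(2)[unfolded Ck_on.simps] assms(3)]
    unfolding Ck_on.simps .
next
  case (Suc k)
  let ?F' = "\<lambda>y. frechet_derivative F (at y)" and ?G' = "\<lambda>x. frechet_derivative G (at x)"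
  show ?case
  proof (rule Ck_on_SucI[OF assms(1)])
    fix x assume x: "x \<in> U"
    \<comment> \<open>In F'(G x) (G'(x) v) the direction depends on x, while \<open>Ck_on\<close>
      speaks of fixed directions. Expanding G'(x) v in the basis leaves the fixed directions
      \<open>b\<close>, to which the induction hypothesis applies.\<close>
    show "((\<lambda>x. F (G x)) has_derivative (\<lambda>v. \<Sum>b\<in>Basis. (?G' x v \<bullet> b) *\<^sub>R ?F' (G x) b)) (at x)"
    proof -
      have F: "(F has_derivative ?F' (G x)) (at (G x))"
        by (rule Ck_on_SucD(1)[OF Suc.prems(1)]) (use x assms(3) in blast)
      interpret F: bounded_linear "?F' (G x)" using F by (rule has_derivative_bounded_linear)
      have "?F' (G x) y = (\<Sum>b\<in>Basis. (y \<bullet> b) *\<^sub>R ?F' (G x) b)" for y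
      proof -
        have "?F' (G x) (\<Sum>b\<in>Basis. (y \<bullet> b) *\<^sub>R b) = (\<Sum>b\<in>Basis. (y \<bullet> b) *\<^sub>R ?F' (G x) b)"
          unfolding F.sum F.scaleR ..
        then show ?thesis unfolding euclidean_representation .
      qed
      then show ?thesis
        by (intro has_derivative_eq_rhs[OF has_derivative_compose[OF Ck_on_SucD(1)[OF Suc.prems(2) x] F]] ext)
    qed
  next
    fix v
    have "Ck_on k U (\<lambda>x. ?F' (G x) b)" for b
      by (rule Suc.IH[OF Ck_on_SucD(2)[OF Suc.prems(1)] Ck_on_Suc_imp[OF Suc.prems(2)]])
    moreover have "Ck_on k U (\<lambda>x. ?G' x v \<bullet> b)" for b
      by (rule Ck_on_inner[OF assms(1) Ck_on_SucD(2)[OF Suc.prems(2)] Ck_on_const[OF assms(1)]])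
    ultimately show "Ck_on k U (\<lambda>x. \<Sum>b\<in>Basis. (?G' x v \<bullet> b) *\<^sub>R ?F' (G x) b)"
      by (intro Ck_on_sum[OF assms(1) finite_Basis] Ck_on_scaleR[OF assms(1)])
  qed
qed

section \<open>Smooth maps and diffeomorphisms between arbitrary subsets\<close>

lemma smooth_map_onI:
  assumes "open U" "\<And>k. Ck_on k U f" "A \<subseteq> U"
  shows "smooth_map_on A f"
  unfolding smooth_map_on_def
proof
  fix x assume "x \<in> A"
  then show "\<exists>V F. open V \<and> x \<in> V \<and> (\<forall>k. Ck_on k V F) \<and> (\<forall>y\<in>A \<inter> V. F y = f y)"
    using assms(1,3) by (intro exI[of _ U] exI[of _ f] conjI allI assms(2)) (blast | simp)+
qed

lemma smooth_map_on_cong: "(\<And>x. x \<in> A \<Longrightarrow> f x = g x) \<Longrightarrow> smooth_map_on A f \<longleftrightarrow> smooth_map_on A g"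
  unfolding smooth_map_on_def by simp

lemma smooth_map_on_subset: "smooth_map_on A f \<Longrightarrow> B \<subseteq> A \<Longrightarrow> smooth_map_on B f"
  unfolding smooth_map_on_def
proof
  fix x assume *: "\<forall>x\<in>A. \<exists>V F. open V \<and> x \<in> V \<and> (\<forall>k. Ck_on k V F) \<and> (\<forall>y\<in>A \<inter> V. F y = f y)"
    and B: "B \<subseteq> A" "x \<in> B"
  then have "x \<in> A" by blast
  from bspec[OF * this] obtain V F where V: "open V" "x \<in> V" "\<forall>k. Ck_on k V F" "\<forall>y\<in>A \<inter> V. F y = f y"
    by (elim exE conjE)
  moreover have "\<forall>y\<in>B \<inter> V. F y = f y" using V(4) B(1) by blast
  ultimately show "\<exists>V F. open V \<and> x \<in> V \<and> (\<forall>k. Ck_on k V F) \<and> (\<forall>y\<in>B \<inter> V. F y = f y)"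
    by blast
qed

lemma smooth_map_on_imp_Ck_on:
  assumes "open U" "smooth_map_on U f"
  shows "Ck_on k U f"
proof (rule Ck_on_local)
  fix x assume "x \<in> U"
  then obtain V F where V: "open V" "x \<in> V" "\<And>k. Ck_on k V F" "\<And>y. y \<in> U \<inter> V \<Longrightarrow> F y = f y"
    using assms(2) unfolding smooth_map_on_def by metis
  have "Ck_on k (U \<inter> V) f"
    using Ck_on_cong[of "U \<inter> V" F f k] V assms(1) Ck_on_subset[OF V(3)] by auto
  then show "\<exists>V. open V \<and> x \<in> V \<and> Ck_on k V f"
    using V \<open>x \<in> U\<close> assms(1) by (metis IntI open_Int)
qed

lemma smooth_map_on_imp_continuous_on:
  assumes "smooth_map_on A f"
  shows "continuous_on A f"
  unfolding continuous_on_eq_continuous_within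
proof
  fix x assume x: "x \<in> A"
  then obtain V F where V: "open V" "x \<in> V" "\<And>k. Ck_on k V F" "\<And>y. y \<in> A \<inter> V \<Longrightarrow> F y = f y"
    using assms unfolding smooth_map_on_def by metis
  have "continuous_on V F" using V(3)[of 0] by simp
  then have "continuous (at x within A) F"
    using V continuous_on_eq_continuous_at continuous_at_imp_continuous_at_within by blast
  then have F: "(F \<longlongrightarrow> f x) (at x within A)"
    using V(4)[of x] x V(2) by (simp add: continuous_within)
  have "eventually (\<lambda>y. F y = f y) (at x within A)"
    unfolding eventually_at_topological using V by (metis IntI)
  with F show "continuous (at x within A) f"
    unfolding continuous_within by (rule Lim_transform_eventually)
qed

lemma smooth_map_on_compose:
  fixes f :: "'a::euclidean_space \<Rightarrow> 'b::euclidean_space"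
  assumes f: "smooth_map_on A f" and g: "smooth_map_on B g" and "f ` A \<subseteq> B"
  shows "smooth_map_on A (g \<circ> f)"
  unfolding smooth_map_on_def
proof
  fix x assume x: "x \<in> A"
  then obtain V F where V: "open V" "x \<in> V" "\<And>k. Ck_on k V F" "\<And>y. y \<in> A \<inter> V \<Longrightarrow> F y = f y"
    using f unfolding smooth_map_on_def by metis
  have "f x \<in> B" using x assms(3) by auto
  then obtain W G where W: "open W" "f x \<in> W" "\<And>k. Ck_on k W G" "\<And>y. y \<in> B \<inter> W \<Longrightarrow> G y = g y"
    using g unfolding smooth_map_on_def by metis
  define V' where "V' = V \<inter> F -` W"
  have "continuous_on V F" using V(3)[of 0] by simp
  then have oV': "open V'" unfolding V'_def using V(1) W(1)
    by (metis Int_commute continuous_on_open_vimage)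
  have "Ck_on k V' (\<lambda>x. G (F x))" for k
    by (rule Ck_on_compose[OF oV' W(1) _ W(3) Ck_on_subset[OF V(3)]]) (auto simp: V'_def)
  moreover have "x \<in> V'" using V(4)[of x] x V(2) W(2) by (simp add: V'_def)
  moreover have "G (F y) = (g \<circ> f) y" if "y \<in> A \<inter> V'" for y
    using that V(4)[of y] W(4)[of "f y"] assms(3) by (auto simp: V'_def)
  ultimately show "\<exists>V F. open V \<and> x \<in> V \<and> (\<forall>k. Ck_on k V F) \<and> (\<forall>y\<in>A \<inter> V. F y = (g \<circ> f) y)"
    using oV' by blast
qed

lemma diffeoI:
  assumes "f ` A = B" "\<And>x. x \<in> A \<Longrightarrow> h (f x) = x" "smooth_map_on A f" "smooth_map_on B h"
  shows "diffeo A B f"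
proof -
  have inj: "inj_on f A" using assms(2) by (rule inj_on_inverseI)
  have "inv_into A f y = h y" if "y \<in> B" for y
    using that assms(1,2) inj by (auto simp: inv_into_f_f)
  then show ?thesis
    unfolding diffeo_def bij_betw_def using assms inj smooth_map_on_cong[of B "inv_into A f" h] by simp
qed

lemma diffeoD:
  assumes "diffeo A B f"
  shows "inj_on f A" "f ` A = B" "smooth_map_on A f" "smooth_map_on B (inv_into A f)"
  using assms by (auto simp: diffeo_def bij_betw_def)

lemma diffeo_inv:
  assumes "diffeo A B f"
  shows "diffeo B A (inv_into A f)"
  using diffeoD[OF assms] by (intro diffeoI[of _ _ _ f]) (auto simp: f_inv_into_f image_iff inv_into_into)

lemma diffeo_compose:
  assumes f: "diffeo A B f" and g: "diffeo B C g"
  shows "diffeo A C (g \<circ> f)"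
proof (rule diffeoI[of _ _ _ "inv_into A f \<circ> inv_into B g"])
  show "smooth_map_on A (g \<circ> f)"
    using diffeoD[OF f] diffeoD[OF g] by (intro smooth_map_on_compose) auto
  show "smooth_map_on C (inv_into A f \<circ> inv_into B g)"
    using diffeoD[OF f] diffeoD[OF g] diffeoD(2)[OF diffeo_inv[OF g]] by (intro smooth_map_on_compose) auto
qed (use diffeoD[OF f] diffeoD[OF g] in \<open>auto simp: inv_into_f_f image_comp[symmetric]\<close>)

lemma diffeo_subset:
  assumes f: "diffeo A B f" and "A' \<subseteq> A"
  shows "diffeo A' (f ` A') f"
  by (rule diffeoI[of _ _ _ "inv_into A f"])
     (use diffeoD[OF f] assms(2) in \<open>auto intro: smooth_map_on_subset simp: inv_into_f_f subset_iff\<close>)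

lemma diffeo_homeomorphism:
  assumes "diffeo A B f"
  shows "homeomorphism A B f (inv_into A f)"
  using diffeoD[OF assms] diffeoD[OF diffeo_inv[OF assms]]
  by (auto simp: homeomorphism_def smooth_map_on_imp_continuous_on f_inv_into_f)

text \<open>Used in both directions: it carries the stereographic charts to \<open>S\<close>, and it
  pulls arbitrary charts of \<open>S\<close> back to the sphere.\<close>

lemma local_param_diffeo:
  assumes \<psi>: "diffeo S T \<psi>" and f: "local_param S U f"
  shows "local_param T U (\<psi> \<circ> f)"
proof -
  have o: "openin (top_of_set S) (f ` U)" and d: "diffeo U (f ` U) f" and "open U"
    using f by (auto simp: local_param_def)
  have "f ` U \<subseteq> S" using o openin_imp_subset by blast
  then show ?thesis
    unfolding local_param_def image_comp[symmetric]
    using \<open>open U\<close> homeomorphism_imp_open_map[OF diffeo_homeomorphism[OF \<psi>] o]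
      diffeo_compose[OF d diffeo_subset[OF \<psi>]] by simp
qed

text \<open>For s = 1 or s = -1, the inverse of stereographic projection from the pole (0, 0,
  s).\<close>

definition stereo :: "real \<Rightarrow> real^2 \<Rightarrow> real^3" where
  "stereo s x = inverse (x \<bullet> x + 1) *\<^sub>R
     ((2 * x $ 1) *\<^sub>R axis 1 1 + (2 * x $ 2) *\<^sub>R axis 2 1 + (s * (x \<bullet> x - 1)) *\<^sub>R axis 3 1)"

definition stereo_inv :: "real \<Rightarrow> real^3 \<Rightarrow> real^2" where
  "stereo_inv s y = inverse (1 - s * y $ 3) *\<^sub>R (y $ 1 *\<^sub>R axis 1 1 + y $ 2 *\<^sub>R axis 2 1)"

lemma Ck_on_component: "open U \<Longrightarrow> Ck_on k U (\<lambda>x. x $ i)"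
  by (simp add: Ck_on_bounded_linear bounded_linear_vec_nth)

lemma smooth_stereo: "smooth_map_on UNIV (stereo s)"
proof (rule smooth_map_onI[OF open_UNIV])
  fix k
  have id: "Ck_on k UNIV (\<lambda>x::real^2. x)"
    by (simp add: Ck_on_bounded_linear bounded_linear_ident)
  have nz: "x \<bullet> x + 1 \<noteq> 0" for x :: "real^2"
    using inner_ge_zero[of x] by linarith
  have "Ck_on k UNIV (\<lambda>x::real^2. inverse (x \<bullet> x + 1) *\<^sub>R
     ((2 * x $ 1) *\<^sub>R axis 1 1 + (2 * x $ 2) *\<^sub>R axis 2 1 + (s * (x \<bullet> x + (-1))) *\<^sub>R axis 3 1 :: real^3))"
    by (intro Ck_on_scaleR Ck_on_inverse Ck_on_add Ck_on_inner Ck_on_const Ck_on_mult Ck_on_component open_UNIV nz id)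
  then show "Ck_on k UNIV (stereo s)"
    by (simp add: stereo_def[abs_def])
qed auto

lemma smooth_stereo_inv: "smooth_map_on {y. s * y $ 3 \<noteq> 1} (stereo_inv s)"
proof -
  let ?U = "{y::real^3. s * y $ 3 \<noteq> 1}"
  have o: "open ?U"
    by (intro open_Collect_neq continuous_intros)
  show ?thesis
  proof (rule smooth_map_onI[OF o])
    fix k
    have nz: "1 + (- s) * y $ 3 \<noteq> 0" if "y \<in> ?U" for y
      using that by auto
    have "Ck_on k ?U (\<lambda>y. inverse (1 + (- s) * y $ 3) *\<^sub>R (y $ 1 *\<^sub>R axis 1 1 + y $ 2 *\<^sub>R axis 2 1 :: real^2))"
      by (intro Ck_on_scaleR Ck_on_inverse Ck_on_add Ck_on_inner Ck_on_const Ck_on_mult Ck_on_component o nz)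
    then show "Ck_on k ?U (stereo_inv s)"
      by (simp add: stereo_inv_def[abs_def])
  qed auto
qed

lemma local_param_stereo:
  assumes s: "s\<^sup>2 = (1::real)"
  shows "local_param S2 UNIV (stereo s)" and "stereo s ` UNIV = {y \<in> S2. s * y $ 3 \<noteq> 1}"
proof -
  have inner3: "x \<bullet> y = x $ 1 * y $ 1 + x $ 2 * y $ 2 + x $ 3 * y $ 3" for x y :: "real^3"
    by (simp add: inner_vec_def sum_3)
  have inner2: "x \<bullet> y = x $ 1 * y $ 1 + x $ 2 * y $ 2" for x y :: "real^2"
    by (simp add: inner_vec_def sum_2)
  have comp: "stereo s x $ 1 = 2 * x $ 1 / (x \<bullet> x + 1)" "stereo s x $ 2 = 2 * x $ 2 / (x \<bullet> x + 1)"
    "stereo s x $ 3 = s * (x \<bullet> x - 1) / (x \<bullet> x + 1)" for x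
    by (simp_all add: stereo_def axis_def divide_inverse mult.commute)
  have pos: "x \<bullet> x + 1 > 0" for x :: "real^2"
    by (simp add: add_nonneg_pos)
  \<comment> \<open>This factor never vanishes on the image, so the pole is missed; it is also the
    denominator in \<open>stereo_inv\<close>.\<close>
  have s3: "1 - s * stereo s x $ 3 = 2 / (x \<bullet> x + 1)" for x
    using pos[of x] s unfolding comp by (simp add: field_simps power2_eq_square)
  have S2: "y \<in> S2 \<longleftrightarrow> y \<bullet> y = 1" for y :: "real^3"
    by (simp add: norm_eq_1)
  have inS: "stereo s x \<in> S2" for x
  proof -
    define r where "r = x \<bullet> x"
    have r: "r = (x $ 1)\<^sup>2 + (x $ 2)\<^sup>2" by (simp add: r_def inner2 power2_eq_square)
    have "r + 1 > 0" using pos by (simp add: r_def)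
    have "4 * (x $ 1)\<^sup>2 + 4 * (x $ 2)\<^sup>2 + s\<^sup>2 * (r - 1)\<^sup>2 = (r + 1)\<^sup>2"
      unfolding s by (simp add: r power2_eq_square algebra_simps)
    then have "(2 * x $ 1)\<^sup>2 / (r + 1)\<^sup>2 + (2 * x $ 2)\<^sup>2 / (r + 1)\<^sup>2 + (s * (r - 1))\<^sup>2 / (r + 1)\<^sup>2 = 1"
      using \<open>r + 1 > 0\<close> by (simp add: power_mult_distrib add_divide_distrib[symmetric])
    then show ?thesis
      unfolding S2 inner3 comp r_def[symmetric] by (simp add: power2_eq_square)
  qed
  have left: "stereo_inv s (stereo s x) = x" for x
    using pos[of x] unfolding stereo_inv_def s3 by (simp add: comp(1,2) vec_eq_iff forall_2 axis_def)
  have right: "stereo s (stereo_inv s y) = y" if "y \<in> S2" "s * y $ 3 \<noteq> 1" for y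
  proof -
    define a where "a = 1 - s * y $ 3"
    have a: "a \<noteq> 0" using that by (simp add: a_def)
    have y: "(y $ 1)\<^sup>2 + (y $ 2)\<^sup>2 + (y $ 3)\<^sup>2 = 1"
      using that(1) unfolding S2 inner3 power2_eq_square .
    have h: "stereo_inv s y $ 1 = y $ 1 / a" "stereo_inv s y $ 2 = y $ 2 / a"
      by (simp_all add: stereo_inv_def a_def axis_def divide_inverse)
    \<comment> \<open>The equation of the sphere rewritten in terms of \<open>a\<close>; dividing by
      a^2 yields the squared norm of the preimage.\<close>
    have aa: "a * a = 2 * a - ((y $ 1)\<^sup>2 + (y $ 2)\<^sup>2)"
    proof -
      have "a * a = 1 - 2 * (s * y $ 3) + s\<^sup>2 * (y $ 3)\<^sup>2"
        by (simp add: a_def algebra_simps power2_eq_square)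
      then show ?thesis using s y by (simp add: a_def)
    qed
    have hh: "stereo_inv s y \<bullet> stereo_inv s y = 2 / a - 1"
    proof -
      have "stereo_inv s y \<bullet> stereo_inv s y = ((y $ 1)\<^sup>2 + (y $ 2)\<^sup>2) / (a * a)"
        by (simp add: inner2 h power2_eq_square add_divide_distrib)
      also have "\<dots> = (2 * a - a * a) / (a * a)" using aa by simp
      also have "\<dots> = 2 / a - 1" using a by (simp add: field_simps)
      finally show ?thesis .
    qed
    have "s * (2 / a - 1 - 1) / (2 / a - 1 + 1) = s * (1 - a)"
      using a by (simp add: field_simps)
    also have "\<dots> = s\<^sup>2 * y $ 3" by (simp add: a_def power2_eq_square)
    finally have "s * (2 / a - 1 - 1) / (2 / a - 1 + 1) = y $ 3" using s by simp
    then show ?thesis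
      unfolding vec_eq_iff forall_3 comp hh h using a by simp
  qed
  show img: "stereo s ` UNIV = {y \<in> S2. s * y $ 3 \<noteq> 1}" (is "_ = ?B")
  proof
    show "stereo s ` UNIV \<subseteq> ?B"
      using inS s3 pos by (smt (verit, best) divide_eq_0_iff image_iff mem_Collect_eq subsetI)
    show "?B \<subseteq> stereo s ` UNIV"
    proof
      fix y assume "y \<in> ?B"
      then have "stereo s (stereo_inv s y) = y" using right by blast
      then show "y \<in> range (stereo s)" by (rule range_eqI[OF sym])
    qed
  qed
  have "diffeo UNIV (range (stereo s)) (stereo s)"
    by (rule diffeoI[of _ _ _ "stereo_inv s"])
       (auto simp: left smooth_stereo img intro: smooth_map_on_subset[OF smooth_stereo_inv])
  moreover have "openin (top_of_set S2) (range (stereo s))"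
  proof -
    have "open {y::real^3. s * y $ 3 \<noteq> 1}"
      by (intro open_Collect_neq continuous_intros)
    moreover have "?B = S2 \<inter> {y. s * y $ 3 \<noteq> 1}" by auto
    ultimately show ?thesis unfolding img openin_open by blast
  qed
  ultimately show "local_param S2 UNIV (stereo s)"
    by (simp add: local_param_def)
qed

section \<open>The area measure\<close>

lemma emeasure_lborel_box_cart:
  fixes l u :: "real^'n"
  assumes "\<And>i. l $ i \<le> u $ i"
  shows "emeasure lborel (box l u) = ennreal (\<Prod>i\<in>UNIV. u $ i - l $ i)"
proof -
  have "emeasure lborel (box l u) = ennreal (\<Prod>b\<in>Basis. (u - l) \<bullet> b)"
    using assms by (intro emeasure_lborel_box) (auto simp: Basis_vec_def inner_axis)
  also have "(\<Prod>b\<in>Basis. (u - l) \<bullet> b) = (\<Prod>i\<in>UNIV. u $ i - l $ i)"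
    by (simp add: Basis_vec_def cart_eq_inner_axis axis_eq_axis prod.UNION_disjoint inner_diff_left)
  finally show ?thesis .
qed

text \<open>Identifies R^2 x R with R^3, so that Tonelli's theorem can separate the chart variable
  from the radial variable of a cone.\<close>

definition cart3 :: "(real^2) \<times> real \<Rightarrow> real^3" where
  "cart3 = (\<lambda>(x, t). x $ 1 *\<^sub>R axis 1 1 + x $ 2 *\<^sub>R axis 2 1 + t *\<^sub>R axis 3 1)"

definition proj12 :: "real^3 \<Rightarrow> real^2" where
  "proj12 y = y $ 1 *\<^sub>R axis 1 1 + y $ 2 *\<^sub>R axis 2 1"

lemma cart3_nth: "cart3 (x, t) $ 1 = x $ 1" "cart3 (x, t) $ 2 = x $ 2" "cart3 (x, t) $ 3 = t"
  by (simp_all add: cart3_def axis_def)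

lemma proj12_nth: "proj12 y $ 1 = y $ 1" "proj12 y $ 2 = y $ 2"
  by (simp_all add: proj12_def axis_def)

lemma proj12_cart3: "proj12 (cart3 (x, t)) = x"
  by (simp add: vec_eq_iff forall_2 proj12_nth cart3_nth)

lemma cart3_proj12: "cart3 (proj12 y, y $ 3) = y"
  by (simp add: vec_eq_iff forall_3 proj12_nth cart3_nth)

lemma bounded_linear_proj12: "bounded_linear proj12"
  unfolding proj12_def[abs_def] by (intro bounded_linear_add bounded_linear_scaleR_const bounded_linear_vec_nth)

lemma measurable_cart3: "cart3 \<in> borel_measurable (lborel \<Otimes>\<^sub>M lborel)"
proof -
  have "cart3 \<in> borel_measurable borel"
    unfolding cart3_def split_beta' by (intro borel_measurable_continuous_onI continuous_intros)
  then show ?thesis by (simp add: lborel_prod)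
qed

text \<open>Lebesgue measure is determined by its values on boxes, and \<open>cart3\<close> pulls a
  box back to the product of a planar box and an interval.\<close>

lemma lborel_eq_distr_cart3: "lborel = distr (lborel \<Otimes>\<^sub>M lborel) borel cart3"
proof (rule lborel_eqI)
  note m = measurable_cart3
  fix l u :: "real^3" assume "\<And>b. b \<in> Basis \<Longrightarrow> l \<bullet> b \<le> u \<bullet> b"
  then have le: "l $ i \<le> u $ i" for i by (auto simp: Basis_vec_def cart_eq_inner_axis)
  have *: "cart3 -` box l u = box (proj12 l) (proj12 u) \<times> {l $ 3<..<u $ 3}"
    by (auto simp: mem_box_cart forall_3 forall_2 cart3_nth proj12_nth)
  have "emeasure (distr (lborel \<Otimes>\<^sub>M lborel) borel cart3) (box l u) =
    emeasure (lborel \<Otimes>\<^sub>M lborel) (box (proj12 l) (proj12 u) \<times> {l $ 3<..<u $ 3})"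
    by (subst emeasure_distr[OF m]) (auto simp: space_pair_measure *)
  also have "\<dots> = emeasure lborel (box (proj12 l) (proj12 u)) * emeasure lborel {l $ 3<..<u $ 3}"
    by (rule lborel.emeasure_pair_measure_Times) auto
  also have "proj12 l $ i \<le> proj12 u $ i" for i using exhaust_2[of i] le by (auto simp: proj12_nth)
  then have "emeasure lborel (box (proj12 l) (proj12 u)) * emeasure lborel {l $ 3<..<u $ 3} =
      ennreal (\<Prod>i\<in>UNIV. proj12 u $ i - proj12 l $ i) * ennreal (u $ 3 - l $ 3)"
    using le[of 3] by (simp add: emeasure_lborel_box_cart)
  also have "\<dots> = ennreal (\<Prod>i\<in>UNIV. u $ i - l $ i)"
  proof -
    have a: "(\<Prod>i\<in>UNIV. u $ i - l $ i) = (u $ 1 - l $ 1) * (u $ 2 - l $ 2) * (u $ 3 - l $ 3)"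
      unfolding UNIV_3 by simp
    have b: "(\<Prod>i\<in>UNIV. proj12 u $ i - proj12 l $ i) = (u $ 1 - l $ 1) * (u $ 2 - l $ 2)"
      unfolding UNIV_2 by (simp add: proj12_nth)
    show ?thesis
      unfolding a b using le by (intro ennreal_mult[symmetric] mult_nonneg_nonneg) simp_all
  qed
  also have "(\<Prod>i\<in>UNIV. u $ i - l $ i) = (\<Prod>b\<in>Basis. (u - l) \<bullet> b)"
    by (simp add: Basis_vec_def cart_eq_inner_axis axis_eq_axis prod.UNION_disjoint inner_diff_left)
  finally show "emeasure (distr (lborel \<Otimes>\<^sub>M lborel) borel cart3) (box l u) = (\<Prod>b\<in>Basis. (u - l) \<bullet> b)" .
qed simp

lemma nn_integral_lborel_cart3:
  assumes f: "f \<in> borel_measurable borel"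
  shows "(\<integral>\<^sup>+y. f y \<partial>lborel) = (\<integral>\<^sup>+x. (\<integral>\<^sup>+t. f (cart3 (x, t)) \<partial>lborel) \<partial>lborel)"
proof -
  note m = measurable_cart3
  have "(\<integral>\<^sup>+y. f y \<partial>lborel) = (\<integral>\<^sup>+p. f (cart3 p) \<partial>(lborel \<Otimes>\<^sub>M lborel))"
    by (subst lborel_eq_distr_cart3) (rule nn_integral_distr[OF m], simp add: f)
  also have "\<dots> = (\<integral>\<^sup>+x. (\<integral>\<^sup>+t. f (cart3 (x, t)) \<partial>lborel) \<partial>lborel)"
    using lborel.nn_integral_fst[of "\<lambda>p. f (cart3 p)" "lborel :: (real^2) measure"] measurable_compose[OF m f] by simp
  finally show ?thesis .
qed

section \<open>Local parametrizations and cones over the sphere\<close>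

lemma local_paramD:
  assumes "local_param S U g"
  shows "open U" "openin (top_of_set S) (g ` U)" "inj_on g U" "continuous_on U g"
    and "x \<in> U \<Longrightarrow> (g has_derivative frechet_derivative g (at x)) (at x)"
    and "continuous_on U (\<lambda>x. frechet_derivative g (at x) v)"
    and "continuous_on U (area_density g)"
proof -
  show U: "open U" and "openin (top_of_set S) (g ` U)" using assms by (auto simp: local_param_def)
  have d: "diffeo U (g ` U) g" using assms by (simp add: local_param_def)
  show "inj_on g U" "continuous_on U g"
    using diffeoD[OF d] smooth_map_on_imp_continuous_on by auto
  have C: "Ck_on (Suc 0) U g" using smooth_map_on_imp_Ck_on[OF U diffeoD(3)[OF d]] .
  show "x \<in> U \<Longrightarrow> (g has_derivative frechet_derivative g (at x)) (at x)" using Ck_on_SucD(1)[OF C] .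
  show c: "continuous_on U (\<lambda>x. frechet_derivative g (at x) v)" for v
    using Ck_on_SucD(2)[OF C] by simp
  show "continuous_on U (area_density g)"
    unfolding area_density_def[abs_def] Let_def by (intro continuous_intros c)
qed

lemma area_density_nonneg: "0 \<le> area_density g x"
proof -
  have "(a \<bullet> b)\<^sup>2 \<le> (a \<bullet> a) * (b \<bullet> b)" for a b :: "real^3" by (rule Cauchy_Schwarz_ineq)
  then show ?thesis by (simp add: area_density_def Let_def)
qed

text \<open>The chart takes values in the unit sphere, so g . g = 1 can be differentiated.\<close>

lemma local_param_tangent:
  assumes g: "local_param S2 U g" and x: "x \<in> U"
  shows "norm (g x) = 1" "g x \<bullet> frechet_derivative g (at x) v = 0"
proof -
  have S: "norm (g y) = 1" if "y \<in> U" for y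
    using openin_imp_subset[OF local_paramD(2)[OF g]] that by auto
  then show "norm (g x) = 1" using x by simp
  let ?D = "frechet_derivative g (at x)"
  have "((\<lambda>y. g y \<bullet> g y) has_derivative (\<lambda>v. g x \<bullet> ?D v + ?D v \<bullet> g x)) (at x)"
    by (rule has_derivative_inner[OF local_paramD(5)[OF g x] local_paramD(5)[OF g x]])
  moreover have "((\<lambda>y. g y \<bullet> g y) has_derivative (\<lambda>v. 0)) (at x)"
    by (rule has_derivative_transform_within_open[OF has_derivative_const[of 1] local_paramD(1)[OF g] x])
       (simp add: S norm_eq_1[symmetric])
  ultimately have "(\<lambda>v. g x \<bullet> ?D v + ?D v \<bullet> g x) = (\<lambda>v. 0)"
    by (rule has_derivative_unique)
  from fun_cong[OF this, of v] show "g x \<bullet> ?D v = 0" by (simp add: inner_commute)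
qed

text \<open>The solid cone in the unit ball, without its apex: radial projection is defined on all
  of it, and (x, t) -> t g(x) with 0 < t <= 1 is injective.\<close>

definition cone :: "(real^3) set \<Rightarrow> (real^3) set" where
  "cone A = {x. x \<noteq> 0 \<and> norm x \<le> 1 \<and> x /\<^sub>R norm x \<in> A}"

text \<open>The Jacobian determinant of \<open>(x, t) \<mapsto> t g(x)\<close>.\<close>

lemma det_cone_param:
  fixes a b n :: "real^3"
  assumes "linear f" "f (axis 1 1) = t *\<^sub>R a" "f (axis 2 1) = t *\<^sub>R b" "f (axis 3 1) = n"
    and n: "norm n = 1" "n \<bullet> a = 0" "n \<bullet> b = 0"
  shows "\<bar>det (matrix f)\<bar> = t\<^sup>2 * sqrt ((a \<bullet> a) * (b \<bullet> b) - (a \<bullet> b)\<^sup>2)"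
proof -
  have "det (matrix f) = cross3 (f (axis 1 1)) (f (axis 2 1)) \<bullet> f (axis 3 1)"
    by (simp add: det_3 matrix_def cross3_def inner_vec_def sum_3 algebra_simps)
  also have "\<dots> = t\<^sup>2 * (cross3 a b \<bullet> n)"
    unfolding assms by (simp add: cross_mult_left cross_mult_right power2_eq_square)
  finally have det: "det (matrix f) = t\<^sup>2 * (cross3 a b \<bullet> n)" .
  \<comment> \<open>Both \<open>a\<close> and \<open>b\<close> are orthogonal to \<open>n\<close>,
    so their cross product is parallel to \<open>n\<close> and its component along \<open>n\<close>
    carries its whole length.\<close>
  have "cross3 (cross3 a b) n = 0"
    using n by (subst cross_skew) (simp add: Lagrange)
  then have "(cross3 a b \<bullet> n)\<^sup>2 = (norm (cross3 a b))\<^sup>2"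
    using norm_cross_dot[of "cross3 a b" n] n by simp
  also have "\<dots> = (a \<bullet> a) * (b \<bullet> b) - (a \<bullet> b)\<^sup>2"
    unfolding norm_cross unfolding power2_norm_eq_inner ..
  finally have "\<bar>cross3 a b \<bullet> n\<bar> = sqrt ((a \<bullet> a) * (b \<bullet> b) - (a \<bullet> b)\<^sup>2)"
    by (metis real_sqrt_abs)
  then show ?thesis by (simp add: det abs_mult)
qed

lemma borel_local_param_preimage:
  assumes g: "local_param S U g" and A: "A \<in> sets borel"
  shows "{x \<in> U. g x \<in> A} \<in> sets borel"
proof -
  have "g \<in> measurable (restrict_space borel U) borel"
    by (rule borel_measurable_continuous_on_restrict[OF local_paramD(4)[OF g]])
  from measurable_sets[OF this A] have "g -` A \<inter> U \<in> sets (restrict_space borel U)"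
    by (simp add: space_restrict_space)
  then have "g -` A \<inter> U \<in> sets borel"
    using local_paramD(1)[OF g] by (subst (asm) sets_restrict_space_iff) auto
  then show ?thesis by (simp add: vimage_def Int_def conj_commute)
qed

text \<open>\<open>area_density\<close> is known to be continuous on \<open>U\<close> only; cutting
  off by the indicator of \<open>U\<close> gives measurability, and changes nothing on
  \<open>B\<close>.\<close>

lemma borel_area_density:
  assumes g: "local_param S U g" and B: "B \<in> sets borel" "B \<subseteq> U"
  shows "(\<lambda>x. ennreal (area_density g x) * indicator B x) \<in> borel_measurable borel"
proof -
  have "(\<lambda>x. indicator U x *\<^sub>R area_density g x) \<in> borel_measurable borel"
    using borel_measurable_continuous_on_indicator[OF _ local_paramD(7)[OF g]] local_paramD(1)[OF g] by auto
  then have "(\<lambda>x. ennreal (indicator U x *\<^sub>R area_density g x) * indicator B x) \<in> borel_measurable borel"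
    using B by measurable
  also have "(\<lambda>x. ennreal (indicator U x *\<^sub>R area_density g x) * indicator B x) =
      (\<lambda>x. ennreal (area_density g x) * indicator B x)"
    using B by (auto simp: fun_eq_iff split: split_indicator)
  finally show ?thesis .
qed

text \<open>Change of variables for (x, t) -> t g(x), whose Jacobian is t^2 times
  \<open>area_density g x\<close>. By Tonelli the radial integral splits off as 1/3, which the
  factor 3 cancels. What remains is the chart formula that characterises the area measure.\<close>

lemma emeasure_cone_local_param:
  assumes g: "local_param S2 U g" and A: "A \<in> sets borel" "A \<subseteq> g ` U" and cA: "cone A \<in> sets borel"
  shows "3 * emeasure lborel (cone A) = (\<integral>\<^sup>+x\<in>{x\<in>U. g x \<in> A}. ennreal (area_density g x) \<partial>lborel)"
proof -
  note gD = local_paramD[OF g]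
  define B where "B = {x \<in> U. g x \<in> A}"
  have B: "B \<in> sets borel" "B \<subseteq> U"
    using borel_local_param_preimage[OF g A(1)] by (auto simp: B_def)
  let ?D = "\<lambda>x. frechet_derivative g (at x)"
  define T where "T = {y. proj12 y \<in> B \<and> 0 < y $ 3 \<and> y $ 3 \<le> 1}"
  define \<Psi> where "\<Psi> y = y $ 3 *\<^sub>R g (proj12 y)" for y
  define \<Psi>' where "\<Psi>' y v = y $ 3 *\<^sub>R ?D (proj12 y) (proj12 v) + v $ 3 *\<^sub>R g (proj12 y)" for y v
  have mp: "proj12 \<in> borel_measurable borel"
    by (intro borel_measurable_continuous_onI linear_continuous_on bounded_linear_proj12)
  have T: "T \<in> sets borel"
  proof -
    have "T = proj12 -` B \<inter> {y. 0 < y $ 3} \<inter> {y. y $ 3 \<le> 1}" by (auto simp: T_def)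
    moreover have "open {y::real^3. 0 < y $ 3}" "closed {y::real^3. y $ 3 \<le> 1}"
      by (intro open_Collect_less closed_Collect_le continuous_intros)+
    moreover have "proj12 -` B \<in> sets borel" using measurable_sets[OF mp B(1)] by simp
    ultimately show ?thesis by (metis sets.Int borel_open borel_closed)
  qed
  have der: "(\<Psi> has_derivative \<Psi>' y) (at y within T)" if "y \<in> T" for y
  proof -
    have "proj12 y \<in> U" using that B by (auto simp: T_def)
    have "((\<lambda>y. g (proj12 y)) has_derivative (\<lambda>v. ?D (proj12 y) (proj12 v))) (at y)"
      by (rule has_derivative_compose[OF bounded_linear_imp_has_derivative[OF bounded_linear_proj12] gD(5)[OF \<open>proj12 y \<in> U\<close>]])
    from has_derivative_scaleR[OF bounded_linear_imp_has_derivative[OF bounded_linear_vec_nth[of 3]] this]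
    have "(\<Psi> has_derivative \<Psi>' y) (at y)" unfolding \<Psi>_def[abs_def] \<Psi>'_def[abs_def] .
    then show ?thesis by (rule has_derivative_at_withinI)
  qed
  have norm\<Psi>: "norm (\<Psi> y) = y $ 3" if "y \<in> T" for y
    using that B local_param_tangent(1)[OF g, of "proj12 y"] by (auto simp: \<Psi>_def T_def)
  have inj: "inj_on \<Psi> T"
  proof (rule inj_onI)
    fix y z assume yz: "y \<in> T" "z \<in> T" "\<Psi> y = \<Psi> z"
    then have 3: "y $ 3 = z $ 3" using norm\<Psi> by metis
    then have "g (proj12 y) = g (proj12 z)" using yz by (auto simp: \<Psi>_def T_def)
    then have "proj12 y = proj12 z" using gD(3) yz B by (auto simp: T_def inj_on_def)
    then show "y = z" using 3 cart3_proj12 by metis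
  qed
  have img: "\<Psi> ` T = cone A"
  proof
    show "\<Psi> ` T \<subseteq> cone A"
    proof
      fix z assume "z \<in> \<Psi> ` T"
      then obtain y where y: "y \<in> T" "z = \<Psi> y" by auto
      then have "z /\<^sub>R norm z = g (proj12 y)" "norm z = y $ 3" using norm\<Psi>[OF y(1)]
        by (auto simp: \<Psi>_def T_def)
      then show "z \<in> cone A" using y by (auto simp: cone_def T_def B_def)
    qed
    show "cone A \<subseteq> \<Psi> ` T"
    proof
      fix z assume z: "z \<in> cone A"
      then obtain x where x: "x \<in> U" "g x = z /\<^sub>R norm z" using A(2) by (auto simp: cone_def)
      have "z = \<Psi> (cart3 (x, norm z))" using z by (simp add: \<Psi>_def cart3_nth proj12_cart3 x(2) cone_def)
      moreover have "cart3 (x, norm z) \<in> T"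
        using z x by (auto simp: T_def cart3_nth proj12_cart3 cone_def B_def)
      ultimately show "z \<in> \<Psi> ` T" by blast
    qed
  qed
  have "bounded (cone A)" by (rule boundedI[of _ 1]) (auto simp: cone_def)
  then have lm: "cone A \<in> lmeasurable" using cA by (simp add: bounded_set_imp_lmeasurable)
  have det: "\<bar>det (matrix (\<Psi>' y))\<bar> = (y $ 3)\<^sup>2 * area_density g (proj12 y)" if "y \<in> T" for y
    unfolding area_density_def Let_def
  proof (rule det_cone_param[where n = "g (proj12 y)"])
    show "linear (\<Psi>' y)" using der[OF that] by (rule has_derivative_linear)
    have U: "proj12 y \<in> U" using that B by (auto simp: T_def)
    have "linear (?D (proj12 y))" using gD(5)[OF U] by (rule has_derivative_linear)
    then have 0: "?D (proj12 y) 0 = 0" by (rule linear_0)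
    have p: "proj12 (axis 1 1) = axis 1 1" "proj12 (axis 2 1) = axis 2 1" "proj12 (axis 3 1) = 0"
      by (simp_all add: vec_eq_iff forall_2 proj12_nth axis_def)
    show "\<Psi>' y (axis 1 1) = y $ 3 *\<^sub>R ?D (proj12 y) (axis 1 1)"
      "\<Psi>' y (axis 2 1) = y $ 3 *\<^sub>R ?D (proj12 y) (axis 2 1)"
      "\<Psi>' y (axis 3 1) = g (proj12 y)"
      by (simp_all add: \<Psi>'_def p 0) (simp_all add: axis_def)
    show "norm (g (proj12 y)) = 1" "g (proj12 y) \<bullet> ?D (proj12 y) (axis 1 1) = 0"
      "g (proj12 y) \<bullet> ?D (proj12 y) (axis 2 1) = 0"
      using local_param_tangent[OF g U] by auto
  qed
  have "((\<lambda>y. \<bar>det (matrix (\<Psi>' y))\<bar>) has_integral measure lebesgue (cone A)) T"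
    using has_measure_differentiable_image[OF _ der inj, of "measure lebesgue (cone A)"] T lm img by simp
  then have "(\<integral>\<^sup>+y. ennreal \<bar>det (matrix (\<Psi>' y))\<bar> * indicator T y \<partial>lborel) = ennreal (measure lebesgue (cone A))"
    by (rule nn_integral_has_integral_lebesgue'[rotated]) simp
  also have "ennreal (measure lebesgue (cone A)) = emeasure lborel (cone A)"
    using lm cA by (simp add: emeasure_eq_measure2[symmetric] fmeasurable_def)
  finally have "emeasure lborel (cone A) = (\<integral>\<^sup>+y. ennreal \<bar>det (matrix (\<Psi>' y))\<bar> * indicator T y \<partial>lborel)" ..
  also have "\<dots> = (\<integral>\<^sup>+y. (ennreal (area_density g (proj12 y)) * indicator B (proj12 y)) *
      (ennreal ((y $ 3)\<^sup>2) * indicator {0..1} (y $ 3)) \<partial>lborel)"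
  proof (rule nn_integral_cong)
    fix y :: "real^3"
    show "ennreal \<bar>det (matrix (\<Psi>' y))\<bar> * indicator T y =
      (ennreal (area_density g (proj12 y)) * indicator B (proj12 y)) * (ennreal ((y $ 3)\<^sup>2) * indicator {0..1} (y $ 3))"
    proof (cases "y \<in> T")
      case True
      then show ?thesis
        by (simp add: det T_def ennreal_mult area_density_nonneg mult.commute)
    next
      case False
      \<comment> \<open>Height 0 belongs to the closed interval but not to \<open>T\<close>; there
        the factor t^2 vanishes.\<close>
      then show ?thesis by (cases "y $ 3 = 0") (auto simp: T_def indicator_def)
    qed
  qed
  also have "\<dots> = (\<integral>\<^sup>+x. (\<integral>\<^sup>+t. (ennreal (area_density g x) * indicator B x) *
      (ennreal (t\<^sup>2) * indicator {0..1} t) \<partial>lborel) \<partial>lborel)"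
  proof (subst nn_integral_lborel_cart3)
    have "(\<lambda>y::real^3. y $ 3) \<in> borel_measurable borel" by measurable
    then show "(\<lambda>y. (ennreal (area_density g (proj12 y)) * indicator B (proj12 y)) *
      (ennreal ((y $ 3)\<^sup>2) * indicator {0..1} (y $ 3))) \<in> borel_measurable borel"
      using measurable_compose[OF mp borel_area_density[OF g B]] by measurable
  qed (simp add: cart3_nth proj12_cart3)
  also have "\<dots> = (\<integral>\<^sup>+x. (ennreal (area_density g x) * indicator B x) * ennreal (1/3) \<partial>lborel)"
  proof -
    have "(\<integral>\<^sup>+t. ennreal (t\<^sup>2) * indicator {0..1} t \<partial>lborel) = ennreal (1^3 / 3 - 0^3 / 3)"
      by (rule nn_integral_FTC_Icc[where F = "\<lambda>t. t^3/3"]) (auto intro!: derivative_eq_intros)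
    then show ?thesis
      by (subst nn_integral_cmult) auto
  qed
  also have "\<dots> = (\<integral>\<^sup>+x. (ennreal (area_density g x) * indicator B x) \<partial>lborel) * ennreal (1/3)"
    using borel_area_density[OF g B] by (intro nn_integral_multc) simp
  finally have "3 * emeasure lborel (cone A) =
      (\<integral>\<^sup>+x. (ennreal (area_density g x) * indicator B x) \<partial>lborel) * (ennreal 3 * ennreal (1/3))"
    by (simp add: mult_ac)
  also have "ennreal 3 * ennreal (1/3) = 1"
    by (subst ennreal_mult[symmetric]) auto
  finally show ?thesis by (simp add: B_def)
qed

section \<open>Existence and uniqueness of the area measure\<close>

lemma borel_cone:
  assumes "A \<in> sets borel"
  shows "cone A \<in> sets borel"
proof -
  have m: "(\<lambda>x::real^3. x /\<^sub>R norm x) \<in> borel_measurable borel" by measurable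
  have "cone A = (\<lambda>x. x /\<^sub>R norm x) -` A \<inter> (- {0}) \<inter> cball 0 1"
    by (auto simp: cone_def)
  then show ?thesis using measurable_sets[OF m assms] by auto
qed

text \<open>A push-forward under radial projection is a measure by construction, so only the chart
  formula remains to be proved.\<close>

definition sphere_measure :: "(real^3) measure" where
  "sphere_measure = scale_measure 3
     (distr (restrict_space lborel (cone S2)) (restrict_space borel S2) (\<lambda>x. x /\<^sub>R norm x))"

lemma sets_sphere_measure: "sets sphere_measure = sets (restrict_space borel S2)"
  and space_sphere_measure: "space sphere_measure = S2"
  by (simp_all add: sphere_measure_def space_scale_measure space_restrict_space)

lemma sets_restrict_S2: "A \<in> sets (restrict_space borel S2) \<longleftrightarrow> A \<in> sets borel \<and> A \<subseteq> S2"
  by (subst sets_restrict_space_iff) auto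

lemma emeasure_sphere_measure:
  assumes "A \<in> sets borel" "A \<subseteq> S2"
  shows "emeasure sphere_measure A = 3 * emeasure lborel (cone A)"
proof -
  have c: "cone S2 \<in> sets borel" by (rule borel_cone) simp
  have m: "(\<lambda>x. x /\<^sub>R norm x) \<in> measurable (restrict_space lborel (cone S2)) (restrict_space borel S2)"
  proof (rule measurable_restrict_space3)
    show "(\<lambda>x::real^3. x /\<^sub>R norm x) \<in> borel_measurable lborel" by measurable
  qed (auto simp: cone_def)
  have *: "(\<lambda>x. x /\<^sub>R norm x) -` A \<inter> cone S2 = cone A"
    using assms(2) by (auto simp: cone_def)
  have "emeasure (restrict_space lborel (cone S2)) (cone A) = emeasure lborel (cone A)"
    using c assms(2) by (intro emeasure_restrict_space) (auto simp: cone_def)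
  then show ?thesis
    unfolding sphere_measure_def emeasure_scale_measure
    using assms by (subst emeasure_distr[OF m]) (auto simp: sets_restrict_S2 space_restrict_space * )
qed

lemma is_area_measure_sphere: "is_area_measure S2 sphere_measure"
  unfolding is_area_measure_def
proof (intro conjI allI impI ballI)
  fix U f A assume f: "local_param S2 U f" and A: "A \<in> sets sphere_measure" "A \<subseteq> f ` U"
  then have "A \<in> sets borel" "A \<subseteq> S2" by (auto simp: sets_sphere_measure sets_restrict_S2)
  then show "emeasure sphere_measure A = (\<integral>\<^sup>+x\<in>{x\<in>U. f x \<in> A}. ennreal (area_density f x) \<partial>lborel)"
    using emeasure_cone_local_param[OF f _ A(2) borel_cone] emeasure_sphere_measure by simp
qed (simp add: sets_sphere_measure)

lemma openin_imp_sets_restrict: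
  assumes "openin (top_of_set S) V"
  shows "V \<in> sets (restrict_space borel S)"
proof -
  obtain T where "open T" "V = S \<inter> T" using assms unfolding openin_open by blast
  then show ?thesis unfolding sets_restrict_space by (intro image_eqI[of _ _ T]) simp_all
qed

lemma is_area_measureD:
  assumes "is_area_measure S M" "local_param S U f" "A \<in> sets M" "A \<subseteq> f ` U"
  shows "emeasure M A = (\<integral>\<^sup>+x\<in>{x\<in>U. f x \<in> A}. ennreal (area_density f x) \<partial>lborel)"
  using assms unfolding is_area_measure_def by simp

text \<open>The chart formula determines only sets inside a single chart. With two charts covering
  \<open>S\<close>, split \<open>A\<close> into its part in the first and the rest, which lies in
  the second.\<close>

lemma is_area_measure_unique:
  assumes M: "is_area_measure S M" and N: "is_area_measure S N"
    and f1: "local_param S U1 f1" and f2: "local_param S U2 f2" and S: "S \<subseteq> f1 ` U1 \<union> f2 ` U2"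
  shows "M = N"
proof (rule measure_eqI)
  show sets: "sets M = sets N" using M N by (simp add: is_area_measure_def)
  have sM: "sets M = sets (restrict_space borel S)" using M by (simp add: is_area_measure_def)
  have eq: "emeasure M A = emeasure N A" if "local_param S U f" "A \<in> sets M" "A \<subseteq> f ` U" for U f A
    using is_area_measureD[OF M that] is_area_measureD[OF N that(1) _ that(3)] that(2) sets by simp
  fix A assume A: "A \<in> sets M"
  then have AS: "A \<subseteq> S" unfolding sM by (auto simp: sets_restrict_space)
  let ?V = "f1 ` U1"
  have V: "?V \<in> sets M"
    unfolding sM by (rule openin_imp_sets_restrict[OF local_paramD(2)[OF f1]])
  have 1: "A \<inter> ?V \<in> sets M" "A - ?V \<in> sets M" using A V by auto
  have e1: "emeasure M (A \<inter> ?V) = emeasure N (A \<inter> ?V)" by (rule eq[OF f1 1(1)]) simp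
  have e2: "emeasure M (A - ?V) = emeasure N (A - ?V)" by (rule eq[OF f2 1(2)]) (use AS S in blast)
  have "A = (A \<inter> ?V) \<union> (A - ?V)" by blast
  then show "emeasure M A = emeasure N A"
    using plus_emeasure[of "A \<inter> ?V" M "A - ?V"] plus_emeasure[of "A \<inter> ?V" N "A - ?V"] 1 e1 e2 sets
    by (metis Diff_disjoint Int_Diff_disjoint inf_commute inf_left_commute Int_assoc)
qed

lemma stereo_cover: "S2 \<subseteq> stereo 1 ` UNIV \<union> stereo (-1) ` UNIV"
  by (simp add: local_param_stereo(2) subset_iff)

text \<open>Resolves the definite description: composing \<open>\<psi>\<close> with the two
  stereographic charts covers \<open>S\<close>, so uniqueness applies.\<close>

lemma area_measure_eqI:
  assumes \<psi>: "diffeo S2 S \<psi>" and M: "is_area_measure S M"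
  shows "area_measure S = M"
  unfolding area_measure_def
proof (rule the_equality[where P = "is_area_measure S", OF M])
  fix N assume N: "is_area_measure S N"
  have "S = \<psi> ` S2" using diffeoD(2)[OF \<psi>] by simp
  then have "S \<subseteq> (\<psi> \<circ> stereo 1) ` UNIV \<union> (\<psi> \<circ> stereo (-1)) ` UNIV"
    using stereo_cover unfolding image_comp[symmetric] by blast
  then show "N = M"
    using is_area_measure_unique[OF N M] local_param_diffeo[OF \<psi> local_param_stereo(1)] by (metis one_power2 power2_minus)
qed

lemma diffeo_id: "diffeo S2 S2 id"
proof (rule diffeoI[of _ _ _ id])
  show "smooth_map_on S2 id" "smooth_map_on S2 id"
    by (rule smooth_map_onI[of UNIV]; simp add: Ck_on_bounded_linear id_def bounded_linear_ident)+
qed auto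

lemma area_measure_S2: "area_measure S2 = sphere_measure"
  by (rule area_measure_eqI[OF diffeo_id is_area_measure_sphere])

text \<open>The chart formula speaks of sets only; integrals with a weight \<open>w\<close> follow
  once it is read as an equality of measures.\<close>

lemma nn_integral_local_param:
  assumes M: "is_area_measure S2 M" and g: "local_param S2 U g"
    and C: "C \<in> sets M" "C \<subseteq> g ` U" and w: "w \<in> borel_measurable M"
  shows "(\<integral>\<^sup>+u. w u * indicator C u \<partial>M) =
    (\<integral>\<^sup>+x. (w (g x) * ennreal (area_density g x)) * indicator {x\<in>U. g x \<in> C} x \<partial>lborel)"
proof -
  note gD = local_paramD[OF g]
  have sM: "sets M = sets (restrict_space borel S2)" using M by (simp add: is_area_measure_def)
  have gU: "g ` U \<in> sets M" unfolding sM by (rule openin_imp_sets_restrict[OF gD(2)])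
  have gS: "g ` U \<subseteq> S2" using gD(2) openin_imp_subset by blast
  have mg: "g \<in> measurable (restrict_space lborel U) M"
    unfolding measurable_cong_sets[OF refl sM]
  proof (rule measurable_restrict_space2)
    show "g \<in> measurable (restrict_space lborel U) borel"
      using borel_measurable_continuous_on_restrict[OF gD(4)]
      by (subst measurable_cong_sets[OF sets_restrict_space_cong[of lborel borel] refl]) auto
  qed (use gS in \<open>auto simp: space_restrict_space\<close>)
  have ma: "(\<lambda>x. ennreal (area_density g x)) \<in> borel_measurable (restrict_space lborel U)"
    using borel_measurable_continuous_on_restrict[OF gD(7)]
    by (subst measurable_cong_sets[OF sets_restrict_space_cong[of lborel borel] refl]) auto
  let ?L = "density (restrict_space lborel U) (\<lambda>x. ennreal (area_density g x))"
  have U: "U \<inter> space lborel \<in> sets lborel" using gD(1) by simp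
  \<comment> \<open>\<open>M\<close> cut off to the chart is the image under \<open>g\<close> of
    Lebesgue measure weighted by \<open>area_density g\<close>.\<close>
  have "density M (indicator (g ` U)) = distr ?L M g"
  proof (rule measure_eqI)
    fix A assume "A \<in> sets (density M (indicator (g ` U)))"
    then have A: "A \<in> sets M" by simp
    have "emeasure (density M (indicator (g ` U))) A = emeasure M (g ` U \<inter> A)"
      using gU A by (subst emeasure_density) (auto simp: nn_integral_indicator indicator_inter_arith[symmetric])
    also have "\<dots> = (\<integral>\<^sup>+x. ennreal (area_density g x) * indicator {x\<in>U. g x \<in> g ` U \<inter> A} x \<partial>lborel)"
      by (rule is_area_measureD[OF M g]) (use gU A in auto)
    also have "\<dots> = (\<integral>\<^sup>+x. ennreal (area_density g x) * indicator (g -` A \<inter> space (restrict_space lborel U)) x \<partial>restrict_space lborel U)"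
      unfolding nn_integral_restrict_space[OF U]
      by (intro nn_integral_cong) (auto simp: space_restrict_space split: split_indicator)
    also have "\<dots> = emeasure (distr ?L M g) A"
      using measurable_sets[OF mg A] ma mg A
      by (simp add: emeasure_distr emeasure_density)
    finally show "emeasure (density M (indicator (g ` U))) A = emeasure (distr ?L M g) A" .
  qed simp
  moreover have mw: "(\<lambda>u. w u * indicator C u) \<in> borel_measurable M" using w C(1) by measurable
  ultimately have "(\<integral>\<^sup>+u. w u * indicator C u \<partial>(density M (indicator (g ` U)))) =
      (\<integral>\<^sup>+u. w u * indicator C u \<partial>(distr ?L M g))" by simp
  also have "\<dots> = (\<integral>\<^sup>+x. w (g x) * indicator C (g x) \<partial>?L)"
    using mg mw by (intro nn_integral_distr) auto
  also have "\<dots> = (\<integral>\<^sup>+x. ennreal (area_density g x) * (w (g x) * indicator C (g x)) \<partial>restrict_space lborel U)"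
    using ma measurable_compose[OF mg mw] by (intro nn_integral_density) auto
  also have "\<dots> = (\<integral>\<^sup>+x. (w (g x) * ennreal (area_density g x)) * indicator {x\<in>U. g x \<in> C} x \<partial>lborel)"
    unfolding nn_integral_restrict_space[OF U]
    by (intro nn_integral_cong) (auto simp: mult.commute split: split_indicator)
  also have "(\<integral>\<^sup>+u. w u * indicator C u \<partial>(density M (indicator (g ` U)))) = (\<integral>\<^sup>+u. indicator (g ` U) u * (w u * indicator C u) \<partial>M)"
    using mw gU by (intro nn_integral_density) auto
  also have "\<dots> = (\<integral>\<^sup>+u. w u * indicator C u \<partial>M)"
    using C(2) by (intro nn_integral_cong) (auto split: split_indicator)
  finally show ?thesis .
qed

text \<open>\<open>frechet_derivative\<close> means something only where a derivative exists. Near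
  \<open>u\<close> the extension constant along rays is a smooth local extension \<open>F\<close>
  after radial projection, hence differentiable.\<close>

lemma sphere_diff_derivative:
  assumes \<phi>: "smooth_map_on S2 \<phi>" and u: "u \<in> S2"
  shows "((\<lambda>x. \<phi> (x /\<^sub>R norm x)) has_derivative sphere_diff \<phi> u) (at u)"
proof -
  let ?N = "\<lambda>x::real^3. x /\<^sub>R norm x"
  have u0: "u \<noteq> 0" and Nu: "?N u = u" using u by auto
  obtain V F where V: "open V" "u \<in> V" "\<And>k. Ck_on k V F" "\<And>y. y \<in> S2 \<inter> V \<Longrightarrow> F y = \<phi> y"
    using \<phi> u unfolding smooth_map_on_def by metis
  have "F differentiable (at u)" using V(3)[of "Suc 0"] V(2) by simp
  then have "F differentiable (at (?N u))" unfolding Nu .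
  moreover have "?N differentiable (at u)"
  proof (rule differentiable_scaleR)
    show "(\<lambda>x. inverse (norm x)) differentiable (at u)"
      using u0 by (intro differentiable_inverse differentiable_norm_at) auto
  qed simp
  ultimately have FN: "(F \<circ> ?N) differentiable (at u)"
    by (rule differentiable_chain_at[rotated])
  have "continuous_on (- {0}) ?N" by (intro continuous_intros) auto
  then have "open (- {0} \<inter> ?N -` V)"
    using V(1) continuous_on_open_vimage[of "- {0::real^3}" ?N] by (simp add: Int_commute open_Compl)
  moreover have "u \<in> - {0} \<inter> ?N -` V" using u0 Nu V(2) by simp
  moreover have "(F \<circ> ?N) x = \<phi> (?N x)" if "x \<in> - {0} \<inter> ?N -` V" for x
    using that V(4)[of "?N x"] by simp
  moreover obtain D where D: "((F \<circ> ?N) has_derivative D) (at u)"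
    using FN unfolding differentiable_def by blast
  ultimately have "((\<lambda>x. \<phi> (?N x)) has_derivative D) (at u)"
    by (intro has_derivative_transform_within_open[OF D])
  then have "(\<lambda>x. \<phi> (?N x)) differentiable (at u)"
    unfolding differentiable_def by blast
  then show ?thesis unfolding sphere_diff_def by (simp add: frechet_derivative_works[symmetric])
qed

text \<open>By the chain rule the columns of f' are the images under \<open>sphere_diff\<close> of
  those of g', which are tangent to the sphere. So the Gram matrix scales by e^(2 rho) and its
  determinant by e^(4 rho).\<close>

lemma area_density_conformal:
  assumes \<phi>: "smooth_map_on S2 \<phi>" and \<rho>: "has_conformal_factor \<phi> \<rho>"
    and g: "local_param S2 U g" and f: "\<And>x. x \<in> U \<Longrightarrow> f x = \<phi> (g x)" and x: "x \<in> U"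
  shows "area_density f x = exp (2 * \<rho> (g x)) * area_density g x"
proof -
  let ?D = "frechet_derivative g (at x)"
  have n: "norm (g y) = 1" if "y \<in> U" for y using local_param_tangent(1)[OF g that] .
  have u: "g x \<in> S2" using n[OF x] by simp
  have "((\<lambda>y. \<phi> (g y /\<^sub>R norm (g y))) has_derivative (\<lambda>v. sphere_diff \<phi> (g x) (?D v))) (at x)"
    by (rule has_derivative_compose[OF local_paramD(5)[OF g x] sphere_diff_derivative[OF \<phi> u]])
  then have "(f has_derivative (\<lambda>v. sphere_diff \<phi> (g x) (?D v))) (at x)"
    by (rule has_derivative_transform_within_open[OF _ local_paramD(1)[OF g] x]) (simp add: f n)
  then have fd: "frechet_derivative f (at x) = (\<lambda>v. sphere_diff \<phi> (g x) (?D v))"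
    by (rule frechet_derivative_at[symmetric])
  have c: "sphere_diff \<phi> (g x) (?D v) \<bullet> sphere_diff \<phi> (g x) (?D w) = exp (2 * \<rho> (g x)) * (?D v \<bullet> ?D w)" for v w
    using \<rho> u local_param_tangent(2)[OF g x] by (simp add: has_conformal_factor_def)
  define E where "E = exp (2 * \<rho> (g x))"
  have "(E * a) * (E * b) - (E * d)\<^sup>2 = E\<^sup>2 * (a * b - d\<^sup>2)" for a b d
    by (simp add: power2_eq_square algebra_simps)
  moreover have "E > 0" by (simp add: E_def)
  ultimately show ?thesis
    unfolding area_density_def Let_def fd c E_def[symmetric] by (simp add: real_sqrt_mult)
qed

lemma measurable_diffeo:
  assumes "diffeo A B \<psi>"
  shows "\<psi> \<in> measurable (restrict_space borel A) (restrict_space borel B)"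
  using diffeoD[OF assms]
  by (intro measurable_restrict_space2 borel_measurable_continuous_on_restrict smooth_map_on_imp_continuous_on)
    (auto simp: space_restrict_space)

lemma measurable_conformal_factor:
  assumes "has_conformal_factor \<phi> \<rho>"
  shows "(\<lambda>u. exp (2 * \<rho> u)) \<in> borel_measurable (restrict_space borel S2)"
  using assms unfolding has_conformal_factor_def
  by (intro borel_measurable_continuous_on_restrict continuous_intros smooth_map_on_imp_continuous_on) auto

text \<open>A chart \<open>f\<close> of \<open>S\<close> corresponds to the chart \<open>g\<close>
  of the sphere obtained by applying the inverse of \<open>\<phi>\<close>. Their area densities
  differ by e^(2 rho), so the chart formula on \<open>S\<close> is the weighted one on the
  sphere.\<close>

lemma is_area_measure_conformal:
  assumes \<phi>: "diffeo S2 S \<phi>" and \<rho>: "has_conformal_factor \<phi> \<rho>" and M: "is_area_measure S2 M"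
  shows "is_area_measure S (distr (density M (\<lambda>u. ennreal (exp (2 * \<rho> u)))) (restrict_space borel S) \<phi>)"
    (is "is_area_measure S ?N")
  unfolding is_area_measure_def
proof (intro conjI allI impI ballI)
  fix U f A assume f: "local_param S U f" and A: "A \<in> sets ?N" "A \<subseteq> f ` U"
  define g where "g = inv_into S2 \<phi> \<circ> f"
  have g: "local_param S2 U g"
    unfolding g_def by (rule local_param_diffeo[OF diffeo_inv[OF \<phi>] f])
  have fS: "f ` U \<subseteq> S" using local_paramD(2)[OF f] openin_imp_subset by blast
  then have fg: "f x = \<phi> (g x)" if "x \<in> U" for x
    using that diffeoD(2)[OF \<phi>] by (auto simp: g_def f_inv_into_f)
  have gS: "g ` U \<subseteq> S2" using local_paramD(2)[OF g] openin_imp_subset by blast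
  have sM: "sets M = sets (restrict_space borel S2)" using M by (simp add: is_area_measure_def)
  then have spM: "space M = S2" using sets_eq_imp_space_eq[OF sM] by (simp add: space_restrict_space)
  have m\<phi>: "\<phi> \<in> measurable M (restrict_space borel S)"
    unfolding measurable_cong_sets[OF sM refl] by (rule measurable_diffeo[OF \<phi>])
  have mw: "(\<lambda>u. ennreal (exp (2 * \<rho> u))) \<in> borel_measurable M"
    unfolding measurable_cong_sets[OF sM refl] using measurable_conformal_factor[OF \<rho>] by measurable
  define C where "C = \<phi> -` A \<inter> S2"
  have A': "A \<in> sets (restrict_space borel S)" using A by simp
  have C: "C \<in> sets M" using measurable_sets[OF m\<phi> A'] by (simp add: C_def spM)
  have CU: "C \<subseteq> g ` U"
  proof
    fix u assume u: "u \<in> C"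
    then obtain x where x: "x \<in> U" "f x = \<phi> u" using A(2) by (auto simp: C_def)
    then have "g x = u" using u diffeoD(1)[OF \<phi>] by (simp add: g_def C_def inv_into_f_f)
    then show "u \<in> g ` U" using x by blast
  qed
  have "emeasure ?N A = (\<integral>\<^sup>+u. ennreal (exp (2 * \<rho> u)) * indicator C u \<partial>M)"
    using m\<phi> A' mw C by (subst emeasure_distr) (auto simp: C_def[symmetric] spM emeasure_density)
  also have "\<dots> = (\<integral>\<^sup>+x. (ennreal (exp (2 * \<rho> (g x))) * ennreal (area_density g x)) * indicator {x\<in>U. g x \<in> C} x \<partial>lborel)"
    by (rule nn_integral_local_param[OF M g C CU mw])
  also have "\<dots> = (\<integral>\<^sup>+x. ennreal (area_density f x) * indicator {x\<in>U. f x \<in> A} x \<partial>lborel)"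
  proof (intro nn_integral_cong)
    fix x
    show "(ennreal (exp (2 * \<rho> (g x))) * ennreal (area_density g x)) * indicator {x\<in>U. g x \<in> C} x =
      ennreal (area_density f x) * indicator {x\<in>U. f x \<in> A} x"
    proof (cases "x \<in> U")
      case True
      then have "g x \<in> C \<longleftrightarrow> f x \<in> A" using fg gS by (auto simp: C_def)
      moreover have "area_density f x = exp (2 * \<rho> (g x)) * area_density g x"
        by (rule area_density_conformal[OF diffeoD(3)[OF \<phi>] \<rho> g fg True])
      ultimately show ?thesis using True by (simp add: ennreal_mult area_density_nonneg indicator_def)
    qed simp
  qed
  finally show "emeasure ?N A = (\<integral>\<^sup>+x\<in>{x\<in>U. f x \<in> A}. ennreal (area_density f x) \<partial>lborel)" .
qed simp

lemma area_measure_conformal: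
  assumes "diffeo S2 S \<phi>" "has_conformal_factor \<phi> \<rho>"
  shows "area_measure S = distr (density sphere_measure (\<lambda>u. ennreal (exp (2 * \<rho> u)))) (restrict_space borel S) \<phi>"
  by (rule area_measure_eqI[OF assms(1) is_area_measure_conformal[OF assms is_area_measure_sphere]])

text \<open>The push-forward by \<open>\<phi>\<close> that produces the area of \<open>S\<close> is
  undone by the inverse, which leaves the density on the sphere.\<close>

lemma pullback_area_conformal:
  assumes \<phi>: "diffeo S2 S \<phi>" and \<rho>: "has_conformal_factor \<phi> \<rho>"
  shows "pullback_area S \<phi> = density sphere_measure (\<lambda>u. ennreal (exp (2 * \<rho> u)))" (is "_ = ?M")
proof -
  have s: "sets ?M = sets (restrict_space borel S2)" by (simp add: sets_sphere_measure)
  have "pullback_area S \<phi> = distr ?M (restrict_space borel S2) (inv_into S2 \<phi> \<circ> \<phi>)"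
    unfolding pullback_area_def area_measure_conformal[OF assms]
  proof (rule distr_distr)
    show "\<phi> \<in> measurable ?M (restrict_space borel S)"
      unfolding measurable_cong_sets[OF s refl] by (rule measurable_diffeo[OF \<phi>])
    show "inv_into S2 \<phi> \<in> measurable (restrict_space borel S) (restrict_space borel S2)"
      by (rule measurable_diffeo[OF diffeo_inv[OF \<phi>]])
  qed
  also have "\<dots> = distr ?M ?M (\<lambda>u. u)"
    by (rule distr_cong) (use s diffeoD(1)[OF \<phi>] in \<open>auto simp: space_sphere_measure inv_into_f_f\<close>)
  also have "\<dots> = ?M" by (rule distr_id)
  finally show ?thesis .
qed

section \<open>Harmonic polynomials\<close>

definition pd :: "3 \<Rightarrow> (real^3 \<Rightarrow> real) \<Rightarrow> real^3 \<Rightarrow> real" where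
  "pd j p x = frechet_derivative p (at x) (axis j 1)"

lemma pd_eqI: "(p has_derivative D) (at x) \<Longrightarrow> pd j p x = D (axis j 1)"
  unfolding pd_def by (simp add: frechet_derivative_at[symmetric])

lemma poly_has_derivative:
  assumes "real_polynomial_function p"
  shows "(p has_derivative (\<lambda>v. \<Sum>j\<in>UNIV. v $ j * pd j p x)) (at x)"
proof -
  have D: "(p has_derivative frechet_derivative p (at x)) (at x)"
    using differentiable_at_real_polynomial_function[OF assms] by (simp add: frechet_derivative_works[symmetric])
  interpret bounded_linear "frechet_derivative p (at x)" using D by (rule has_derivative_bounded_linear)
  have "frechet_derivative p (at x) v = (\<Sum>j\<in>UNIV. v $ j * pd j p x)" for v
  proof -
    have "v = (\<Sum>j\<in>UNIV. v $ j *\<^sub>R axis j 1)"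
      by (simp add: vec_eq_iff axis_def if_distrib cong: if_cong)
    then have "frechet_derivative p (at x) v = frechet_derivative p (at x) (\<Sum>j\<in>UNIV. v $ j *\<^sub>R axis j 1)" by simp
    then show ?thesis by (simp add: sum scaleR pd_def)
  qed
  then show ?thesis by (intro has_derivative_eq_rhs[OF D] ext)
qed

lemma pd_const: "pd j (\<lambda>x. c) = (\<lambda>x. 0)"
  by (rule ext, subst pd_eqI[OF has_derivative_const]) simp

lemma pd_linear: "bounded_linear f \<Longrightarrow> pd j f = (\<lambda>x. f (axis j 1))"
  by (rule ext, rule pd_eqI[OF bounded_linear_imp_has_derivative])

lemma pd_coord: "pd j (\<lambda>x. x $ i) = (\<lambda>x. if i = j then 1 else 0)"
  by (subst pd_linear) (auto simp: bounded_linear_vec_nth axis_def)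

lemma pd_add:
  assumes "real_polynomial_function p" "real_polynomial_function q"
  shows "pd j (\<lambda>x. p x + q x) = (\<lambda>x. pd j p x + pd j q x)"
  by (rule ext, subst pd_eqI[OF has_derivative_add[OF poly_has_derivative[OF assms(1)] poly_has_derivative[OF assms(2)]]])
     (simp add: axis_def if_distrib[of "\<lambda>a. a * _"] cong: if_cong)

lemma pd_mult:
  assumes "real_polynomial_function p" "real_polynomial_function q"
  shows "pd j (\<lambda>x. p x * q x) = (\<lambda>x. p x * pd j q x + pd j p x * q x)"
  by (rule ext, subst pd_eqI[OF has_derivative_mult[OF poly_has_derivative[OF assms(1)] poly_has_derivative[OF assms(2)]]])
     (simp add: axis_def if_distrib[of "\<lambda>a. a * _"] cong: if_cong)

lemmas rpf_intros = real_polynomial_function.intros(2-4)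
  real_polynomial_function.intros(1)[OF bounded_linear_vec_nth]

lemma rpf_pd: "real_polynomial_function p \<Longrightarrow> real_polynomial_function (pd j p)"
proof (induction p rule: real_polynomial_function.induct)
  case (linear f)
  then show ?case by (simp add: pd_linear rpf_intros)
next
  case (const c)
  then show ?case by (simp add: pd_const rpf_intros)
next
  case (add f g)
  then show ?case by (simp add: pd_add rpf_intros)
next
  case (mult f g)
  then show ?case by (simp add: pd_mult rpf_intros)
qed

lemma rpf_cmult: "real_polynomial_function p \<Longrightarrow> real_polynomial_function (\<lambda>x. c * p x)"
  by (intro rpf_intros)

lemma pd_cmult: "real_polynomial_function p \<Longrightarrow> pd j (\<lambda>x. c * p x) = (\<lambda>x. c * pd j p x)"
  by (simp add: pd_mult rpf_intros pd_const)

lemma rpf_sum: "finite I \<Longrightarrow> (\<And>i. i \<in> I \<Longrightarrow> real_polynomial_function (f i)) \<Longrightarrow> real_polynomial_function (\<lambda>x. \<Sum>i\<in>I. f i x)"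
  by (rule real_polynomial_function_sum)

lemma inner3: "x \<bullet> y = (\<Sum>j\<in>UNIV. x $ j * y $ j)" for x y :: "real^3"
  by (simp add: inner_vec_def)

lemma rpf_inner: "real_polynomial_function (\<lambda>x::real^3. x \<bullet> x)"
  unfolding inner3 by (intro rpf_sum rpf_intros) auto

lemma pd_inner: "pd j (\<lambda>x. x \<bullet> x) = (\<lambda>x. 2 * x $ j)"
  by (rule ext, subst pd_eqI[OF has_derivative_inner[OF has_derivative_ident has_derivative_ident]])
     (simp add: inner_axis inner_axis')

lemma laplacian_eq_pd: "laplacian p x = (\<Sum>j\<in>UNIV. pd j (pd j p) x)"
proof -
  have "laplacian p x = (\<Sum>j\<in>UNIV. frechet_derivative (\<lambda>y. frechet_derivative p (at y) (axis j 1)) (at x) (axis j 1))"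
    unfolding laplacian_def Basis_vec_def by (simp add: axis_eq_axis sum.UNION_disjoint)
  then show ?thesis by (simp add: pd_def[abs_def])
qed

lemma laplacian_add:
  fixes p q :: "real^3 \<Rightarrow> real"
  assumes "real_polynomial_function p" "real_polynomial_function q"
  shows "laplacian (\<lambda>x. p x + q x) x = laplacian p x + laplacian q x"
  using assms by (simp add: laplacian_eq_pd pd_add rpf_pd sum.distrib)

lemma laplacian_cmult:
  fixes p :: "real^3 \<Rightarrow> real"
  assumes "real_polynomial_function p"
  shows "laplacian (\<lambda>x. c * p x) x = c * laplacian p x"
  using assms by (simp add: laplacian_eq_pd pd_cmult rpf_pd sum_distrib_left)

section \<open>Homogeneous polynomials and the operator q -> Delta(|x|^2 q)\<close>

definition hom_poly :: "nat \<Rightarrow> (real^3 \<Rightarrow> real) \<Rightarrow> bool" where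
  "hom_poly n p \<longleftrightarrow> real_polynomial_function p \<and> (\<forall>t x. p (t *\<^sub>R x) = t ^ n * p x)"

lemma hom_polyD: "hom_poly n p \<Longrightarrow> real_polynomial_function p" "hom_poly n p \<Longrightarrow> p (t *\<^sub>R x) = t ^ n * p x"
  by (auto simp: hom_poly_def)

lemma hom_poly_zero: "hom_poly n (\<lambda>x. 0)"
  by (simp add: hom_poly_def rpf_intros)

lemma hom_poly_add: "hom_poly n p \<Longrightarrow> hom_poly n q \<Longrightarrow> hom_poly n (\<lambda>x. p x + q x)"
  by (auto simp: hom_poly_def rpf_intros algebra_simps)

lemma hom_poly_cmult: "hom_poly n p \<Longrightarrow> hom_poly n (\<lambda>x. c * p x)"
  by (auto simp: hom_poly_def rpf_intros)

lemma hom_poly_sum: "finite I \<Longrightarrow> (\<And>i. i \<in> I \<Longrightarrow> hom_poly n (f i)) \<Longrightarrow> hom_poly n (\<lambda>x. \<Sum>i\<in>I. f i x)"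
  by (induction I rule: finite_induct) (auto simp: hom_poly_zero intro: hom_poly_add)

lemma hom_poly_mult: "hom_poly n p \<Longrightarrow> hom_poly m q \<Longrightarrow> hom_poly (n + m) (\<lambda>x. p x * q x)"
  by (auto simp: hom_poly_def rpf_intros power_add)

lemma hom_poly_inner: "hom_poly 2 (\<lambda>x. x \<bullet> x)"
  by (simp add: hom_poly_def rpf_inner power2_eq_square)

lemma hom_poly_euler:
  assumes "hom_poly n p"
  shows "(\<Sum>j\<in>UNIV. x $ j * pd j p x) = real n * p x"
proof -
  have "((\<lambda>t::real. t *\<^sub>R x) has_derivative (\<lambda>t. t *\<^sub>R x)) (at 1)"
    by (intro bounded_linear_imp_has_derivative bounded_linear_scaleR_left)
  from has_derivative_compose[OF this poly_has_derivative[OF hom_polyD(1)[OF assms]]]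
  have "((\<lambda>t. p (t *\<^sub>R x)) has_derivative (\<lambda>t. t * (\<Sum>j\<in>UNIV. x $ j * pd j p x))) (at 1)"
    by (simp add: sum_distrib_left mult.assoc)
  then have 1: "((\<lambda>t. p (t *\<^sub>R x)) has_real_derivative (\<Sum>j\<in>UNIV. x $ j * pd j p x)) (at 1)"
    by (simp add: has_field_derivative_def mult_commute_abs)
  have "((\<lambda>t. t ^ n * p x) has_real_derivative real n * p x) (at 1)"
    by (auto intro!: derivative_eq_intros)
  then have "((\<lambda>t. p (t *\<^sub>R x)) has_real_derivative real n * p x) (at 1)"
    by (simp add: hom_polyD(2)[OF assms])
  with 1 show ?thesis by (rule DERIV_unique)
qed

lemma hom_poly_pd:
  assumes "hom_poly (Suc n) p"
  shows "hom_poly n (pd j p)"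
proof -
  have rp: "real_polynomial_function p" and rq: "real_polynomial_function (pd j p)"
    using hom_polyD(1)[OF assms] rpf_pd by auto
  have nz: "pd j p (t *\<^sub>R x) = t ^ n * pd j p x" if "t \<noteq> 0" for t x
  proof -
    have "((\<lambda>x. t *\<^sub>R x) has_derivative (\<lambda>v. t *\<^sub>R v)) (at x)"
      by (intro bounded_linear_imp_has_derivative bounded_linear_scaleR_right)
    from has_derivative_compose[OF this poly_has_derivative[OF rp]]
    have "pd j (\<lambda>x. p (t *\<^sub>R x)) x = t * pd j p (t *\<^sub>R x)"
      by (rule pd_eqI[THEN trans]) (simp add: axis_def if_distrib[of "\<lambda>a. a * _"] if_distrib[of "\<lambda>a. _ * a"] cong: if_cong)
    moreover have "pd j (\<lambda>x. p (t *\<^sub>R x)) x = t ^ Suc n * pd j p x"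
      using hom_polyD(2)[OF assms] by (simp only: pd_cmult[OF rp])
    ultimately show ?thesis using that by simp
  qed
  \<comment> \<open>At t = 0 the factor t cannot be cancelled, so the value is obtained as a limit;
    for n = 0 the convention 0^0 = 1 is the right one.\<close>
  have "pd j p (0 *\<^sub>R x) = 0 ^ n * pd j p x" for x
  proof (rule tendsto_unique[OF trivial_limit_at])
    have c: "isCont (pd j p) y" for y
      using rq by (intro differentiable_imp_continuous_within differentiable_at_real_polynomial_function)
    have "((\<lambda>t::real. t *\<^sub>R x) \<longlongrightarrow> 0 *\<^sub>R x) (at 0)" by (intro tendsto_intros)
    from isCont_tendsto_compose[OF c this]
    show "((\<lambda>t. pd j p (t *\<^sub>R x)) \<longlongrightarrow> pd j p (0 *\<^sub>R x)) (at 0)" .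
    have "((\<lambda>t::real. t ^ n * pd j p x) \<longlongrightarrow> 0 ^ n * pd j p x) (at 0)" by (intro tendsto_intros)
    then show "((\<lambda>t. pd j p (t *\<^sub>R x)) \<longlongrightarrow> 0 ^ n * pd j p x) (at 0)"
      by (rule Lim_transform_eventually) (auto simp: eventually_at_filter nz)
  qed
  with nz have "pd j p (t *\<^sub>R x) = t ^ n * pd j p x" for t x by (cases "t = 0") auto
  then show ?thesis using rq by (simp add: hom_poly_def)
qed

lemma hom_poly_0_const:
  assumes "hom_poly 0 p"
  shows "p = (\<lambda>x. p 0)"
proof
  fix x show "p x = p 0" using hom_polyD(2)[OF assms, of 0 x] by simp
qed

lemma pd_hom_poly_0: "hom_poly 0 p \<Longrightarrow> pd j p = (\<lambda>x. 0)"
  using hom_poly_0_const pd_const by metis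

lemma laplacian_hom_poly_low:
  assumes "hom_poly n p" "n < 2"
  shows "laplacian p x = 0"
proof (cases n)
  case 0
  then show ?thesis using assms by (simp add: laplacian_eq_pd pd_hom_poly_0 pd_const)
next
  case (Suc m)
  then have "hom_poly 0 (pd j p)" for j using assms hom_poly_pd[of 0 p] by simp
  then show ?thesis by (simp add: laplacian_eq_pd pd_hom_poly_0)
qed

lemma hom_poly_laplacian:
  assumes "hom_poly (Suc (Suc n)) p"
  shows "hom_poly n (laplacian p)"
  unfolding laplacian_eq_pd[abs_def] by (intro hom_poly_sum hom_poly_pd assms) auto

text \<open>Leibniz rule: 6 is the Laplacian of |x|^2 in three dimensions, and the mixed term 4 x .
  grad q equals 4 n q by Euler's identity.\<close>

lemma laplacian_inner_mult:
  assumes q: "hom_poly n q"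
  shows "laplacian (\<lambda>x. (x \<bullet> x) * q x) x = (6 + 4 * real n) * q x + (x \<bullet> x) * laplacian q x"
proof -
  have rq: "real_polynomial_function q" using q by (rule hom_polyD)
  have "pd j (pd j (\<lambda>x. (x \<bullet> x) * q x)) x = 2 * q x + 4 * (x $ j * pd j q x) + (x \<bullet> x) * pd j (pd j q) x" for j
    by (simp add: pd_mult rpf_inner rq pd_inner pd_add rpf_pd rpf_intros pd_coord pd_const algebra_simps)
  then have "laplacian (\<lambda>x. (x \<bullet> x) * q x) x =
      6 * q x + 4 * (\<Sum>j\<in>UNIV. x $ j * pd j q x) + (x \<bullet> x) * laplacian q x"
    by (simp add: laplacian_eq_pd sum.distrib sum_distrib_left)
  then show ?thesis by (simp add: hom_poly_euler[OF q] algebra_simps)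
qed

text \<open>The parameter \<open>a\<close> makes the induction work: it absorbs the eigenvalue produced by
  commuting \<open>\<Delta>\<close> with multiplication by \<open>|x|\<^sup>2\<close>.\<close>

lemma laplacian_inner_mult_surj:
  "hom_poly n p \<Longrightarrow> a \<ge> 0 \<Longrightarrow> \<exists>q. hom_poly n q \<and> (\<forall>x. a * q x + laplacian (\<lambda>y. (y \<bullet> y) * q y) x = p x)"
proof (induction n arbitrary: p a rule: less_induct)
  case (less n)
  define c where "c = a + 6 + 4 * real n"
  have c: "c > 0" using less.prems(2) by (simp add: c_def)
  have rp: "real_polynomial_function p" using less.prems(1) by (rule hom_polyD)
  have eq: "a * q x + laplacian (\<lambda>y. (y \<bullet> y) * q y) x = c * q x + (x \<bullet> x) * laplacian q x" if "hom_poly n q" for q x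
    unfolding laplacian_inner_mult[OF that] c_def by (simp add: algebra_simps)
  show ?case
  proof (cases "n < 2")
    case True
    let ?q = "\<lambda>x. (1 / c) * p x"
    have "hom_poly n ?q" by (rule hom_poly_cmult[OF less.prems(1)])
    then show ?thesis using eq[of ?q] laplacian_hom_poly_low[of n ?q] True c by (intro exI[of _ ?q]) auto
  next
    case False
    then obtain m where m: "n = Suc (Suc m)" by (metis add_2_eq_Suc le_Suc_ex not_less)
    have "hom_poly m (laplacian p)" using less.prems(1) m by (simp add: hom_poly_laplacian)
    then obtain r where r: "hom_poly m r" "\<And>x. c * r x + laplacian (\<lambda>y. (y \<bullet> y) * r y) x = laplacian p x"
      using less.IH[of m "laplacian p" c] m c by auto
    let ?Nr = "\<lambda>x. (x \<bullet> x) * r x"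
    have Nr: "hom_poly n ?Nr" using hom_poly_mult[OF hom_poly_inner r(1)] m by simp
    \<comment> \<open>The equation to solve is c q + |x|^2 Delta q = p. If \<open>r\<close> is to be
      Delta q, then q = (p - |x|^2 r) / c, and applying Delta gives the equation of degree
      \<open>m\<close> that defines \<open>r\<close>.\<close>
    let ?q = "\<lambda>x. (1 / c) * (p x + (- 1) * ?Nr x)"
    have q: "hom_poly n ?q" by (intro hom_poly_cmult hom_poly_add less.prems(1) Nr)
    have "laplacian ?q x = (1 / c) * (laplacian p x + (- 1) * laplacian ?Nr x)" for x
      using rp hom_polyD(1)[OF Nr] by (simp only: laplacian_cmult laplacian_add rpf_intros)
    also have "\<dots> x = r x" for x using r(2)[of x] c by (simp add: field_simps)
    finally have "c * ?q x + (x \<bullet> x) * laplacian ?q x = p x" for x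
      using c by simp
    then show ?thesis using eq[OF q] q by (intro exI[of _ ?q]) simp
  qed
qed

section \<open>Decomposition of polynomials on the sphere into harmonics\<close>

definition harmonic_poly :: "nat \<Rightarrow> (real^3 \<Rightarrow> real) \<Rightarrow> bool" where
  "harmonic_poly l p \<longleftrightarrow> hom_poly l p \<and> (\<forall>x. laplacian p x = 0)"

lemma spherical_harmonics_eq: "spherical_harmonics l = {restrict p S2 | p. harmonic_poly l p}"
  by (auto simp: spherical_harmonics_def harmonic_poly_def hom_poly_def)

lemma harmonic_poly_zero: "harmonic_poly l (\<lambda>x. 0)"
  by (simp add: harmonic_poly_def hom_poly_zero laplacian_eq_pd pd_const)

lemma harmonic_poly_add: "harmonic_poly l p \<Longrightarrow> harmonic_poly l q \<Longrightarrow> harmonic_poly l (\<lambda>x. p x + q x)"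
  using hom_polyD(1) by (auto simp: harmonic_poly_def hom_poly_add laplacian_add)

lemma harmonic_poly_cmult: "harmonic_poly l p \<Longrightarrow> harmonic_poly l (\<lambda>x. c * p x)"
  using hom_polyD(1) by (auto simp: harmonic_poly_def hom_poly_cmult laplacian_cmult)

lemma harmonic_poly_rpf: "harmonic_poly l p \<Longrightarrow> real_polynomial_function p"
  by (simp add: harmonic_poly_def hom_poly_def)

text \<open>Equality is required on the sphere only, where |x|^2 = 1 lets summands of lower degree
  appear.\<close>

definition harm_sum :: "nat \<Rightarrow> (real^3 \<Rightarrow> real) \<Rightarrow> bool" where
  "harm_sum N p \<longleftrightarrow> (\<exists>h. (\<forall>l. harmonic_poly l (h l)) \<and> (\<forall>u\<in>S2. p u = (\<Sum>l\<le>N. h l u)))"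

lemma harm_sum_single:
  assumes "harmonic_poly n p"
  shows "harm_sum n p"
  unfolding harm_sum_def
proof (intro exI conjI allI ballI)
  let ?h = "\<lambda>l. if l = n then p else (\<lambda>x. 0)"
  show "harmonic_poly l (?h l)" for l using assms harmonic_poly_zero by simp
  show "p u = (\<Sum>l\<le>n. ?h l u)" for u by (simp add: if_distrib[of "\<lambda>f. f u"] cong: if_cong)
qed

lemma harm_sum_mono:
  assumes "harm_sum N p" "N \<le> M"
  shows "harm_sum M p"
proof -
  obtain h where h: "\<And>l. harmonic_poly l (h l)" "\<And>u. u \<in> S2 \<Longrightarrow> p u = (\<Sum>l\<le>N. h l u)"
    using assms(1) unfolding harm_sum_def by blast
  let ?h = "\<lambda>l. if l \<le> N then h l else (\<lambda>x. 0)"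
  have "(\<Sum>l\<le>M. ?h l u) = (\<Sum>l\<le>N. h l u)" for u
    using assms(2) by (intro sum.mono_neutral_cong_right) auto
  then show ?thesis
    unfolding harm_sum_def using h harmonic_poly_zero by (intro exI[of _ ?h]) simp
qed

lemma harm_sum_cong: "harm_sum N p \<Longrightarrow> (\<And>u. u \<in> S2 \<Longrightarrow> p u = q u) \<Longrightarrow> harm_sum N q"
  unfolding harm_sum_def by simp

lemma harm_sum_add:
  assumes "harm_sum N p" "harm_sum N q"
  shows "harm_sum N (\<lambda>x. p x + q x)"
proof -
  obtain h where h: "\<And>l. harmonic_poly l (h l)" "\<And>u. u \<in> S2 \<Longrightarrow> p u = (\<Sum>l\<le>N. h l u)"
    using assms(1) unfolding harm_sum_def by blast
  obtain k where k: "\<And>l. harmonic_poly l (k l)" "\<And>u. u \<in> S2 \<Longrightarrow> q u = (\<Sum>l\<le>N. k l u)"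
    using assms(2) unfolding harm_sum_def by blast
  show ?thesis
    unfolding harm_sum_def using h k
    by (intro exI[of _ "\<lambda>l x. h l x + k l x"]) (simp add: harmonic_poly_add sum.distrib)
qed

text \<open>Fischer decomposition: choosing \<open>q\<close> with Delta(|x|^2 q) = Delta p makes h =
  p - |x|^2 q harmonic, and on the sphere p = h + q, where \<open>q\<close> has degree n -
  2.\<close>

lemma harm_sum_hom_poly: "hom_poly n p \<Longrightarrow> harm_sum n p"
proof (induction n arbitrary: p rule: less_induct)
  case (less n)
  show ?case
  proof (cases "n < 2")
    case True
    then have "harmonic_poly n p"
      using less.prems laplacian_hom_poly_low by (simp add: harmonic_poly_def)
    then show ?thesis by (rule harm_sum_single)
  next
    case False
    then obtain m where m: "n = Suc (Suc m)" by (metis add_2_eq_Suc le_Suc_ex not_less)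
    have "hom_poly m (laplacian p)" using less.prems m by (simp add: hom_poly_laplacian)
    then obtain q where q: "hom_poly m q" "\<And>x. laplacian (\<lambda>y. (y \<bullet> y) * q y) x = laplacian p x"
      using laplacian_inner_mult_surj[of m "laplacian p" 0] by auto
    let ?Nq = "\<lambda>x. (x \<bullet> x) * q x"
    have Nq: "hom_poly n ?Nq" using hom_poly_mult[OF hom_poly_inner q(1)] m by simp
    let ?h = "\<lambda>x. p x + (- 1) * ?Nq x"
    have h: "hom_poly n ?h" by (intro hom_poly_cmult hom_poly_add less.prems Nq)
    have "laplacian ?h x = laplacian p x + (- 1) * laplacian ?Nq x" for x
      using hom_polyD(1)[OF less.prems] hom_polyD(1)[OF Nq] by (simp only: laplacian_cmult laplacian_add rpf_intros)
    then have "harmonic_poly n ?h" using h q(2) by (simp add: harmonic_poly_def)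
    then have "harm_sum n (\<lambda>x. ?h x + q x)"
    proof (rule harm_sum_add[OF harm_sum_single])
      show "harm_sum n q" by (rule harm_sum_mono[OF less.IH[OF _ q(1)]]) (simp_all add: m)
    qed
    then show ?thesis
      by (rule harm_sum_cong) (simp add: norm_eq_1)
  qed
qed

text \<open>Sums of homogeneous polynomials of mixed degrees. Degrees are not recorded, so closure
  under products is plain distributivity.\<close>

inductive hom_sum :: "(real^3 \<Rightarrow> real) \<Rightarrow> bool" where
  hom: "hom_poly n p \<Longrightarrow> hom_sum p"
| add: "hom_sum p \<Longrightarrow> hom_sum q \<Longrightarrow> hom_sum (\<lambda>x. p x + q x)"

lemma hom_sum_mult: "hom_sum p \<Longrightarrow> hom_sum q \<Longrightarrow> hom_sum (\<lambda>x. p x * q x)"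
proof (induction p rule: hom_sum.induct)
  case (hom n p)
  from hom(2) show ?case
  proof (induction q rule: hom_sum.induct)
    case (hom m q)
    then show ?case using hom_poly_mult[OF \<open>hom_poly n p\<close>] hom_sum.hom by blast
  next
    case (add q r)
    then show ?case using hom_sum.add by (simp add: distrib_left)
  qed
next
  case (add p r)
  then show ?case using hom_sum.add by (simp add: distrib_right)
qed

lemma hom_sum_rpf: "real_polynomial_function p \<Longrightarrow> hom_sum p"
proof (induction p rule: real_polynomial_function.induct)
  case (linear f)
  have "hom_poly 1 f"
    using linear real_polynomial_function.intros(1) by (simp add: hom_poly_def linear_simps(5))
  then show ?case by (rule hom_sum.hom)
next
  case (const c)
  have "hom_poly 0 (\<lambda>x. c)" by (simp add: hom_poly_def rpf_intros)
  then show ?case by (rule hom_sum.hom)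
next
  case (add p q)
  from add.IH show ?case by (rule hom_sum.add)
next
  case (mult p q)
  from mult.IH show ?case by (rule hom_sum_mult)
qed

text \<open>The bridge from Stone-Weierstrass, which supplies arbitrary polynomials, to spherical
  harmonics.\<close>

lemma harm_sum_rpf:
  assumes "real_polynomial_function p"
  shows "\<exists>N. harm_sum N p"
  using hom_sum_rpf[OF assms]
proof (induction p rule: hom_sum.induct)
  case (hom n p)
  then show ?case using harm_sum_hom_poly by blast
next
  case (add p q)
  then obtain N M where "harm_sum N p" "harm_sum M q" by blast
  then have "harm_sum (max N M) (\<lambda>x. p x + q x)"
    by (intro harm_sum_add[OF harm_sum_mono[of N p] harm_sum_mono[of M q]]) simp_all
  then show ?case by blast
qed

text \<open>Monomials are indexed by words in the coordinates instead of exponents. Many words give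
  the same monomial, which is harmless for a finite spanning family.\<close>

definition monom3 :: "3 list \<Rightarrow> real^3 \<Rightarrow> real" where
  "monom3 js x = prod_list (map (\<lambda>j. x $ j) js)"

text \<open>By Euler's identity p is, up to the factor n + 1, the sum of x_j times its j-th partial
  derivative, and prefixing a word by j multiplies its monomial by x_j. This bounds the dimension of
  the space of harmonics.\<close>

lemma hom_poly_monoms:
  "hom_poly n p \<Longrightarrow> \<exists>c. \<forall>x. p x = (\<Sum>js | length js = n. c js * monom3 js x)"
proof (induction n arbitrary: p)
  case 0
  show ?case
  proof (intro exI allI)
    fix x
    show "p x = (\<Sum>js | length js = 0. (\<lambda>_. p 0) js * monom3 js x)"
      using fun_cong[OF hom_poly_0_const[OF 0], of x] by (simp add: monom3_def)
  qed
next
  case (Suc n)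
  have "\<forall>j. \<exists>c. \<forall>x. pd j p x = (\<Sum>js | length js = n. c js * monom3 js x)"
    using Suc.IH hom_poly_pd[OF Suc.prems] by blast
  then obtain c where c: "\<And>j x. pd j p x = (\<Sum>js | length js = n. c j js * monom3 js x)" by metis
  let ?c = "\<lambda>js. c (hd js) (tl js) / real (Suc n)"
  have S: "{js::3 list. length js = Suc n} = (\<lambda>(j, js). j # js) ` (UNIV \<times> {js. length js = n})"
  proof (rule set_eqI)
    fix js :: "3 list"
    show "js \<in> {js. length js = Suc n} \<longleftrightarrow> js \<in> (\<lambda>(j, js). j # js) ` (UNIV \<times> {js. length js = n})"
      by (cases js) auto
  qed
  have "p x = (\<Sum>js | length js = Suc n. ?c js * monom3 js x)" for x
  proof -
    have "real (Suc n) * p x = (\<Sum>j\<in>UNIV. x $ j * pd j p x)" by (rule hom_poly_euler[OF Suc.prems, symmetric])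
    then have "p x = (\<Sum>j\<in>UNIV. x $ j * pd j p x) / real (Suc n)" by (simp add: field_simps)
    also have "\<dots> = (\<Sum>j\<in>UNIV. \<Sum>js | length js = n. ?c (j # js) * monom3 (j # js) x)"
      unfolding c sum_distrib_left sum_divide_distrib by (intro sum.cong refl) (simp add: monom3_def)
    also have "\<dots> = (\<Sum>(j, js)\<in>UNIV \<times> {js. length js = n}. ?c (j # js) * monom3 (j # js) x)"
      by (rule sum.cartesian_product)
    also have "\<dots> = (\<Sum>js | length js = Suc n. ?c js * monom3 js x)"
      unfolding S by (subst sum.reindex) (auto simp: inj_on_def intro!: sum.cong)
    finally show ?thesis .
  qed
  then show ?case by (intro exI[of _ ?c]) simp
qed

section \<open>The round probability measure and rotations\<close>

lemma scale_measure_eq_density: "scale_measure c M = density M (\<lambda>_. c)"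
  by (rule measure_eqI) (simp_all add: emeasure_density nn_integral_cmult_indicator)

lemma round_prob_eq: "round_prob = scale_measure (ennreal (1 / (4 * pi))) sphere_measure"
  by (simp add: round_prob_def area_measure_S2)

lemma sets_round_prob: "sets round_prob = sets (restrict_space borel S2)"
  by (simp add: round_prob_eq sets_sphere_measure)

lemma space_round_prob: "space round_prob = S2"
  by (simp add: round_prob_eq space_scale_measure space_sphere_measure)

lemma emeasure_round_prob:
  assumes "A \<in> sets borel" "A \<subseteq> S2"
  shows "emeasure round_prob A = ennreal (1 / (4 * pi)) * (3 * emeasure lborel (cone A))"
  by (simp add: round_prob_eq emeasure_sphere_measure[OF assms])

lemma null_sets_round_prob:
  assumes "A \<in> sets borel" "A \<subseteq> S2"
  shows "A \<in> null_sets round_prob \<longleftrightarrow> cone A \<in> null_sets lborel"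
  using assms borel_cone[OF assms(1)] emeasure_round_prob[OF assms]
  by (auto simp: null_sets_def sets_round_prob sets_restrict_S2)

lemma finite_measure_round_prob: "finite_measure round_prob"
proof
  have "emeasure lborel (cone S2) \<le> emeasure lborel (cball (0::real^3) 1)"
    by (rule emeasure_mono) (auto simp: cone_def)
  also have "\<dots> < \<infinity>" by (intro emeasure_bounded_finite) auto
  finally show "emeasure round_prob (space round_prob) \<noteq> \<infinity>"
    by (simp add: space_round_prob emeasure_round_prob ennreal_mult_eq_top_iff)
qed

interpretation round_prob: finite_measure round_prob
  by (rule finite_measure_round_prob)

lemma measurable_round_prob:
  assumes "continuous_on S2 f"
  shows "f \<in> borel_measurable round_prob"
  unfolding measurable_cong_sets[OF sets_round_prob refl]
  by (rule borel_measurable_continuous_on_restrict[OF assms])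

lemma integrable_round_prob_bounded:
  fixes f :: "real^3 \<Rightarrow> real"
  assumes "f \<in> borel_measurable round_prob" "\<And>u. u \<in> S2 \<Longrightarrow> \<bar>f u\<bar> \<le> C"
  shows "integrable round_prob f"
  by (rule round_prob.integrable_const_bound[of _ C]) (use assms in \<open>auto simp: space_round_prob\<close>)

lemma continuous_on_S2_bound:
  fixes f :: "real^3 \<Rightarrow> real"
  assumes "continuous_on S2 f"
  obtains C where "C \<ge> 0" "\<And>u. u \<in> S2 \<Longrightarrow> \<bar>f u\<bar> \<le> C"
proof -
  have "compact (f ` S2)" by (rule compact_continuous_image[OF assms]) simp
  then obtain C where "C > 0" "\<And>y. y \<in> f ` S2 \<Longrightarrow> norm y \<le> C"
    using compact_imp_bounded bounded_pos by metis
  then show ?thesis by (intro that[of C]) auto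
qed

lemma integrable_round_prob:
  fixes f :: "real^3 \<Rightarrow> real"
  assumes "continuous_on S2 f"
  shows "integrable round_prob f"
  using continuous_on_S2_bound[OF assms] integrable_round_prob_bounded[OF measurable_round_prob[OF assms]] by metis

lemma integral_round_prob_cong:
  fixes f g :: "real^3 \<Rightarrow> real"
  assumes "\<And>u. u \<in> S2 \<Longrightarrow> f u = g u"
  shows "(\<integral>u. f u \<partial>round_prob) = (\<integral>u. g u \<partial>round_prob)"
  using assms by (intro Bochner_Integration.integral_cong) (auto simp: space_round_prob)

text \<open>If f(u) were nonzero, the cone over a neighbourhood of \<open>u\<close> would contain a
  nonempty open subset of R^3 and could not be null. The L^2 form is thus definite on continuous
  functions, which makes projections unique.\<close>

lemma round_prob_definite:
  assumes f: "continuous_on S2 f" and 0: "(\<integral>u. f u * f u \<partial>round_prob) = (0::real)" and u: "u \<in> S2"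
  shows "f u = 0"
proof (rule ccontr)
  assume nz: "f u \<noteq> 0"
  have "integrable round_prob (\<lambda>u. f u * f u)" by (intro integrable_round_prob continuous_intros f)
  then have ae: "AE u in round_prob. f u * f u = 0"
    using 0 by (subst integral_nonneg_eq_0_iff_AE[symmetric]) auto
  have "openin (top_of_set S2) (S2 \<inter> f -` (- {0}))"
    by (rule continuous_openin_preimage_gen[OF f]) auto
  then obtain T where T: "open T" "S2 \<inter> f -` (- {0}) = S2 \<inter> T" unfolding openin_open by blast
  let ?V = "S2 \<inter> T"
  have V: "?V \<in> sets borel" "?V \<subseteq> S2" using T(1) by auto
  have "?V = {u \<in> space round_prob. \<not> f u * f u = 0}"
    unfolding T(2)[symmetric] space_round_prob by auto
  then have "?V \<in> null_sets round_prob"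
    using ae V by (subst (asm) AE_iff_null) (auto simp: sets_round_prob sets_restrict_S2)
  then have "cone ?V \<in> null_sets lborel" using null_sets_round_prob[OF V] by simp
  then have neg: "negligible (cone ?V)" by (simp add: negligible_iff_null_sets null_sets_completionI)
  let ?N = "\<lambda>x::real^3. x /\<^sub>R norm x"
  define W where "W = (- {0} \<inter> ?N -` T) \<inter> ball 0 1"
  have "continuous_on (- {0}) ?N" by (intro continuous_intros) auto
  then have "open (- {0} \<inter> ?N -` T)"
    using T(1) continuous_on_open_vimage[of "- {0::real^3}" ?N] by (simp add: Int_commute open_Compl)
  then have oW: "open W" unfolding W_def by (rule open_Int[OF _ open_ball])
  have "u \<in> T" using T(2) u nz by blast
  then have "(1/2) *\<^sub>R u \<in> W" using u by (auto simp: W_def)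
  then have "\<not> negligible W" using open_not_negligible[OF oW] by blast
  moreover have "W \<subseteq> cone ?V" by (auto simp: W_def cone_def)
  ultimately show False using neg negligible_subset by blast
qed

text \<open>The cone over a point lies on a line. This disposes of the point where the distance
  vanishes.\<close>

lemma null_sets_round_prob_singleton:
  assumes u: "u \<in> S2"
  shows "{u} \<in> null_sets round_prob"
proof -
  have "cone {u} \<subseteq> span {u}"
  proof
    fix x assume "x \<in> cone {u}"
    then have "x = norm x *\<^sub>R u" by (auto simp: cone_def)
    then show "x \<in> span {u}" by (metis span_base span_scale insertI1)
  qed
  moreover have "dim (span {u}) < DIM(real^3)"
    using dim_le_card'[of "{u}"] by (simp add: dim_span)
  then have "negligible (span {u})" by (rule negligible_lowdim)
  ultimately have "negligible (cone {u})" by (rule negligible_subset[rotated])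
  then have "cone {u} \<in> null_sets lborel"
    using borel_cone[of "{u}"] by (simp add: negligible_iff_null_sets null_sets_completion_iff)
  then show ?thesis using u by (subst null_sets_round_prob) auto
qed

text \<open>Rodrigues' formula for the rotation by the angle \<open>t\<close> about the i-th
  coordinate axis.\<close>

definition rot :: "3 \<Rightarrow> real \<Rightarrow> real^3 \<Rightarrow> real^3" where
  "rot i t x = x $ i *\<^sub>R axis i 1 + cos t *\<^sub>R (x - x $ i *\<^sub>R axis i 1) + sin t *\<^sub>R cross3 (axis i 1) x"

lemma inner_axis1: "axis i 1 \<bullet> x = x $ i" for x :: "real^'n"
  by (simp add: inner_axis')

lemma cross_axis_nth: "cross3 (axis i 1) x $ i = 0"
  using dot_cross_self(1)[of "axis i 1" x] by (simp add: inner_axis1)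

lemma cross_cross_axis: "cross3 (axis i 1) (cross3 (axis i 1) x) = x $ i *\<^sub>R axis i 1 - x"
  unfolding Lagrange by (simp add: inner_axis1 inner_axis_axis)

lemma rot_nth: "rot i t x $ i = x $ i"
  by (simp add: rot_def cross_axis_nth)

lemma cross_rot: "cross3 (axis i 1) (rot i t x) = cos t *\<^sub>R cross3 (axis i 1) x - sin t *\<^sub>R (x - x $ i *\<^sub>R axis i 1)"
  by (simp add: rot_def cross_add_right cross_mult_right Cross3.right_diff_distrib cross_cross_axis scaleR_diff_right)

lemma rot_0: "rot i 0 x = x"
  by (simp add: rot_def)

lemma rot_add: "rot i s (rot i t x) = rot i (s + t) x"
proof -
  let ?P = "x - x $ i *\<^sub>R axis i 1" and ?Q = "cross3 (axis i 1) x"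
  have "rot i s (rot i t x) = x $ i *\<^sub>R axis i 1 + cos s *\<^sub>R (cos t *\<^sub>R ?P + sin t *\<^sub>R ?Q) +
      sin s *\<^sub>R (cos t *\<^sub>R ?Q - sin t *\<^sub>R ?P)"
    unfolding rot_def[of i s] rot_nth cross_rot unfolding rot_def by simp
  also have "\<dots> = x $ i *\<^sub>R axis i 1 + cos (s + t) *\<^sub>R ?P + sin (s + t) *\<^sub>R ?Q"
  proof -
    have "a + cos s *\<^sub>R (cos t *\<^sub>R P + sin t *\<^sub>R Q) + sin s *\<^sub>R (cos t *\<^sub>R Q - sin t *\<^sub>R P) =
      a + cos (s + t) *\<^sub>R P + sin (s + t) *\<^sub>R Q" for a P Q :: "real^3"
      unfolding cos_add sin_add by (simp add: algebra_simps)
    then show ?thesis .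
  qed
  finally show ?thesis by (simp add: rot_def)
qed

lemma rot_has_vector_derivative:
  "((\<lambda>t. rot i t x) has_vector_derivative cross3 (axis i 1) (rot i t x)) (at t)"
  unfolding cross_rot unfolding rot_def
  by (auto intro!: derivative_eq_intros simp: has_vector_derivative_def scaleR_diff_right mult.commute
      has_real_derivative_iff_has_vector_derivative) 

lemma linear_rot: "linear (rot i t)"
  by (rule linearI)
     (simp_all add: rot_def cross_add_right cross_mult_right algebra_simps)

lemma orthogonal_transformation_rot: "orthogonal_transformation (rot i t)"
  unfolding orthogonal_transformation
proof (intro conjI allI linear_rot)
  fix x
  let ?e = "axis i 1 :: real^3"
  let ?P = "x - x $ i *\<^sub>R ?e" and ?Q = "cross3 ?e x"
  have eP: "?e \<bullet> ?P = 0" by (simp add: inner_diff_right inner_axis1 inner_axis_axis)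
  have eQ: "?e \<bullet> ?Q = 0" by (rule dot_cross_self)
  have PQ: "?P \<bullet> ?Q = 0" by (simp add: inner_diff_left dot_cross_self)
  have PP: "?P \<bullet> ?P = x \<bullet> x - (x $ i)\<^sup>2"
    by (simp add: inner_diff_left inner_diff_right inner_axis1 inner_axis_axis inner_axis power2_eq_square)
  have QQ: "?Q \<bullet> ?Q = x \<bullet> x - (x $ i)\<^sup>2"
    by (simp add: dot_cross inner_axis1 inner_axis_axis inner_axis power2_eq_square)
  have "rot i t x \<bullet> rot i t x = (x $ i)\<^sup>2 + (cos t)\<^sup>2 * (?P \<bullet> ?P) + (sin t)\<^sup>2 * (?Q \<bullet> ?Q)"
    unfolding rot_def inner_add_left inner_add_right inner_scaleR_left inner_scaleR_right
    using eP eQ PQ by (simp add: inner_commute inner_axis_axis power2_eq_square)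
  also have "\<dots> = (x $ i)\<^sup>2 + ((cos t)\<^sup>2 + (sin t)\<^sup>2) * (x \<bullet> x - (x $ i)\<^sup>2)"
    unfolding PP QQ by (simp only: distrib_right add.assoc)
  also have "(cos t)\<^sup>2 + (sin t)\<^sup>2 = 1" by simp
  finally have "rot i t x \<bullet> rot i t x = x \<bullet> x" by simp
  then show "norm (rot i t x) = norm x" by (simp add: norm_eq_sqrt_inner)
qed

lemma norm_rot: "norm (rot i t x) = norm x"
  by (rule orthogonal_transformation_norm[OF orthogonal_transformation_rot])

lemma rot_S2: "u \<in> S2 \<Longrightarrow> rot i t u \<in> S2"
  by (simp add: norm_rot)

lemma continuous_on_rot: "continuous_on A (rot i t)"
  by (intro linear_continuous_on linear_conv_bounded_linear[THEN iffD1] linear_rot)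

lemma measurable_rot: "rot i t \<in> measurable round_prob round_prob"
  unfolding measurable_cong_sets[OF sets_round_prob sets_round_prob]
  by (intro measurable_restrict_space2 borel_measurable_continuous_on_restrict continuous_on_rot)
    (auto simp: space_restrict_space norm_rot)

text \<open>Forming cones commutes with rotations, and orthogonal maps preserve Lebesgue
  measure.\<close>

lemma distr_rot: "distr round_prob round_prob (rot i t) = round_prob"
proof (rule measure_eqI)
  fix A assume "A \<in> sets (distr round_prob round_prob (rot i t))"
  then have A: "A \<in> sets round_prob" by simp
  then have AS: "A \<in> sets borel" "A \<subseteq> S2" by (auto simp: sets_round_prob sets_restrict_S2)
  let ?B = "rot i t -` A \<inter> S2"
  have B: "?B \<in> sets round_prob" using measurable_sets[OF measurable_rot A] by (simp add: space_round_prob)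
  then have BS: "?B \<in> sets borel" "?B \<subseteq> S2" by (auto simp: sets_round_prob sets_restrict_S2)
  have "cone ?B = rot i (- t) ` cone A"
  proof (rule set_eqI)
    fix x
    have "x \<in> cone ?B \<longleftrightarrow> rot i t x \<in> cone A"
      using AS(2) linear_scale[OF linear_rot, of i t "inverse (norm x)" x] norm_rot[of i t x]
      by (auto simp: cone_def subset_iff)
    also have "\<dots> \<longleftrightarrow> x \<in> rot i (- t) ` cone A"
    proof
      assume "rot i t x \<in> cone A"
      moreover have "x = rot i (- t) (rot i t x)" by (simp add: rot_add rot_0)
      ultimately show "x \<in> rot i (- t) ` cone A" by (rule image_eqI[rotated])
    qed (auto simp: rot_add rot_0)
    finally show "x \<in> cone ?B \<longleftrightarrow> x \<in> rot i (- t) ` cone A" .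
  qed
  moreover have lm: "cone C \<in> lmeasurable" if "C \<in> sets borel" for C
    using borel_cone[OF that] by (intro bounded_set_imp_lmeasurable boundedI[of _ 1]) (auto simp: cone_def)
  moreover have eq: "emeasure lborel (cone C) = ennreal (measure lebesgue (cone C))" if "C \<in> sets borel" for C
    using lm[OF that] borel_cone[OF that] by (simp add: emeasure_eq_measure2[symmetric] fmeasurable_def)
  ultimately have "measure lebesgue (cone ?B) = measure lebesgue (cone A)"
    using measure_orthogonal_image[OF orthogonal_transformation_rot lm[OF AS(1)]] by simp
  then have "emeasure lborel (cone ?B) = emeasure lborel (cone A)"
    using eq[OF AS(1)] eq[OF BS(1)] by simp
  then have "emeasure round_prob ?B = emeasure round_prob A"
    using emeasure_round_prob AS BS by simp
  then show "emeasure (distr round_prob round_prob (rot i t)) A = emeasure round_prob A"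
    using A by (simp add: emeasure_distr[OF measurable_rot A] space_round_prob)
qed simp

lemma integral_rot:
  fixes f :: "real^3 \<Rightarrow> real"
  assumes "f \<in> borel_measurable round_prob"
  shows "(\<integral>u. f (rot i t u) \<partial>round_prob) = (\<integral>u. f u \<partial>round_prob)"
  using integral_distr[OF measurable_rot assms, of i t] by (simp add: distr_rot)

section \<open>Derivatives along rotations\<close>

text \<open>One class for all integrands: on a finite measure space such functions are integrable,
  they are closed under products, and the possibly discontinuous derivative of the distance is among
  them.\<close>

definition bounded_meas :: "(real^3 \<Rightarrow> real) \<Rightarrow> bool" where
  "bounded_meas f \<longleftrightarrow> f \<in> borel_measurable round_prob \<and> (\<exists>C. \<forall>u\<in>S2. \<bar>f u\<bar> \<le> C)"

lemma bounded_meas_integrable: "bounded_meas f \<Longrightarrow> integrable round_prob f"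
  unfolding bounded_meas_def using integrable_round_prob_bounded by blast

lemma bounded_meas_continuous: "continuous_on S2 f \<Longrightarrow> bounded_meas f"
  unfolding bounded_meas_def using measurable_round_prob continuous_on_S2_bound by metis

lemma bounded_meas_add:
  assumes "bounded_meas f" "bounded_meas g"
  shows "bounded_meas (\<lambda>u. f u + g u)"
proof -
  obtain C D where C: "\<And>u. u \<in> S2 \<Longrightarrow> \<bar>f u\<bar> \<le> C" and D: "\<And>u. u \<in> S2 \<Longrightarrow> \<bar>g u\<bar> \<le> D"
    using assms unfolding bounded_meas_def by blast
  have "\<bar>f u + g u\<bar> \<le> C + D" if "u \<in> S2" for u using C[OF that] D[OF that] by linarith
  then show ?thesis using assms unfolding bounded_meas_def by (intro conjI borel_measurable_add) blast+
qed

lemma bounded_meas_mult: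
  assumes "bounded_meas f" "bounded_meas g"
  shows "bounded_meas (\<lambda>u. f u * g u)"
proof -
  obtain C D where C: "\<And>u. u \<in> S2 \<Longrightarrow> \<bar>f u\<bar> \<le> C" and D: "\<And>u. u \<in> S2 \<Longrightarrow> \<bar>g u\<bar> \<le> D"
    using assms unfolding bounded_meas_def by blast
  have "\<bar>f u * g u\<bar> \<le> C * D" if "u \<in> S2" for u
    unfolding abs_mult using C[OF that] D[OF that] by (intro mult_mono) auto
  then show ?thesis using assms unfolding bounded_meas_def by (intro conjI borel_measurable_times) blast+
qed

lemma bounded_meas_const: "bounded_meas (\<lambda>u. c)"
  by (intro bounded_meas_continuous continuous_intros)

lemma bounded_meas_cmult: "bounded_meas f \<Longrightarrow> bounded_meas (\<lambda>u. c * f u)"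
  by (rule bounded_meas_mult[OF bounded_meas_const])

lemma bounded_meas_diff:
  assumes "bounded_meas f" "bounded_meas g"
  shows "bounded_meas (\<lambda>u. f u - g u)"
  using bounded_meas_add[OF assms(1) bounded_meas_cmult[OF assms(2), of "- 1"]] by simp

lemma bounded_meas_sum:
  "finite I \<Longrightarrow> (\<And>i. i \<in> I \<Longrightarrow> bounded_meas (f i)) \<Longrightarrow> bounded_meas (\<lambda>u. \<Sum>i\<in>I. f i u)"
proof (induction I rule: finite_induct)
  case (insert x F)
  have "bounded_meas (\<lambda>u. f x u + (\<Sum>i\<in>F. f i u))"
    by (rule bounded_meas_add) (use insert in simp_all)
  then show ?case using insert.hyps by simp
qed (simp add: bounded_meas_const)

lemma continuous_on_rpf: "real_polynomial_function p \<Longrightarrow> continuous_on A (p :: real^3 \<Rightarrow> real)"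
  by (intro continuous_at_imp_continuous_on ballI differentiable_imp_continuous_within
      differentiable_at_real_polynomial_function)

lemma bounded_meas_rpf: "real_polynomial_function p \<Longrightarrow> bounded_meas p"
  by (intro bounded_meas_continuous continuous_on_rpf)

abbreviation (input) integ :: "(real^3 \<Rightarrow> real) \<Rightarrow> real" where
  "integ f \<equiv> integral\<^sup>L round_prob f"

lemma integ_add: "bounded_meas f \<Longrightarrow> bounded_meas g \<Longrightarrow> integ (\<lambda>u. f u + g u) = integ f + integ g"
  by (intro Bochner_Integration.integral_add bounded_meas_integrable)

lemma integ_diff: "bounded_meas f \<Longrightarrow> bounded_meas g \<Longrightarrow> integ (\<lambda>u. f u - g u) = integ f - integ g"
  by (intro Bochner_Integration.integral_diff bounded_meas_integrable)

lemma integ_sum: "(\<And>i. i \<in> I \<Longrightarrow> bounded_meas (f i)) \<Longrightarrow> integ (\<lambda>u. \<Sum>i\<in>I. f i u) = (\<Sum>i\<in>I. integ (f i))"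
  by (intro Bochner_Integration.integral_sum bounded_meas_integrable)

text \<open>The derivative is only required almost everywhere because the distance to a point of the surface is
  not differentiable at that point.\<close>

definition rot_deriv :: "3 \<Rightarrow> (real^3 \<Rightarrow> real) \<Rightarrow> (real^3 \<Rightarrow> real) \<Rightarrow> bool" where
  "rot_deriv i f g \<longleftrightarrow> continuous_on S2 f \<and> bounded_meas g \<and>
     (\<exists>C. \<forall>u\<in>S2. \<forall>t. \<bar>f (rot i t u) - f u\<bar> \<le> C * \<bar>t\<bar>) \<and>
     (AE u in round_prob. ((\<lambda>t. f (rot i t u)) has_real_derivative g u) (at 0))"

lemma rot_deriv_bounded_meas: "rot_deriv i f g \<Longrightarrow> bounded_meas f" "rot_deriv i f g \<Longrightarrow> bounded_meas g"
  using bounded_meas_continuous by (auto simp: rot_deriv_def)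

text \<open>Infinitesimal form of rotation invariance: each difference quotient has integral 0, and
  the Lipschitz constant dominates all of them.\<close>

lemma integ_rot_deriv:
  assumes "rot_deriv i f g"
  shows "integ g = 0"
proof -
  obtain C where f: "continuous_on S2 f" and g: "bounded_meas g"
    and C: "\<And>u t. u \<in> S2 \<Longrightarrow> \<bar>f (rot i t u) - f u\<bar> \<le> C * \<bar>t\<bar>"
    and ae: "AE u in round_prob. ((\<lambda>t. f (rot i t u)) has_real_derivative g u) (at 0)"
    using assms unfolding rot_deriv_def by blast
  have mf: "f \<in> borel_measurable round_prob" by (rule measurable_round_prob[OF f])
  have mfr: "(\<lambda>u. f (rot i t u)) \<in> borel_measurable round_prob" for t
    using measurable_compose[OF measurable_rot mf] .
  define q where "q n u = (f (rot i (1 / real (Suc n)) u) - f u) / (1 / real (Suc n))" for n u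
  have "(\<lambda>n. integ (q n)) \<longlonglongrightarrow> integ g"
  proof (rule integral_dominated_convergence[where w = "\<lambda>u. C"])
    show "g \<in> borel_measurable round_prob" using g by (simp add: bounded_meas_def)
    show "q n \<in> borel_measurable round_prob" for n
      unfolding q_def[abs_def] using mf mfr by measurable
    show "integrable round_prob (\<lambda>u. C)" by simp
    show "AE u in round_prob. norm (q n u) \<le> C" for n
    proof (rule AE_I2)
      fix u assume "u \<in> space round_prob"
      then have "u \<in> S2" by (simp add: space_round_prob)
      from C[OF this, of "1 / real (Suc n)"] show "norm (q n u) \<le> C"
        by (simp add: q_def abs_mult divide_simps mult.commute)
    qed
    show "AE u in round_prob. (\<lambda>n. q n u) \<longlonglongrightarrow> g u"
      using ae
    proof eventually_elim
      case (elim u)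
      then have "((\<lambda>h. (f (rot i h u) - f u) / h) \<longlongrightarrow> g u) (at 0)"
        by (simp add: has_field_derivative_iff rot_0)
      moreover have "filterlim (\<lambda>n. 1 / real (Suc n)) (at 0) sequentially"
        using LIMSEQ_Suc[OF lim_1_over_n] by (auto simp: filterlim_at)
      ultimately show ?case
        unfolding q_def by (rule filterlim_compose)
    qed
  qed
  moreover have "integ (q n) = 0" for n
  proof -
    have "rot i (1 / real (Suc n)) ` S2 \<subseteq> S2" using rot_S2 by blast
    then have "integrable round_prob f" "integrable round_prob (\<lambda>u. f (rot i (1 / real (Suc n)) u))"
      by (intro integrable_round_prob f continuous_on_compose2[OF f continuous_on_rot])+
    then have "integ (\<lambda>u. f (rot i (1 / real (Suc n)) u) - f u) = 0"
      using integral_rot[OF mf] by (simp add: Bochner_Integration.integral_diff)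
    then show ?thesis unfolding q_def[abs_def] by simp
  qed
  ultimately show ?thesis by (simp add: LIMSEQ_const_iff)
qed

text \<open>Together with \<open>integ_rot_deriv\<close> this is integration by parts. The Lipschitz
  bound for the product uses that both factors are bounded on the compact sphere.\<close>

lemma rot_deriv_mult:
  assumes f: "rot_deriv i f g" and h: "rot_deriv i h k"
  shows "rot_deriv i (\<lambda>u. f u * h u) (\<lambda>u. f u * k u + g u * h u)"
proof -
  obtain C where cf: "continuous_on S2 f" and g: "bounded_meas g"
    and C: "\<And>u t. u \<in> S2 \<Longrightarrow> \<bar>f (rot i t u) - f u\<bar> \<le> C * \<bar>t\<bar>"
    and aef: "AE u in round_prob. ((\<lambda>t. f (rot i t u)) has_real_derivative g u) (at 0)"
    using f unfolding rot_deriv_def by blast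
  obtain D where ch: "continuous_on S2 h" and k: "bounded_meas k"
    and D: "\<And>u t. u \<in> S2 \<Longrightarrow> \<bar>h (rot i t u) - h u\<bar> \<le> D * \<bar>t\<bar>"
    and aeh: "AE u in round_prob. ((\<lambda>t. h (rot i t u)) has_real_derivative k u) (at 0)"
    using h unfolding rot_deriv_def by blast
  obtain A where A: "A \<ge> 0" "\<And>u. u \<in> S2 \<Longrightarrow> \<bar>f u\<bar> \<le> A" using continuous_on_S2_bound[OF cf] by metis
  obtain B where B: "B \<ge> 0" "\<And>u. u \<in> S2 \<Longrightarrow> \<bar>h u\<bar> \<le> B" using continuous_on_S2_bound[OF ch] by metis
  have "\<bar>f (rot i t u) * h (rot i t u) - f u * h u\<bar> \<le> (A * D + C * B) * \<bar>t\<bar>" if u: "u \<in> S2" for u t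
  proof -
    have "f (rot i t u) * h (rot i t u) - f u * h u = f (rot i t u) * (h (rot i t u) - h u) + (f (rot i t u) - f u) * h u"
      by (simp add: algebra_simps)
    also have "\<bar>\<dots>\<bar> \<le> \<bar>f (rot i t u)\<bar> * \<bar>h (rot i t u) - h u\<bar> + \<bar>f (rot i t u) - f u\<bar> * \<bar>h u\<bar>"
      unfolding abs_mult[symmetric] by (rule abs_triangle_ineq)
    also have "\<dots> \<le> A * (D * \<bar>t\<bar>) + (C * \<bar>t\<bar>) * B"
    proof (intro add_mono mult_mono)
      show "0 \<le> C * \<bar>t\<bar>" using C[OF u, of t] abs_ge_zero order_trans by blast
    qed (use A(1) A(2)[OF rot_S2[OF u]] B(1) B(2)[OF u] C[OF u] D[OF u] in auto)
    finally show ?thesis by (simp add: algebra_simps)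
  qed
  moreover have "AE u in round_prob. ((\<lambda>t. f (rot i t u) * h (rot i t u)) has_real_derivative f u * k u + g u * h u) (at 0)"
    using aef aeh
  proof eventually_elim
    case (elim u)
    from DERIV_mult[OF elim] show ?case by (simp add: rot_0 mult.commute add.commute)
  qed
  moreover have "bounded_meas (\<lambda>u. f u * k u + g u * h u)"
    by (intro bounded_meas_add bounded_meas_mult rot_deriv_bounded_meas[OF f] rot_deriv_bounded_meas[OF h])
  ultimately show ?thesis
    unfolding rot_deriv_def using continuous_on_mult[OF cf ch] by blast
qed

text \<open>By the group law, the derivative at time 0, known at every point of the sphere, gives
  the derivative at time t as the value of \<open>g\<close> at the rotated point; the mean value
  inequality concludes.\<close>

lemma rot_lipschitz:
  fixes f :: "real^3 \<Rightarrow> 'a::real_normed_vector"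
  assumes d: "\<And>u. u \<in> S2 \<Longrightarrow> ((\<lambda>t. f (rot i t u)) has_vector_derivative g u) (at 0)"
    and C: "\<And>u. u \<in> S2 \<Longrightarrow> norm (g u) \<le> C" and u: "u \<in> S2"
  shows "norm (f (rot i t u) - f u) \<le> C * \<bar>t\<bar>"
proof -
  have "((\<lambda>t. f (rot i t u)) has_vector_derivative g (rot i t u)) (at t)" for t
  proof -
    have "((\<lambda>s. s - t) has_vector_derivative 1) (at t)" by (auto intro!: derivative_eq_intros)
    moreover have "((\<lambda>s. f (rot i s (rot i t u))) has_vector_derivative g (rot i t u)) (at (t - t))"
      using d[OF rot_S2[OF u]] by simp
    ultimately have "((\<lambda>s. f (rot i s (rot i t u))) \<circ> (\<lambda>s. s - t) has_vector_derivative 1 *\<^sub>R g (rot i t u)) (at t)"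
      by (rule vector_diff_chain_at)
    then show ?thesis by (simp add: o_def rot_add)
  qed
  then have "((\<lambda>t. f (rot i t u)) has_derivative (\<lambda>x. x *\<^sub>R g (rot i s u))) (at s within UNIV)" for s
    by (simp add: has_vector_derivative_def)
  moreover have "onorm (\<lambda>x. x *\<^sub>R g (rot i s u)) \<le> C" for s
    by (rule onorm_le) (use mult_right_mono[OF C[OF rot_S2[OF u]] abs_ge_zero] in \<open>simp add: mult.commute\<close>)
  ultimately have "norm (f (rot i t u) - f (rot i 0 u)) \<le> C * norm (t - 0)"
    by (intro differentiable_bound[OF convex_UNIV]) auto
  then show ?thesis by (simp add: rot_0)
qed

text \<open>The i-th component of x cross grad, that is, the derivative along the field generating
  the rotations \<open>rot i\<close>.\<close>

definition rotd :: "3 \<Rightarrow> (real^3 \<Rightarrow> real) \<Rightarrow> real^3 \<Rightarrow> real" where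
  "rotd i p x = (\<Sum>j\<in>UNIV. cross3 (axis i 1) x $ j * pd j p x)"

lemma rpf_rotd:
  assumes "real_polynomial_function p"
  shows "real_polynomial_function (rotd i p)"
proof -
  have "linear (cross3 (axis i 1))"
    by (rule linearI) (simp_all add: cross_add_right cross_mult_right)
  then have "bounded_linear (\<lambda>x. cross3 (axis i 1) x $ j)" for j
    by (intro bounded_linear_compose[OF bounded_linear_vec_nth]) (simp add: linear_conv_bounded_linear)
  then show ?thesis
    unfolding rotd_def[abs_def]
    by (intro rpf_sum real_polynomial_function.intros(4) real_polynomial_function.intros(1) rpf_pd assms) simp
qed

lemma rot_deriv_rpf:
  assumes p: "real_polynomial_function p"
  shows "rot_deriv i p (rotd i p)"
proof -
  have bm: "bounded_meas (rotd i p)" by (rule bounded_meas_rpf[OF rpf_rotd[OF p]])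
  then obtain C where C: "\<And>u. u \<in> S2 \<Longrightarrow> \<bar>rotd i p u\<bar> \<le> C" unfolding bounded_meas_def by blast
  have d: "((\<lambda>t. p (rot i t u)) has_vector_derivative rotd i p u) (at 0)" for u
  proof -
    have "((\<lambda>t. rot i t u) has_derivative (\<lambda>s. s *\<^sub>R cross3 (axis i 1) u)) (at 0)"
      using rot_has_vector_derivative[of i u 0] by (simp add: has_vector_derivative_def rot_0)
    from has_derivative_compose[OF this poly_has_derivative[OF p]]
    show ?thesis by (simp add: has_vector_derivative_def rotd_def rot_0 sum_distrib_left mult.assoc)
  qed
  then have "\<bar>p (rot i t u) - p u\<bar> \<le> C * \<bar>t\<bar>" if "u \<in> S2" for u t
    using rot_lipschitz[of p i "rotd i p" C u t] C that by simp
  then show ?thesis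
    unfolding rot_deriv_def
    by (intro conjI bm continuous_on_rpf[OF p] exI[of _ C])
       (auto simp: has_real_derivative_iff_has_vector_derivative d)
qed

lemma pd_diff:
  assumes "real_polynomial_function p" "real_polynomial_function q"
  shows "pd j (\<lambda>x. p x - q x) = (\<lambda>x. pd j p x - pd j q x)"
  using pd_add[OF assms(1) rpf_cmult[OF assms(2), of "- 1"], of j] pd_cmult[OF assms(2), of j "- 1"] by simp

lemma rotd_sum:
  assumes "finite I" "\<And>l. l \<in> I \<Longrightarrow> real_polynomial_function (h l)"
  shows "rotd i (\<lambda>u. \<Sum>l\<in>I. h l u) x = (\<Sum>l\<in>I. rotd i (h l) x)"
  using assms
proof (induction I rule: finite_induct)
  case empty
  then show ?case by (simp add: rotd_def pd_const)
next
  case (insert l I)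
  then have "rotd i (\<lambda>u. h l u + (\<Sum>l\<in>I. h l u)) x = rotd i (h l) x + rotd i (\<lambda>u. \<Sum>l\<in>I. h l u) x"
    by (simp add: rotd_def pd_add rpf_sum distrib_left sum.distrib)
  then show ?case using insert by simp
qed

text \<open>On the sphere, \<open>\<Sum>\<^sub>i R\<^sub>i\<^sup>2 = |x|\<^sup>2 \<Delta> - E (E + 1)\<close> for the rotation fields \<open>R\<^sub>i\<close> and the Euler
  field \<open>E\<close>.\<close>

lemma sum_rotd_rotd_harmonic:
  assumes h: "harmonic_poly l h" and u: "u \<in> S2"
  shows "(\<Sum>i\<in>UNIV. rotd i (rotd i h) u) = - (real l * (real l + 1)) * h u"
proof -
  have hom: "hom_poly l h" and lap: "laplacian h u = 0" using h by (auto simp: harmonic_poly_def)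
  have rh: "real_polynomial_function h" by (rule hom_polyD[OF hom])
  define b where "b k = pd k h u" for k
  define a where "a j k = pd j (pd k h) u" for j k
  \<comment> \<open>Euler's identity for the first derivatives, which have degree l - 1; for l = 0
    they vanish and both sides are 0.\<close>
  have E: "u $ 1 * a 1 k + u $ 2 * a 2 k + u $ 3 * a 3 k = (real l - 1) * b k" for k
  proof (cases l)
    case 0
    then have "pd k h = (\<lambda>x. 0)" for k using hom pd_hom_poly_0 by blast
    then show ?thesis by (simp add: a_def b_def pd_const)
  next
    case (Suc n)
    then show ?thesis using hom_poly_euler[OF hom_poly_pd[of n h k], of u] hom
      by (simp add: sum_3 a_def b_def)
  qed
  have E0: "u $ 1 * b 1 + u $ 2 * b 2 + u $ 3 * b 3 = real l * h u"
    using hom_poly_euler[OF hom, of u] by (simp add: sum_3 b_def)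
  have tr: "a 1 1 + a 2 2 + a 3 3 = 0" using lap by (simp add: laplacian_eq_pd sum_3 a_def)
  have n: "u $ 1 * u $ 1 + u $ 2 * u $ 2 + u $ 3 * u $ 3 = 1"
    using u inner3[of u u] by (simp add: norm_eq_1 sum_3)
  have R: "rotd 1 p = (\<lambda>x. x $ 2 * pd 3 p x - x $ 3 * pd 2 p x)"
    "rotd 2 p = (\<lambda>x. x $ 3 * pd 1 p x - x $ 1 * pd 3 p x)"
    "rotd 3 p = (\<lambda>x. x $ 1 * pd 2 p x - x $ 2 * pd 1 p x)" for p
    by (simp_all add: fun_eq_iff rotd_def sum_3 cross_components axis_def)
  note pds = pd_diff pd_mult pd_coord pd_const rh rpf_pd rpf_intros
  have R1: "rotd 1 (rotd 1 h) u = u $ 2 * (u $ 2 * a 3 3 - b 2 - u $ 3 * a 3 2) - u $ 3 * (b 3 + u $ 2 * a 2 3 - u $ 3 * a 2 2)"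
    unfolding R by (simp add: pds a_def b_def) (simp add: algebra_simps)
  have R2: "rotd 2 (rotd 2 h) u = u $ 3 * (u $ 3 * a 1 1 - b 3 - u $ 1 * a 1 3) - u $ 1 * (b 1 + u $ 3 * a 3 1 - u $ 1 * a 3 3)"
    unfolding R by (simp add: pds a_def b_def) (simp add: algebra_simps)
  have R3: "rotd 3 (rotd 3 h) u = u $ 1 * (u $ 1 * a 2 2 - b 1 - u $ 2 * a 2 1) - u $ 2 * (b 2 + u $ 1 * a 1 2 - u $ 2 * a 1 1)"
    unfolding R by (simp add: pds a_def b_def) (simp add: algebra_simps)
  have "(\<Sum>i\<in>UNIV. rotd i (rotd i h) u) =
      (u $ 1 * u $ 1 + u $ 2 * u $ 2 + u $ 3 * u $ 3) * (a 1 1 + a 2 2 + a 3 3)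
      - (u $ 1 * (u $ 1 * a 1 1 + u $ 2 * a 2 1 + u $ 3 * a 3 1) + u $ 2 * (u $ 1 * a 1 2 + u $ 2 * a 2 2 + u $ 3 * a 3 2)
         + u $ 3 * (u $ 1 * a 1 3 + u $ 2 * a 2 3 + u $ 3 * a 3 3))
      - 2 * (u $ 1 * b 1 + u $ 2 * b 2 + u $ 3 * b 3)"
    unfolding sum_3 R1 R2 R3 by (simp add: algebra_simps)
  also have "\<dots> = - ((real l - 1) * (u $ 1 * b 1 + u $ 2 * b 2 + u $ 3 * b 3)) - 2 * (u $ 1 * b 1 + u $ 2 * b 2 + u $ 3 * b 3)"
    unfolding n tr E by (simp add: algebra_simps)
  also have "\<dots> = - (real l * (real l + 1)) * h u"
    unfolding E0 by (simp add: algebra_simps)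
  finally show ?thesis .
qed

text \<open>Integration by parts moves the derivative from \<open>f\<close> to
  \<open>rotd i h\<close>, so the second derivatives fall on the polynomial, where
  \<open>sum_rotd_rotd_harmonic\<close> evaluates them.\<close>

lemma green_harmonic:
  assumes f: "\<And>i. rot_deriv i f (g i)" and h: "harmonic_poly l h"
  shows "integ (\<lambda>u. \<Sum>i\<in>UNIV. g i u * rotd i h u) = real l * (real l + 1) * integ (\<lambda>u. f u * h u)"
proof -
  have rh: "real_polynomial_function h" by (rule harmonic_poly_rpf[OF h])
  note bm = rot_deriv_bounded_meas[OF f] bounded_meas_rpf[OF rpf_rotd[OF rh]]
    bounded_meas_rpf[OF rpf_rotd[OF rpf_rotd[OF rh]]] bounded_meas_mult
  have "integ (\<lambda>u. g i u * rotd i h u) = - integ (\<lambda>u. f u * rotd i (rotd i h) u)" for i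
  proof -
    have "integ (\<lambda>u. f u * rotd i (rotd i h) u + g i u * rotd i h u) = 0"
      by (rule integ_rot_deriv[OF rot_deriv_mult[OF f rot_deriv_rpf[OF rpf_rotd[OF rh]]]])
    moreover have "integ (\<lambda>u. f u * rotd i (rotd i h) u + g i u * rotd i h u) =
      integ (\<lambda>u. f u * rotd i (rotd i h) u) + integ (\<lambda>u. g i u * rotd i h u)"
      by (intro integ_add bm)
    ultimately show ?thesis by simp
  qed
  moreover have "integ (\<lambda>u. \<Sum>i\<in>UNIV. g i u * rotd i h u) = (\<Sum>i\<in>UNIV. integ (\<lambda>u. g i u * rotd i h u))"
    by (intro integ_sum bm)
  ultimately have "integ (\<lambda>u. \<Sum>i\<in>UNIV. g i u * rotd i h u) = - (\<Sum>i\<in>UNIV. integ (\<lambda>u. f u * rotd i (rotd i h) u))"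
    by (simp add: sum_negf)
  also have "(\<Sum>i\<in>UNIV. integ (\<lambda>u. f u * rotd i (rotd i h) u)) = integ (\<lambda>u. \<Sum>i\<in>UNIV. f u * rotd i (rotd i h) u)"
    by (intro integ_sum[symmetric] bm)
  also have "\<dots> = integ (\<lambda>u. - (real l * (real l + 1)) * (f u * h u))"
    by (intro integral_round_prob_cong)
       (simp only: sum_distrib_left[symmetric] sum_rotd_rotd_harmonic[OF h] mult.left_commute)
  finally show ?thesis by simp
qed

text \<open>The Dirichlet form is symmetric, so Green's formula in both orders compares two
  eigenvalues; these differ because l (l + 1) is strictly increasing.\<close>

lemma harmonic_poly_orthogonal:
  assumes p: "harmonic_poly l p" and q: "harmonic_poly m q" and "l \<noteq> m"
  shows "integ (\<lambda>u. p u * q u) = 0"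
proof -
  have "integ (\<lambda>u. \<Sum>i\<in>UNIV. rotd i p u * rotd i q u) = real m * (real m + 1) * integ (\<lambda>u. p u * q u)"
    by (rule green_harmonic[OF rot_deriv_rpf[OF harmonic_poly_rpf[OF p]] q])
  moreover have "integ (\<lambda>u. \<Sum>i\<in>UNIV. rotd i q u * rotd i p u) = real l * (real l + 1) * integ (\<lambda>u. q u * p u)"
    by (rule green_harmonic[OF rot_deriv_rpf[OF harmonic_poly_rpf[OF q]] p])
  ultimately have "real m * (real m + 1) * integ (\<lambda>u. p u * q u) = real l * (real l + 1) * integ (\<lambda>u. p u * q u)"
    by (simp add: mult.commute)
  moreover have "real m * (real m + 1) \<noteq> real l * (real l + 1)"
  proof -
    have "real m * (real m + 1) - real l * (real l + 1) = (real m - real l) * (real m + real l + 1)"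
      by (simp add: algebra_simps)
    moreover have "real m + real l + 1 \<noteq> 0" by linarith
    ultimately show ?thesis using \<open>l \<noteq> m\<close> by auto
  qed
  ultimately show ?thesis by simp
qed

section \<open>Orthogonal projections and the spectral gap inequality\<close>

text \<open>Gram-Schmidt by induction on a spanning family. The functions \<open>b i\<close> need
  not lie in \<open>V\<close> (monomials are not harmonic), so each step passes to the subspace of
  those elements of \<open>V\<close> that can be written without \<open>b k\<close>.\<close>

lemma projection_exists:
  fixes b :: "'i \<Rightarrow> real^3 \<Rightarrow> real" and V :: "(real^3 \<Rightarrow> real) set"
  assumes "finite I"
  shows "(\<And>p. p \<in> V \<Longrightarrow> continuous_on S2 p) \<Longrightarrow> (\<lambda>u. 0) \<in> V \<Longrightarrow>
    (\<And>p q. p \<in> V \<Longrightarrow> q \<in> V \<Longrightarrow> (\<lambda>u. p u + q u) \<in> V) \<Longrightarrow> (\<And>c p. p \<in> V \<Longrightarrow> (\<lambda>u. c * p u) \<in> V) \<Longrightarrow>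
    (\<And>p. p \<in> V \<Longrightarrow> \<exists>c. \<forall>u\<in>S2. p u = (\<Sum>i\<in>I. c i * b i u)) \<Longrightarrow> bounded_meas f \<Longrightarrow>
    \<exists>h\<in>V. \<forall>g\<in>V. integ (\<lambda>u. (f u - h u) * g u) = 0"
  using assms
proof (induction I arbitrary: V f rule: finite_induct)
  case empty
  have "integ (\<lambda>u. (f u - 0) * g u) = 0" if "g \<in> V" for g
  proof -
    have "integ (\<lambda>u. (f u - 0) * g u) = integ (\<lambda>u. 0)"
      using empty.prems(5)[OF that] by (intro integral_round_prob_cong) simp
    then show ?thesis by simp
  qed
  then show ?case using empty.prems(2) by (intro bexI[of _ "\<lambda>u. 0"]) auto
next
  case (insert k I)
  note cont = insert.prems(1) and zero = insert.prems(2) and add = insert.prems(3) and cmult = insert.prems(4)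
  note bmV = bounded_meas_continuous[OF cont]
  define V' where "V' = {p \<in> V. \<exists>c. \<forall>u\<in>S2. p u = (\<Sum>i\<in>I. c i * b i u)}"
  have V'V: "V' \<subseteq> V" by (auto simp: V'_def)
  have V'I: "p \<in> V'" if "p \<in> V" "\<And>u. u \<in> S2 \<Longrightarrow> p u = (\<Sum>i\<in>I. c i * b i u)" for p c
    using that by (auto simp: V'_def)
  have proj: "\<exists>h\<in>V'. \<forall>g\<in>V'. integ (\<lambda>u. (f u - h u) * g u) = 0" if "bounded_meas f" for f
  proof (rule insert.IH[OF _ _ _ _ _ that])
    show "continuous_on S2 p" if "p \<in> V'" for p using that cont V'V by blast
    show "(\<lambda>u. 0) \<in> V'" by (rule V'I[OF zero, of "\<lambda>_. 0"]) simp
    show "\<exists>c. \<forall>u\<in>S2. p u = (\<Sum>i\<in>I. c i * b i u)" if "p \<in> V'" for p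
      using that by (simp add: V'_def)
    show "(\<lambda>u. p u + q u) \<in> V'" if p: "p \<in> V'" and q: "q \<in> V'" for p q
    proof -
      obtain c d where c: "\<forall>u\<in>S2. p u = (\<Sum>i\<in>I. c i * b i u)" and d: "\<forall>u\<in>S2. q u = (\<Sum>i\<in>I. d i * b i u)"
        using p q unfolding V'_def by blast
      show ?thesis
        by (rule V'I[OF add, of _ _ "\<lambda>i. c i + d i"]) (use p q c d V'V in \<open>auto simp: sum.distrib distrib_right\<close>)
    qed
    show "(\<lambda>u. a * p u) \<in> V'" if p: "p \<in> V'" for a p
    proof -
      obtain c where c: "\<forall>u\<in>S2. p u = (\<Sum>i\<in>I. c i * b i u)"
        using p unfolding V'_def by blast
      show ?thesis
        by (rule V'I[of "\<lambda>u. a * p u" "\<lambda>i. a * c i", OF cmult]) (use p c V'V in \<open>auto simp: sum_distrib_left mult.assoc\<close>)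
    qed
  qed
  show ?case
  proof (cases "V' = V")
    case True
    then show ?thesis using proj[OF insert.prems(6)] by simp
  next
    case False
    then obtain v where v: "v \<in> V" "v \<notin> V'" using V'V by blast
    obtain v' where v': "v' \<in> V'" "\<And>g. g \<in> V' \<Longrightarrow> integ (\<lambda>u. (v u - v' u) * g u) = 0"
      using proj[OF bmV[OF v(1)]] by blast
    obtain c' where c': "\<And>u. u \<in> S2 \<Longrightarrow> v' u = (\<Sum>i\<in>I. c' i * b i u)"
      using v'(1) unfolding V'_def by blast
    \<comment> \<open>The Gram-Schmidt vector: \<open>v\<close> minus its projection to V', hence
      orthogonal to V'.\<close>
    define w where "w u = v u + (-1) * v' u" for u
    have w: "w \<in> V" unfolding w_def[abs_def] using v v' V'V by (intro add cmult) auto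
    have wperp: "integ (\<lambda>u. w u * g u) = 0" if "g \<in> V'" for g
      using v'(2)[OF that] by (simp add: w_def)
    obtain c where c: "\<And>u. u \<in> S2 \<Longrightarrow> w u = c k * b k u + (\<Sum>i\<in>I. c i * b i u)"
      using insert.prems(5)[OF w] insert.hyps by auto
    have v_eq: "v u = w u + v' u" for u by (simp add: w_def)
    \<comment> \<open>Otherwise \<open>w\<close>, and with it v = w + v', could be written without
      \<open>b k\<close>, and \<open>v\<close> would lie in V'.\<close>
    have ck: "c k \<noteq> 0"
    proof
      assume "c k = 0"
      then have "v \<in> V'"
        by (intro V'I[OF v(1), of "\<lambda>i. c i + c' i"]) (simp add: v_eq c c' sum.distrib distrib_right)
      then show False using v by simp
    qed
    have ww: "integ (\<lambda>u. w u * w u) \<noteq> 0"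
    proof
      assume "integ (\<lambda>u. w u * w u) = 0"
      then have "w u = 0" if "u \<in> S2" for u by (rule round_prob_definite[OF cont[OF w] _ that])
      then have "v \<in> V'"
        by (intro V'I[OF v(1), of c']) (simp add: v_eq c')
      then show False using v by simp
    qed
    obtain h' where h': "h' \<in> V'" "\<And>g. g \<in> V' \<Longrightarrow> integ (\<lambda>u. (f u - h' u) * g u) = 0"
      using proj[OF insert.prems(6)] by blast
    \<comment> \<open>The Fourier coefficient of \<open>f\<close> along \<open>w\<close>; adding
      \<beta> w to the projection to V' gives the projection to V.\<close>
    define \<beta> where "\<beta> = integ (\<lambda>u. f u * w u) / integ (\<lambda>u. w u * w u)"
    define h where "h u = h' u + \<beta> * w u" for u
    have hV: "h \<in> V" unfolding h_def[abs_def] using h'(1) V'V w by (intro add cmult) auto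
    have bh': "bounded_meas h'" using bmV h'(1) V'V by blast
    note bm = insert.prems(6) bh' bmV[OF w] bounded_meas_mult bounded_meas_diff bounded_meas_cmult
    have hw: "integ (\<lambda>u. (f u - h u) * w u) = 0"
    proof -
      have "integ (\<lambda>u. (f u - h u) * w u) = integ (\<lambda>u. (f u * w u - w u * h' u) - \<beta> * (w u * w u))"
        by (simp add: h_def algebra_simps)
      also have "\<dots> = integ (\<lambda>u. f u * w u) - integ (\<lambda>u. w u * h' u) - \<beta> * integ (\<lambda>u. w u * w u)"
        by (subst integ_diff, (intro bm)+, subst integ_diff, (intro bm)+, simp)
      also have "\<dots> = 0" using ww wperp[OF h'(1)] by (simp add: \<beta>_def)
      finally show ?thesis .
    qed
    have hV': "integ (\<lambda>u. (f u - h u) * g u) = 0" if g: "g \<in> V'" for g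
    proof -
      have bg: "bounded_meas g" using bmV g V'V by blast
      have "integ (\<lambda>u. (f u - h u) * g u) = integ (\<lambda>u. (f u - h' u) * g u - \<beta> * (w u * g u))"
        by (simp add: h_def algebra_simps)
      also have "\<dots> = integ (\<lambda>u. (f u - h' u) * g u) - \<beta> * integ (\<lambda>u. w u * g u)"
        by (subst integ_diff, (intro bm bg)+, simp)
      finally show ?thesis using h'(2)[OF g] wperp[OF g] by simp
    qed
    have "integ (\<lambda>u. (f u - h u) * g u) = 0" if g: "g \<in> V" for g
    proof -
      obtain d where d: "\<And>u. u \<in> S2 \<Longrightarrow> g u = d k * b k u + (\<Sum>i\<in>I. d i * b i u)"
        using insert.prems(5)[OF g] insert.hyps by auto
      \<comment> \<open>Subtracting \<alpha> w cancels the \<open>b k\<close> coefficient of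
        \<open>g\<close>, which puts the difference into V'. So orthogonality to V' and to
        \<open>w\<close> suffices.\<close>
      define \<alpha> where "\<alpha> = d k / c k"
      define g' where "g' u = g u + (- \<alpha>) * w u" for u
      have g'V: "g' \<in> V" unfolding g'_def[abs_def] using g w by (intro add cmult)
      have g': "g' \<in> V'"
      proof (rule V'I[OF g'V])
        fix u assume u: "u \<in> S2"
        have dk: "d k = \<alpha> * c k" using ck by (simp add: \<alpha>_def)
        have "g' u = (\<Sum>i\<in>I. d i * b i u) - \<alpha> * (\<Sum>i\<in>I. c i * b i u)"
          unfolding g'_def d[OF u] c[OF u] dk by (simp add: algebra_simps)
        then show "g' u = (\<Sum>i\<in>I. (d i - \<alpha> * c i) * b i u)"
          by (simp add: sum_distrib_left sum_subtractf left_diff_distrib mult.assoc)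
      qed
      have "integ (\<lambda>u. (f u - h u) * g u) = integ (\<lambda>u. (f u - h u) * g' u + \<alpha> * ((f u - h u) * w u))"
        by (simp add: g'_def algebra_simps)
      also have "\<dots> = integ (\<lambda>u. (f u - h u) * g' u) + \<alpha> * integ (\<lambda>u. (f u - h u) * w u)"
        by (subst integ_add, (intro bm bmV[OF hV] bmV[OF g'V])+, simp)
      finally show ?thesis using hw hV'[OF g'] by simp
    qed
    then show ?thesis using hV by blast
  qed
qed

lemma harmonic_projection_exists:
  assumes "bounded_meas f"
  shows "\<exists>h. harmonic_poly l h \<and> (\<forall>g. harmonic_poly l g \<longrightarrow> integ (\<lambda>u. (f u - h u) * g u) = 0)"
proof -
  have fin: "finite {js::3 list. length js = l}"
    using finite_lists_length_eq[of "UNIV::3 set" l] by simp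
  have "\<exists>h\<in>Collect (harmonic_poly l). \<forall>g\<in>Collect (harmonic_poly l). integ (\<lambda>u. (f u - h u) * g u) = 0"
  proof (rule projection_exists[OF fin _ _ _ _ _ assms, of _ monom3])
    show "\<exists>c. \<forall>u\<in>S2. p u = (\<Sum>js | length js = l. c js * monom3 js u)" if "p \<in> Collect (harmonic_poly l)" for p
      using that hom_poly_monoms[of l p] by (auto simp: harmonic_poly_def)
  qed (auto intro: harmonic_poly_zero harmonic_poly_add harmonic_poly_cmult continuous_on_rpf harmonic_poly_rpf)
  then show ?thesis by blast
qed

text \<open>Two candidates differ by a harmonic polynomial orthogonal to itself, which vanishes on
  the sphere; as elements of \<open>spherical_harmonics\<close> are restrictions, they are then
  equal as functions.\<close>

lemma harm_proj_eq:
  assumes h: "harmonic_poly l h" and orth: "\<And>g. harmonic_poly l g \<Longrightarrow> integ (\<lambda>u. (f u - h u) * g u) = 0"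
    and f: "bounded_meas f"
  shows "harm_proj l f = restrict h S2"
proof -
  let ?P = "\<lambda>h. h \<in> spherical_harmonics l \<and> (\<forall>g\<in>spherical_harmonics l. integ (\<lambda>u. (f u - h u) * g u) = 0)"
  have P: "?P (restrict k S2) \<longleftrightarrow> (\<forall>g. harmonic_poly l g \<longrightarrow> integ (\<lambda>u. (f u - k u) * g u) = 0)"
    if k: "harmonic_poly l k" for k
  proof -
    have "integ (\<lambda>u. (f u - restrict k S2 u) * restrict g S2 u) = integ (\<lambda>u. (f u - k u) * g u)" for g
      by (intro integral_round_prob_cong) simp
    moreover have "restrict k S2 \<in> spherical_harmonics l" using k by (auto simp: spherical_harmonics_eq)
    ultimately show ?thesis by (auto simp: spherical_harmonics_eq)
  qed
  have "k' = restrict h S2" if "?P k'" for k'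
  proof -
    have "k' \<in> spherical_harmonics l" using that by blast
    then obtain k where k: "harmonic_poly l k" "k' = restrict k S2"
      unfolding spherical_harmonics_eq by blast
    have orthk: "\<And>g. harmonic_poly l g \<Longrightarrow> integ (\<lambda>u. (f u - k u) * g u) = 0"
      using that P[OF k(1)] unfolding k(2) by blast
    define d where "d u = h u + (- 1) * k u" for u
    have d: "harmonic_poly l d"
      unfolding d_def[abs_def] by (intro harmonic_poly_add harmonic_poly_cmult h k)
    note bm = f bounded_meas_rpf[OF harmonic_poly_rpf[OF h]] bounded_meas_rpf[OF harmonic_poly_rpf[OF k(1)]]
      bounded_meas_rpf[OF harmonic_poly_rpf[OF d]] bounded_meas_mult bounded_meas_diff
    have "integ (\<lambda>u. d u * d u) = integ (\<lambda>u. (f u - k u) * d u - (f u - h u) * d u)"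
      by (intro integral_round_prob_cong) (simp add: d_def algebra_simps)
    also have "\<dots> = integ (\<lambda>u. (f u - k u) * d u) - integ (\<lambda>u. (f u - h u) * d u)"
      by (intro integ_diff bm)
    also have "\<dots> = 0" using orthk[OF d] orth[OF d] by simp
    finally have "d u = 0" if "u \<in> S2" for u
      by (rule round_prob_definite[OF continuous_on_rpf[OF harmonic_poly_rpf[OF d]] _ that])
    then show ?thesis unfolding k(2) by (auto simp: restrict_def fun_eq_iff d_def)
  qed
  then show ?thesis unfolding harm_proj_def using P[OF h] orth by (intro the_equality) blast+
qed

text \<open>A polynomial representing the projection. \<open>harm_proj\<close> is a restriction to
  the sphere and cannot be differentiated in R^3.\<close>

definition hproj :: "nat \<Rightarrow> (real^3 \<Rightarrow> real) \<Rightarrow> real^3 \<Rightarrow> real" where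
  "hproj l f = (SOME h. harmonic_poly l h \<and> (\<forall>g. harmonic_poly l g \<longrightarrow> integ (\<lambda>u. (f u - h u) * g u) = 0))"

section \<open>Truncations: orthogonality, approximation and the gap\<close>

lemma hproj:
  assumes "bounded_meas f"
  shows "harmonic_poly l (hproj l f)" "harmonic_poly l g \<Longrightarrow> integ (\<lambda>u. (f u - hproj l f u) * g u) = 0"
  using someI_ex[OF harmonic_projection_exists[OF assms, of l]] unfolding hproj_def by blast+

definition htrunc :: "nat \<Rightarrow> (real^3 \<Rightarrow> real) \<Rightarrow> real^3 \<Rightarrow> real" where
  "htrunc N f u = (\<Sum>l\<le>N. hproj l f u)"

lemma truncation_eq:
  assumes "bounded_meas f" "u \<in> S2"
  shows "truncation N f u = htrunc N f u"
  using assms harm_proj_eq[OF hproj(1)[OF assms(1)] hproj(2)[OF assms(1)] assms(1)]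
  by (simp add: truncation_def htrunc_def)

lemma rpf_htrunc: "bounded_meas f \<Longrightarrow> real_polynomial_function (htrunc N f)"
  unfolding htrunc_def[abs_def] by (intro rpf_sum harmonic_poly_rpf[OF hproj(1)]) auto

lemma htrunc_orthogonal:
  assumes f: "bounded_meas f" and g: "harmonic_poly l g" and l: "l \<le> N"
  shows "integ (\<lambda>u. (f u - htrunc N f u) * g u) = 0"
proof -
  note bmp = bounded_meas_rpf[OF harmonic_poly_rpf]
  have bm: "bounded_meas (\<lambda>u. hproj m f u * g u)" for m
    by (intro bounded_meas_mult bmp[OF hproj(1)[OF f]] bmp[OF g])
  have "integ (\<lambda>u. htrunc N f u * g u) = integ (\<lambda>u. \<Sum>m\<le>N. hproj m f u * g u)"
    by (simp add: htrunc_def sum_distrib_right)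
  also have "\<dots> = (\<Sum>m\<le>N. integ (\<lambda>u. hproj m f u * g u))"
    by (rule integ_sum[OF bm])
  also have "\<dots> = (\<Sum>m\<le>N. if m = l then integ (\<lambda>u. hproj l f u * g u) else 0)"
    using harmonic_poly_orthogonal[OF hproj(1)[OF f] g] by (intro sum.cong) auto
  also have "\<dots> = integ (\<lambda>u. hproj l f u * g u)" using l by simp
  finally have 1: "integ (\<lambda>u. htrunc N f u * g u) = integ (\<lambda>u. hproj l f u * g u)" .
  have "integ (\<lambda>u. (f u - k u) * g u) = integ (\<lambda>u. f u * g u) - integ (\<lambda>u. k u * g u)" if "bounded_meas k" for k
    unfolding left_diff_distrib by (intro integ_diff bounded_meas_mult f that bmp[OF g])
  then show ?thesis
    using hproj(2)[OF f g] 1 bmp[OF hproj(1)[OF f]] bounded_meas_rpf[OF rpf_htrunc[OF f]] by simp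
qed

lemma htrunc_orthogonal_sum:
  assumes f: "bounded_meas f" and g: "\<And>l. harmonic_poly l (g l)"
  shows "integ (\<lambda>u. (f u - htrunc N f u) * (\<Sum>l\<le>N. g l u)) = 0"
proof -
  have "integ (\<lambda>u. (f u - htrunc N f u) * (\<Sum>l\<le>N. g l u)) = integ (\<lambda>u. \<Sum>l\<le>N. (f u - htrunc N f u) * g l u)"
    by (simp add: sum_distrib_left)
  also have "\<dots> = (\<Sum>l\<le>N. integ (\<lambda>u. (f u - htrunc N f u) * g l u))"
    by (intro integ_sum bounded_meas_mult bounded_meas_diff f bounded_meas_rpf rpf_htrunc harmonic_poly_rpf[OF g])
  also have "\<dots> = 0" using htrunc_orthogonal[OF f g] by (intro sum.neutral) auto
  finally show ?thesis .
qed

lemma integ_square_add: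
  assumes "bounded_meas p" "bounded_meas q" "integ (\<lambda>u. p u * q u) = 0"
  shows "integ (\<lambda>u. (p u + q u)\<^sup>2) = integ (\<lambda>u. (p u)\<^sup>2) + integ (\<lambda>u. (q u)\<^sup>2)"
proof -
  have "integ (\<lambda>u. (p u + q u)\<^sup>2) = integ (\<lambda>u. (p u * p u + 2 * (p u * q u)) + q u * q u)"
    by (simp add: power2_eq_square algebra_simps)
  also have "\<dots> = (integ (\<lambda>u. p u * p u) + integ (\<lambda>u. 2 * (p u * q u))) + integ (\<lambda>u. q u * q u)"
    by (subst integ_add, (intro bounded_meas_add bounded_meas_mult bounded_meas_const assms)+,
        subst integ_add, (intro bounded_meas_mult bounded_meas_const assms)+, rule refl)
  finally show ?thesis using assms(3) by (simp add: power2_eq_square)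
qed

text \<open>Pythagoras: the difference between the truncation and \<open>p\<close> is on the sphere
  a sum of harmonics of degree at most N, hence orthogonal to the residual.\<close>

lemma htrunc_best_approximation:
  assumes f: "bounded_meas f" and p: "harm_sum N p" "continuous_on S2 p"
  shows "integ (\<lambda>u. (f u - htrunc N f u)\<^sup>2) \<le> integ (\<lambda>u. (f u - p u)\<^sup>2)"
proof -
  obtain k where k: "\<And>l. harmonic_poly l (k l)" "\<And>u. u \<in> S2 \<Longrightarrow> p u = (\<Sum>l\<le>N. k l u)"
    using p unfolding harm_sum_def by blast
  define g where "g l u = hproj l f u + (- 1) * k l u" for l u
  have g: "harmonic_poly l (g l)" for l
    unfolding g_def[abs_def] by (intro harmonic_poly_add harmonic_poly_cmult hproj(1) f k)
  let ?G = "\<lambda>u. \<Sum>l\<le>N. g l u"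
  have bG: "bounded_meas ?G" by (intro bounded_meas_rpf rpf_sum harmonic_poly_rpf[OF g]) auto
  have "integ (\<lambda>u. (f u - p u)\<^sup>2) = integ (\<lambda>u. ((f u - htrunc N f u) + ?G u)\<^sup>2)"
    by (intro integral_round_prob_cong) (simp add: k(2) htrunc_def g_def sum_subtractf)
  also have "\<dots> = integ (\<lambda>u. (f u - htrunc N f u)\<^sup>2) + integ (\<lambda>u. (?G u)\<^sup>2)"
    by (intro integ_square_add htrunc_orthogonal_sum f g bG bounded_meas_diff bounded_meas_rpf rpf_htrunc)
  finally show ?thesis by simp
qed

text \<open>Finite form of Parseval's identity; each further degree splits off one orthogonal
  component.\<close>

lemma htrunc_residual_add:
  assumes f: "bounded_meas f"
  shows "integ (\<lambda>u. (f u - htrunc L f u)\<^sup>2) =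
    integ (\<lambda>u. (f u - htrunc (L + k) f u)\<^sup>2) + (\<Sum>l\<in>{L<..L + k}. integ (\<lambda>u. (hproj l f u)\<^sup>2))"
proof (induction k)
  case (Suc k)
  let ?n = "Suc (L + k)"
  have "integ (\<lambda>u. (f u - htrunc (L + k) f u)\<^sup>2) = integ (\<lambda>u. ((f u - htrunc ?n f u) + hproj ?n f u)\<^sup>2)"
    by (simp add: htrunc_def)
  also have "\<dots> = integ (\<lambda>u. (f u - htrunc ?n f u)\<^sup>2) + integ (\<lambda>u. (hproj ?n f u)\<^sup>2)"
    by (intro integ_square_add htrunc_orthogonal[OF f hproj(1)[OF f]] bounded_meas_diff f bounded_meas_rpf
        rpf_htrunc harmonic_poly_rpf[OF hproj(1)[OF f]]) simp
  finally have 1: "integ (\<lambda>u. (f u - htrunc (L + k) f u)\<^sup>2) =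
    integ (\<lambda>u. (f u - htrunc ?n f u)\<^sup>2) + integ (\<lambda>u. (hproj ?n f u)\<^sup>2)" .
  have "{L<..L + Suc k} = insert ?n {L<..L + k}" by auto
  then show ?case using Suc.IH 1 by simp
qed simp

text \<open>A polynomial uniformly close to \<open>f\<close> is on the sphere a finite sum of
  harmonics, and the truncation of sufficiently high degree approximates at least as well in
  L^2.\<close>

lemma htrunc_converges:
  assumes f: "continuous_on S2 f" and e: "e > 0"
  shows "\<exists>k. integ (\<lambda>u. (f u - htrunc (L + k) f u)\<^sup>2) \<le> e"
proof -
  have bf: "bounded_meas f" by (rule bounded_meas_continuous[OF f])
  define m where "m = measure round_prob (space round_prob)"
  have m: "m \<ge> 0" by (simp add: m_def)
  \<comment> \<open>Uniform accuracy d gives squared L^2 error at most d^2 m <= e; m + 1 avoids a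
    separate case m = 0.\<close>
  define d where "d = sqrt (e / (m + 1))"
  have d: "d > 0" "d\<^sup>2 * m \<le> e" using e m by (simp_all add: d_def field_simps)
  obtain p where p: "real_polynomial_function p" "\<And>u. u \<in> S2 \<Longrightarrow> \<bar>f u - p u\<bar> < d"
    using Stone_Weierstrass_real_polynomial_function[OF compact_sphere f d(1)] by metis
  obtain N where "harm_sum N p" using harm_sum_rpf[OF p(1)] by blast
  then have "harm_sum (L + N) p" by (rule harm_sum_mono) simp
  then have "integ (\<lambda>u. (f u - htrunc (L + N) f u)\<^sup>2) \<le> integ (\<lambda>u. (f u - p u)\<^sup>2)"
    by (rule htrunc_best_approximation[OF bf _ continuous_on_rpf[OF p(1)]])
  also have "\<dots> \<le> integ (\<lambda>u. d\<^sup>2)"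
  proof (rule integral_mono)
    show "integrable round_prob (\<lambda>u. (f u - p u)\<^sup>2)"
      by (intro integrable_round_prob continuous_intros f continuous_on_rpf p)
    show "(f u - p u)\<^sup>2 \<le> d\<^sup>2" if "u \<in> space round_prob" for u
      using p(2)[of u] that d by (simp add: space_round_prob abs_le_square_iff[symmetric])
  qed simp
  also have "\<dots> = d\<^sup>2 * m" by (simp add: m_def mult.commute)
  also have "\<dots> \<le> e" by (rule d)
  finally show ?thesis by blast
qed

lemma green_htrunc:
  assumes f: "bounded_meas f" and g: "\<And>i. rot_deriv i p (g i)"
  shows "integ (\<lambda>u. \<Sum>i\<in>UNIV. g i u * rotd i (htrunc N f) u) =
    (\<Sum>l\<le>N. real l * (real l + 1) * integ (\<lambda>u. p u * hproj l f u))"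
proof -
  have rh: "real_polynomial_function (hproj l f)" for l by (rule harmonic_poly_rpf[OF hproj(1)[OF f]])
  have "integ (\<lambda>u. \<Sum>i\<in>UNIV. g i u * rotd i (htrunc N f) u) =
      integ (\<lambda>u. \<Sum>l\<le>N. \<Sum>i\<in>UNIV. g i u * rotd i (hproj l f) u)"
    unfolding htrunc_def[abs_def] rotd_sum[OF finite_atMost rh] sum_distrib_left
    by (subst sum.swap) (rule refl)
  also have "\<dots> = (\<Sum>l\<le>N. integ (\<lambda>u. \<Sum>i\<in>UNIV. g i u * rotd i (hproj l f) u))"
    by (intro integ_sum bounded_meas_sum finite bounded_meas_mult rot_deriv_bounded_meas[OF g]
        bounded_meas_rpf rpf_rotd rh)
  also have "\<dots> = (\<Sum>l\<le>N. real l * (real l + 1) * integ (\<lambda>u. p u * hproj l f u))"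
    by (intro sum.cong refl green_harmonic[OF g] hproj(1) f)
  finally show ?thesis .
qed

text \<open>Expand the nonnegative integral of the sum of (g_i - R_i F)^2 for the truncation F. By
  Green's formula the mixed integral and the Dirichlet integral of F are both the left-hand side, so
  the expansion is the right-hand side minus the left-hand side.\<close>

lemma bessel_dirichlet:
  assumes f: "\<And>i. rot_deriv i f (g i)"
  shows "(\<Sum>l\<le>N. real l * (real l + 1) * integ (\<lambda>u. (hproj l f u)\<^sup>2)) \<le> integ (\<lambda>u. \<Sum>i\<in>UNIV. (g i u)\<^sup>2)"
proof -
  have bf: "bounded_meas f" by (rule rot_deriv_bounded_meas[OF f])
  have bg: "bounded_meas (g i)" for i by (rule rot_deriv_bounded_meas[OF f])
  let ?F = "htrunc N f"
  have rF: "real_polynomial_function ?F" by (rule rpf_htrunc[OF bf])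
  have bF: "bounded_meas (rotd i ?F)" for i by (intro bounded_meas_rpf rpf_rotd rF)
  have bh: "bounded_meas (hproj l f)" for l by (rule bounded_meas_rpf[OF harmonic_poly_rpf[OF hproj(1)[OF bf]]])
  have 1: "integ (\<lambda>u. p u * hproj l f u) = integ (\<lambda>u. (hproj l f u)\<^sup>2)"
    if "bounded_meas p" "integ (\<lambda>u. (p u - hproj l f u) * hproj l f u) = 0" for p l
  proof -
    have "integ (\<lambda>u. (p u - hproj l f u) * hproj l f u) = integ (\<lambda>u. p u * hproj l f u) - integ (\<lambda>u. hproj l f u * hproj l f u)"
      unfolding left_diff_distrib by (intro integ_diff bounded_meas_mult that bh)
    then show ?thesis using that by (simp add: power2_eq_square)
  qed
  have fh: "integ (\<lambda>u. f u * hproj l f u) = integ (\<lambda>u. (hproj l f u)\<^sup>2)" for l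
    by (rule 1[OF bf hproj(2)[OF bf hproj(1)[OF bf]]])
  have Fh: "integ (\<lambda>u. ?F u * hproj l f u) = integ (\<lambda>u. (hproj l f u)\<^sup>2)" if "l \<le> N" for l
  proof -
    have "integ (\<lambda>u. (f u - ?F u) * hproj l f u) = integ (\<lambda>u. f u * hproj l f u) - integ (\<lambda>u. ?F u * hproj l f u)"
      unfolding left_diff_distrib by (intro integ_diff bounded_meas_mult bf bh bounded_meas_rpf[OF rF])
    then show ?thesis using htrunc_orthogonal[OF bf hproj(1)[OF bf] that] fh by simp
  qed
  let ?S = "\<Sum>l\<le>N. real l * (real l + 1) * integ (\<lambda>u. (hproj l f u)\<^sup>2)"
  have gF: "integ (\<lambda>u. \<Sum>i\<in>UNIV. g i u * rotd i ?F u) = ?S"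
    unfolding green_htrunc[OF bf f] fh ..
  have FF: "integ (\<lambda>u. \<Sum>i\<in>UNIV. rotd i ?F u * rotd i ?F u) = ?S"
    unfolding green_htrunc[OF bf rot_deriv_rpf[OF rF]] by (intro sum.cong) (simp_all add: Fh)
  have "0 \<le> integ (\<lambda>u. \<Sum>i\<in>UNIV. (g i u - rotd i ?F u)\<^sup>2)"
    by (intro integral_nonneg_AE AE_I2 sum_nonneg) simp
  also have "\<dots> = integ (\<lambda>u. (\<Sum>i\<in>UNIV. (g i u)\<^sup>2) - 2 * (\<Sum>i\<in>UNIV. g i u * rotd i ?F u) + (\<Sum>i\<in>UNIV. rotd i ?F u * rotd i ?F u))"
    unfolding sum_distrib_left sum_subtractf[symmetric] sum.distrib[symmetric]
    by (simp add: power2_eq_square algebra_simps)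
  also have "\<dots> = integ (\<lambda>u. \<Sum>i\<in>UNIV. (g i u)\<^sup>2) - integ (\<lambda>u. 2 * (\<Sum>i\<in>UNIV. g i u * rotd i ?F u)) + integ (\<lambda>u. \<Sum>i\<in>UNIV. rotd i ?F u * rotd i ?F u)"
    unfolding power2_eq_square
    by (subst integ_add, (intro bounded_meas_diff bounded_meas_sum bounded_meas_cmult bounded_meas_mult bg bF finite)+,
        subst integ_diff, (intro bounded_meas_sum bounded_meas_cmult bounded_meas_mult bg bF finite)+, rule refl)
  also have "\<dots> = integ (\<lambda>u. \<Sum>i\<in>UNIV. (g i u)\<^sup>2) - ?S"
    using gF FF by simp
  finally show ?thesis by simp
qed

text \<open>The residual is a tail of finitely many degrees, controlled by
  \<open>bessel_dirichlet\<close>, plus an error below any given e.\<close>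

lemma spectral_gap:
  assumes f: "\<And>i. rot_deriv i f (g i)"
  shows "integ (\<lambda>u. (f u - truncation L f u)\<^sup>2) \<le> integ (\<lambda>u. \<Sum>i\<in>UNIV. (g i u)\<^sup>2) / ((real L + 1) * (real L + 2))"
proof -
  have bf: "bounded_meas f" by (rule rot_deriv_bounded_meas[OF f])
  have cf: "continuous_on S2 f" using f[of 1] by (simp add: rot_deriv_def)
  define E where "E = integ (\<lambda>u. \<Sum>i\<in>UNIV. (g i u)\<^sup>2)"
  define a where "a l = integ (\<lambda>u. (hproj l f u)\<^sup>2)" for l
  have a: "a l \<ge> 0" for l by (simp add: a_def)
  let ?c = "(real L + 1) * (real L + 2)"
  have c: "?c > 0" by simp
  have "integ (\<lambda>u. (f u - htrunc L f u)\<^sup>2) \<le> E / ?c + e" if e: "e > 0" for e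
  proof -
    obtain k where k: "integ (\<lambda>u. (f u - htrunc (L + k) f u)\<^sup>2) \<le> e"
      using htrunc_converges[OF cf e] by blast
    have "?c * (\<Sum>l\<in>{L<..L + k}. a l) \<le> (\<Sum>l\<in>{L<..L + k}. real l * (real l + 1) * a l)"
      unfolding sum_distrib_left
    proof (intro sum_mono mult_right_mono a)
      \<comment> \<open>Here l is at least L + 1, the first degree beyond the truncation; this fixes
        the constant.\<close>
      fix l assume "l \<in> {L<..L + k}"
      then show "?c \<le> real l * (real l + 1)" by (intro mult_mono) auto
    qed
    also have "\<dots> \<le> (\<Sum>l\<le>L + k. real l * (real l + 1) * a l)"
      by (intro sum_mono2) (auto intro!: mult_nonneg_nonneg a)
    also have "\<dots> \<le> E" unfolding a_def E_def by (rule bessel_dirichlet[OF f])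
    finally have "(\<Sum>l\<in>{L<..L + k}. a l) \<le> E / ?c" using c by (simp add: field_simps)
    then show ?thesis using htrunc_residual_add[OF bf, of L k] k by (simp add: a_def)
  qed
  then have "integ (\<lambda>u. (f u - htrunc L f u)\<^sup>2) \<le> E / ?c" by (rule field_le_epsilon)
  moreover have "integ (\<lambda>u. (f u - truncation L f u)\<^sup>2) = integ (\<lambda>u. (f u - htrunc L f u)\<^sup>2)"
    by (intro integral_round_prob_cong) (simp add: truncation_eq[OF bf])
  ultimately show ?thesis by (simp add: E_def)
qed

section \<open>Conformal parametrizations\<close>

text \<open>Measurability of \<open>g\<close> comes for free: it is a pointwise limit of difference
  quotients of a continuous function. So no regularity of \<open>sphere_diff\<close> in
  \<open>u\<close> has to be proved.\<close>

lemma rot_derivI: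
  assumes f: "continuous_on S2 f"
    and d: "\<And>u. u \<in> S2 \<Longrightarrow> ((\<lambda>t. f (rot i t u)) has_real_derivative g u) (at 0)"
    and C: "\<And>u. u \<in> S2 \<Longrightarrow> \<bar>g u\<bar> \<le> C"
  shows "rot_deriv i f g"
proof -
  have mf: "f \<in> borel_measurable round_prob" by (rule measurable_round_prob[OF f])
  have mfr: "(\<lambda>u. f (rot i t u)) \<in> borel_measurable round_prob" for t
    using measurable_compose[OF measurable_rot mf] .
  have "g \<in> borel_measurable round_prob"
  proof (rule borel_measurable_LIMSEQ_real)
    show "(\<lambda>u. (f (rot i (1 / real (Suc n)) u) - f u) / (1 / real (Suc n))) \<in> borel_measurable round_prob" for n
      using mf mfr by measurable
    fix u assume "u \<in> space round_prob"
    then have "((\<lambda>h. (f (rot i h u) - f u) / h) \<longlongrightarrow> g u) (at 0)"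
      using d[of u] by (simp add: has_field_derivative_iff rot_0 space_round_prob)
    moreover have "filterlim (\<lambda>n. 1 / real (Suc n)) (at 0) sequentially"
      using LIMSEQ_Suc[OF lim_1_over_n] by (auto simp: filterlim_at)
    ultimately show "(\<lambda>n. (f (rot i (1 / real (Suc n)) u) - f u) / (1 / real (Suc n))) \<longlonglongrightarrow> g u"
      by (rule filterlim_compose)
  qed
  moreover have "\<bar>f (rot i t u) - f u\<bar> \<le> C * \<bar>t\<bar>" if "u \<in> S2" for u t
    using rot_lipschitz[of f i g C u t] d C that by (simp add: has_real_derivative_iff_has_vector_derivative)
  moreover have "AE u in round_prob. ((\<lambda>t. f (rot i t u)) has_real_derivative g u) (at 0)"
    using d by (intro AE_I2) (simp add: space_round_prob)
  ultimately show ?thesis unfolding rot_deriv_def bounded_meas_def using f C by blast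
qed

definition sphere_rotd :: "3 \<Rightarrow> (real^3 \<Rightarrow> real^3) \<Rightarrow> real^3 \<Rightarrow> real^3" where
  "sphere_rotd i \<phi> u = sphere_diff \<phi> u (cross3 (axis i 1) u)"

lemma sphere_rotd_derivative:
  assumes \<phi>: "smooth_map_on S2 \<phi>" and u: "u \<in> S2"
  shows "((\<lambda>t. \<phi> (rot i t u)) has_vector_derivative sphere_rotd i \<phi> u) (at 0)"
proof -
  have "((\<lambda>t. rot i t u) has_derivative (\<lambda>s. s *\<^sub>R cross3 (axis i 1) u)) (at 0)"
    using rot_has_vector_derivative[of i u 0] by (simp add: has_vector_derivative_def rot_0)
  from has_derivative_compose[OF this, of "\<lambda>x. \<phi> (x /\<^sub>R norm x)" "sphere_diff \<phi> u"]
  have "((\<lambda>t. \<phi> (rot i t u /\<^sub>R norm (rot i t u))) has_derivative (\<lambda>s. sphere_diff \<phi> u (s *\<^sub>R cross3 (axis i 1) u))) (at 0)"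
    using sphere_diff_derivative[OF \<phi> u] by (simp add: rot_0)
  moreover have "linear (sphere_diff \<phi> u)"
    using sphere_diff_derivative[OF \<phi> u] by (rule has_derivative_linear)
  ultimately show ?thesis
    using u by (simp add: has_vector_derivative_def norm_rot sphere_rotd_def linear_scale)
qed

text \<open>The rotation field e_i cross u is tangent with squared length 1 - u_i^2, and
  conformality scales squared lengths by e^(2 rho).\<close>

lemma norm_sphere_rotd:
  assumes \<rho>: "has_conformal_factor \<phi> \<rho>" and u: "u \<in> S2"
  shows "(norm (sphere_rotd i \<phi> u))\<^sup>2 = exp (2 * \<rho> u) * (1 - (u $ i)\<^sup>2)"
proof -
  have "u \<bullet> cross3 (axis i 1) u = 0" by (rule dot_cross_self)
  then have "(norm (sphere_rotd i \<phi> u))\<^sup>2 = exp (2 * \<rho> u) * (norm (cross3 (axis i 1) u))\<^sup>2"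
    using \<rho> u unfolding sphere_rotd_def power2_norm_eq_inner has_conformal_factor_def by simp
  also have "(norm (cross3 (axis i 1) u))\<^sup>2 = 1 - (u $ i)\<^sup>2"
    using u by (simp add: norm_cross norm_axis_1 inner_axis1)
  finally show ?thesis .
qed

lemma sum_norm_sphere_rotd:
  assumes \<rho>: "has_conformal_factor \<phi> \<rho>" and u: "u \<in> S2"
  shows "(\<Sum>i\<in>UNIV. (norm (sphere_rotd i \<phi> u))\<^sup>2) = 2 * exp (2 * \<rho> u)"
proof -
  have "(\<Sum>i\<in>UNIV. (u $ i)\<^sup>2) = 1" using u inner3[of u u] by (simp add: norm_eq_1 power2_eq_square)
  then have "(\<Sum>i\<in>UNIV. 1 - (u $ i)\<^sup>2) = 2" by (simp add: sum_subtractf)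
  then show ?thesis unfolding norm_sphere_rotd[OF assms] sum_distrib_left[symmetric] by simp
qed

text \<open>Compactness of the sphere bounds the factor, so the supremum is a genuine one.\<close>

lemma conformal_factor_le_SUP:
  assumes "has_conformal_factor \<phi> \<rho>" "u \<in> S2"
  shows "exp (2 * \<rho> u) \<le> (SUP u\<in>S2. exp (2 * \<rho> u))"
proof (rule cSUP_upper[OF assms(2)])
  have "continuous_on S2 (\<lambda>u. exp (2 * \<rho> u))"
    using assms(1) by (intro continuous_intros smooth_map_on_imp_continuous_on) (simp add: has_conformal_factor_def)
  then have "compact ((\<lambda>u. exp (2 * \<rho> u)) ` S2)" by (intro compact_continuous_image) auto
  then show "bdd_above ((\<lambda>u. exp (2 * \<rho> u)) ` S2)" by (intro bounded_imp_bdd_above compact_imp_bounded)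
qed

lemma norm_sphere_rotd_le:
  assumes \<rho>: "has_conformal_factor \<phi> \<rho>" and u: "u \<in> S2"
  shows "norm (sphere_rotd i \<phi> u) \<le> sqrt (SUP u\<in>S2. exp (2 * \<rho> u))"
proof (rule real_le_rsqrt)
  have "(norm (sphere_rotd i \<phi> u))\<^sup>2 \<le> exp (2 * \<rho> u)"
    unfolding norm_sphere_rotd[OF assms] by (simp add: mult_left_le)
  then show "(norm (sphere_rotd i \<phi> u))\<^sup>2 \<le> (SUP u\<in>S2. exp (2 * \<rho> u))"
    using conformal_factor_le_SUP[OF assms] by linarith
qed

lemma rot_deriv_component:
  assumes \<phi>: "smooth_map_on S2 \<phi>" and \<rho>: "has_conformal_factor \<phi> \<rho>"
  shows "rot_deriv i (\<lambda>u. (\<phi> u - c) $ j) (\<lambda>u. sphere_rotd i \<phi> u $ j)"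
proof (rule rot_derivI)
  show "continuous_on S2 (\<lambda>u. (\<phi> u - c) $ j)"
    by (intro continuous_intros smooth_map_on_imp_continuous_on[OF \<phi>])
  show "\<bar>sphere_rotd i \<phi> u $ j\<bar> \<le> sqrt (SUP u\<in>S2. exp (2 * \<rho> u))" if "u \<in> S2" for u
    using component_le_norm_cart[of "sphere_rotd i \<phi> u" j] norm_sphere_rotd_le[OF \<rho> that, of i] by linarith
  show "((\<lambda>t. (\<phi> (rot i t u) - c) $ j) has_real_derivative sphere_rotd i \<phi> u $ j) (at 0)" if "u \<in> S2" for u
  proof -
    have "((\<lambda>t. \<phi> (rot i t u) - c) has_vector_derivative sphere_rotd i \<phi> u) (at 0)"
      using has_vector_derivative_diff[OF sphere_rotd_derivative[OF \<phi> that] has_vector_derivative_const] by simp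
    from bounded_linear.has_vector_derivative[OF bounded_linear_vec_nth this, of j]
    show ?thesis by (simp add: has_real_derivative_iff_has_vector_derivative)
  qed
qed

text \<open>Off the zero the quotient is given by the chain rule; at the zero, division by 0 makes
  it 0. So it is bounded and measurable throughout, and the Lipschitz bound is inherited from
  \<open>\<phi>\<close> by the triangle inequality.\<close>

lemma rot_deriv_norm:
  assumes \<phi>: "diffeo S2 S \<phi>" and \<rho>: "has_conformal_factor \<phi> \<rho>"
  shows "rot_deriv i (\<lambda>u. norm (\<phi> u - c)) (\<lambda>u. (\<phi> u - c) \<bullet> sphere_rotd i \<phi> u / norm (\<phi> u - c))"
  unfolding rot_deriv_def
proof (intro conjI)
  let ?g = "\<lambda>u. (\<phi> u - c) \<bullet> sphere_rotd i \<phi> u / norm (\<phi> u - c)"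
  let ?C = "sqrt (SUP u\<in>S2. exp (2 * \<rho> u))"
  note s\<phi> = diffeoD(3)[OF \<phi>]
  have der: "((\<lambda>t. \<phi> (rot i t u) - c) has_vector_derivative sphere_rotd i \<phi> u) (at 0)" if "u \<in> S2" for u
    using has_vector_derivative_diff[OF sphere_rotd_derivative[OF s\<phi> that] has_vector_derivative_const] by simp
  show cont: "continuous_on S2 (\<lambda>u. norm (\<phi> u - c))"
    by (intro continuous_intros smooth_map_on_imp_continuous_on[OF s\<phi>])
  have "\<bar>?g u\<bar> \<le> ?C" if "u \<in> S2" for u
  proof (cases "\<phi> u = c")
    case True
    have "0 \<le> ?C" using norm_sphere_rotd_le[OF \<rho> that, of i] norm_ge_zero[of "sphere_rotd i \<phi> u"] by linarith
    then show ?thesis using True by simp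
  next
    case False
    then have "\<bar>?g u\<bar> \<le> norm (sphere_rotd i \<phi> u)"
      using Cauchy_Schwarz_ineq2[of "\<phi> u - c" "sphere_rotd i \<phi> u"] by (simp add: divide_le_eq mult.commute)
    then show ?thesis using norm_sphere_rotd_le[OF \<rho> that, of i] by linarith
  qed
  moreover have "?g \<in> borel_measurable round_prob"
  proof -
    have "bounded_meas (\<lambda>u. (\<phi> u - c) \<bullet> sphere_rotd i \<phi> u)"
      unfolding inner3
      by (rule bounded_meas_sum[OF finite]) (rule bounded_meas_mult; rule rot_deriv_bounded_meas[OF rot_deriv_component[OF s\<phi> \<rho>]])
    then show ?thesis
      unfolding bounded_meas_def by (elim conjE, intro borel_measurable_divide measurable_round_prob[OF cont])
  qed
  ultimately show "bounded_meas ?g" unfolding bounded_meas_def by blast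
  show "\<exists>C. \<forall>u\<in>S2. \<forall>t. \<bar>norm (\<phi> (rot i t u) - c) - norm (\<phi> u - c)\<bar> \<le> C * \<bar>t\<bar>"
  proof (intro exI ballI allI)
    fix u :: "real^3" and t assume "u \<in> S2"
    then have "norm ((\<phi> (rot i t u) - c) - (\<phi> u - c)) \<le> ?C * \<bar>t\<bar>"
      by (intro rot_lipschitz[where g = "sphere_rotd i \<phi>" and f = "\<lambda>u. \<phi> u - c"] der norm_sphere_rotd_le[OF \<rho>])
    then show "\<bar>norm (\<phi> (rot i t u) - c) - norm (\<phi> u - c)\<bar> \<le> ?C * \<bar>t\<bar>"
      using norm_triangle_ineq3 order_trans by blast
  qed
  \<comment> \<open>Injectivity of \<open>\<phi>\<close> leaves at most one exceptional point, and
    single points are null.\<close>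
  have "AE u in round_prob. \<phi> u \<noteq> c"
  proof (cases "\<exists>u0\<in>S2. \<phi> u0 = c")
    case True
    then obtain u0 where u0: "u0 \<in> S2" "\<phi> u0 = c" by blast
    have "AE u in round_prob. u \<notin> {u0}"
      by (rule AE_not_in[OF null_sets_round_prob_singleton[OF u0(1)]])
    moreover have "AE u in round_prob. u \<in> S2" by (rule AE_I2) (simp add: space_round_prob)
    ultimately show ?thesis
    proof eventually_elim
      case (elim u)
      then show ?case using inj_onD[OF diffeoD(1)[OF \<phi>], of u u0] u0 by auto
    qed
  next
    case False
    then show ?thesis by (intro AE_I2) (auto simp: space_round_prob)
  qed
  moreover have "AE u in round_prob. u \<in> S2" by (rule AE_I2) (simp add: space_round_prob)
  ultimately show "AE u in round_prob. ((\<lambda>t. norm (\<phi> (rot i t u) - c)) has_real_derivative ?g u) (at 0)"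
  proof eventually_elim
    case (elim u)
    have "((\<lambda>t. norm (\<phi> (rot i t u) - c)) has_derivative (\<lambda>h. (h *\<^sub>R sphere_rotd i \<phi> u) \<bullet> sgn (\<phi> (rot i 0 u) - c))) (at 0)"
      by (rule has_derivative_compose[OF der[OF elim(2), unfolded has_vector_derivative_def] has_derivative_norm])
         (simp add: rot_0 elim(1))
    moreover have "(\<lambda>h. (h *\<^sub>R sphere_rotd i \<phi> u) \<bullet> sgn (\<phi> (rot i 0 u) - c)) = (*) (?g u)"
      by (simp add: rot_0 sgn_div_norm fun_eq_iff inner_commute divide_inverse mult_ac)
    ultimately show ?case by (simp add: has_field_derivative_def)
  qed
qed

section \<open>Total area and passage to the measure of a conformal map\<close>

lemma bounded_meas_conformal_factor:
  assumes "has_conformal_factor \<phi> \<rho>"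
  shows "bounded_meas (\<lambda>u. exp (2 * \<rho> u))"
  using assms by (intro bounded_meas_continuous continuous_intros smooth_map_on_imp_continuous_on)
    (simp add: has_conformal_factor_def)

lemma area_nonneg: "area S \<ge> 0"
  by (simp add: area_def)

text \<open>The area of \<open>S\<close> is the total mass of the density e^(2 rho) on the
  unnormalised sphere measure; 4 pi is the normalisation built into
  \<open>round_prob\<close>.\<close>

lemma integ_conformal_factor:
  assumes \<phi>: "diffeo S2 S \<phi>" and \<rho>: "has_conformal_factor \<phi> \<rho>"
  shows "integ (\<lambda>u. exp (2 * \<rho> u)) = area S / (4 * pi)"
proof -
  let ?w = "\<lambda>u. ennreal (exp (2 * \<rho> u))"
  have mw: "?w \<in> borel_measurable sphere_measure"
    unfolding measurable_cong_sets[OF sets_sphere_measure refl] using measurable_conformal_factor[OF \<rho>] by measurable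
  have m\<phi>: "\<phi> \<in> measurable (density sphere_measure ?w) (restrict_space borel S)"
    using measurable_diffeo[OF \<phi>] by (subst measurable_cong_sets[OF _ refl]) (simp_all add: sets_sphere_measure)
  have "emeasure (area_measure S) S = emeasure (density sphere_measure ?w) (\<phi> -` S \<inter> space (density sphere_measure ?w))"
    unfolding area_measure_conformal[OF assms]
    by (rule emeasure_distr[OF m\<phi>]) (use sets.top[of "restrict_space borel S"] in \<open>simp add: space_restrict_space\<close>)
  also have "\<phi> -` S \<inter> space (density sphere_measure ?w) = space sphere_measure"
    using diffeoD(2)[OF \<phi>] by (auto simp: space_sphere_measure)
  also have "emeasure (density sphere_measure ?w) (space sphere_measure) = (\<integral>\<^sup>+u. ?w u \<partial>sphere_measure)"
    using mw by (subst emeasure_density) (auto intro!: nn_integral_cong)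
  finally have 1: "area S = enn2real (\<integral>\<^sup>+u. ?w u \<partial>sphere_measure)"
    by (simp add: area_def measure_def)
  have "integ (\<lambda>u. exp (2 * \<rho> u)) = enn2real (\<integral>\<^sup>+u. ?w u \<partial>round_prob)"
    using bounded_meas_conformal_factor[OF \<rho>] by (intro integral_eq_nn_integral) (auto simp: bounded_meas_def)
  also have "(\<integral>\<^sup>+u. ?w u \<partial>round_prob) = ennreal (1 / (4 * pi)) * (\<integral>\<^sup>+u. ?w u \<partial>sphere_measure)"
    unfolding round_prob_eq by (rule nn_integral_scale_measure[OF mw])
  finally show ?thesis by (simp add: 1 enn2real_mult)
qed

lemma conf_measure_eq_density:
  assumes \<phi>: "diffeo S2 S \<phi>" and \<rho>: "has_conformal_factor \<phi> \<rho>"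
  shows "conf_measure S \<phi> = density round_prob (\<lambda>u. ennreal (4 * pi / area S * exp (2 * \<rho> u)))"
proof -
  have mw: "(\<lambda>u. exp (2 * \<rho> u)) \<in> borel_measurable sphere_measure"
    unfolding measurable_cong_sets[OF sets_sphere_measure refl] by (rule measurable_conformal_factor[OF \<rho>])
  have mwe: "(\<lambda>u. ennreal (a * exp (2 * \<rho> u))) \<in> borel_measurable sphere_measure" for a
    by (rule measurable_compose[OF borel_measurable_times[OF borel_measurable_const mw] measurable_ennreal])
  have "conf_measure S \<phi> = density sphere_measure (\<lambda>u. ennreal (exp (2 * \<rho> u)) * ennreal (1 / area S))"
    unfolding conf_measure_def pullback_area_conformal[OF assms] scale_measure_eq_density
    using mwe[of 1] by (intro density_density_eq) simp_all
  also have "(\<lambda>u. ennreal (exp (2 * \<rho> u)) * ennreal (1 / area S)) =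
      (\<lambda>u. ennreal (1 / (4 * pi)) * ennreal (4 * pi / area S * exp (2 * \<rho> u)))"
    using area_nonneg[of S] by (simp add: fun_eq_iff ennreal_mult[symmetric])
  also have "density sphere_measure \<dots> = density round_prob (\<lambda>u. ennreal (4 * pi / area S * exp (2 * \<rho> u)))"
    unfolding round_prob_eq scale_measure_eq_density
    by (rule density_density_eq[symmetric]) (simp_all only: mwe borel_measurable_const)
  finally show ?thesis .
qed

text \<open>Replacing the density by its supremum costs the factor 4 pi K / |S|, with K the supremum
  of e^(2 rho), and the |S| in the bound for \<open>f\<close> cancels: (4 pi K / |S|) (|S| / (2 pi
  c)) = 2 K / c.\<close>

lemma integral_conf_measure_le:
  assumes \<phi>: "diffeo S2 S \<phi>" and \<rho>: "has_conformal_factor \<phi> \<rho>"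
    and f: "bounded_meas f" "\<And>u. u \<in> S2 \<Longrightarrow> f u \<ge> 0" and c: "c > 0"
    and le: "integ f \<le> area S / (2 * pi * c)"
  shows "(\<integral>u. f u \<partial>conf_measure S \<phi>) \<le> 2 * (SUP u\<in>S2. exp (2 * \<rho> u)) / c"
proof -
  let ?K = "SUP u\<in>S2. exp (2 * \<rho> u)"
  have "axis 1 1 \<in> S2" by (simp add: norm_axis_1)
  then have K: "?K > 0" using conformal_factor_le_SUP[OF \<rho>, of "axis 1 1"] exp_gt_zero less_le_trans by blast
  have bw: "bounded_meas (\<lambda>u. exp (2 * \<rho> u))" by (rule bounded_meas_conformal_factor[OF \<rho>])
  let ?a = "4 * pi / area S"
  have a: "?a \<ge> 0" using area_nonneg[of S] by simp
  have "(\<integral>u. f u \<partial>conf_measure S \<phi>) = integ (\<lambda>u. (?a * exp (2 * \<rho> u)) *\<^sub>R f u)"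
    unfolding conf_measure_eq_density[OF \<phi> \<rho>]
  proof (rule integral_density)
    show "f \<in> borel_measurable round_prob" using f(1) by (simp add: bounded_meas_def)
    show "(\<lambda>u. ?a * exp (2 * \<rho> u)) \<in> borel_measurable round_prob"
      using bounded_meas_cmult[OF bw, of ?a] by (simp add: bounded_meas_def)
    show "AE u in round_prob. 0 \<le> ?a * exp (2 * \<rho> u)"
      using a by (intro AE_I2 mult_nonneg_nonneg) simp_all
  qed
  also have "\<dots> \<le> integ (\<lambda>u. (?a * ?K) * f u)"
  proof (rule integral_mono)
    have "bounded_meas (\<lambda>u. ?a * exp (2 * \<rho> u) * f u)"
      by (intro bounded_meas_mult[OF bounded_meas_cmult] bw f)
    then show "integrable round_prob (\<lambda>u. (?a * exp (2 * \<rho> u)) *\<^sub>R f u)"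
      by (simp add: bounded_meas_integrable)
    show "integrable round_prob (\<lambda>u. (?a * ?K) * f u)"
      by (intro bounded_meas_integrable bounded_meas_cmult f)
    show "(?a * exp (2 * \<rho> u)) *\<^sub>R f u \<le> (?a * ?K) * f u" if "u \<in> space round_prob" for u
      using that unfolding space_round_prob real_scaleR_def
      by (intro mult_right_mono mult_left_mono conformal_factor_le_SUP[OF \<rho>] f(2) a)
  qed
  also have "\<dots> = ?a * ?K * integ f" by simp
  also have "\<dots> \<le> ?a * ?K * (area S / (2 * pi * c))"
    by (intro mult_left_mono le mult_nonneg_nonneg a less_imp_le[OF K])
  \<comment> \<open>If the area were 0, the convention 4 pi / 0 = 0 would make the left-hand side 0;
    otherwise equality holds.\<close>
  also have "\<dots> \<le> 2 * ?K / c"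
    using area_nonneg[of S] K c by (cases "area S = 0") (auto simp: field_simps)
  finally show ?thesis .
qed

lemma truncation_vec_nth: "truncation_vec L F u $ j = truncation L (\<lambda>v. F v $ j) u"
  by (simp add: truncation_vec_def truncation_def harm_proj_vec_def)

lemma bounded_meas_cong: "bounded_meas f \<Longrightarrow> (\<And>u. u \<in> S2 \<Longrightarrow> f u = g u) \<Longrightarrow> bounded_meas g"
  unfolding bounded_meas_def using measurable_cong[of round_prob f g] by (simp add: space_round_prob)

lemma bounded_meas_residual:
  assumes "bounded_meas f"
  shows "bounded_meas (\<lambda>u. (f u - truncation L f u)\<^sup>2)"
proof (rule bounded_meas_cong)
  show "bounded_meas (\<lambda>u. (f u - htrunc L f u) * (f u - htrunc L f u))"
    by (intro bounded_meas_mult bounded_meas_diff assms bounded_meas_rpf rpf_htrunc)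
qed (simp add: truncation_eq[OF assms] power2_eq_square)

theorem proposition2p4:
  fixes S :: "(real^3) set"
    and \<phi> :: "real^3 \<Rightarrow> real^3"
    and \<rho> :: "real^3 \<Rightarrow> real"
    and L :: nat
  assumes "embedded_two_sphere S"
    and "\<phi> \<in> centered_conformal_maps S"
    and "has_conformal_factor \<phi> \<rho>"
  shows "(\<integral>u. (norm (centered_position S \<phi> u - truncation_vec L (centered_position S \<phi>) u))\<^sup>2 \<partial>round_prob)
           \<le> area S / (2 * pi * (real L + 1) * (real L + 2))
       \<and> (\<integral>u. (norm (centered_position S \<phi> u - truncation_vec L (centered_position S \<phi>) u))\<^sup>2 \<partial>conf_measure S \<phi>)
           \<le> 2 * (SUP u\<in>S2. exp (2 * \<rho> u)) / ((real L + 1) * (real L + 2))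
       \<and> (\<integral>u. (center_distance S \<phi> u - truncation L (center_distance S \<phi>) u)\<^sup>2 \<partial>round_prob)
           \<le> area S / (2 * pi * (real L + 1) * (real L + 2))
       \<and> (\<integral>u. (center_distance S \<phi> u - truncation L (center_distance S \<phi>) u)\<^sup>2 \<partial>conf_measure S \<phi>)
           \<le> 2 * (SUP u\<in>S2. exp (2 * \<rho> u)) / ((real L + 1) * (real L + 2))"
proof -
  have \<phi>: "diffeo S2 S \<phi>" using assms(2) by (simp add: centered_conformal_maps_def conformal_maps_def)
  note \<rho> = assms(3) and s\<phi> = diffeoD(3)[OF \<phi>]
  let ?c = "(real L + 1) * (real L + 2)"
  have c: "?c > 0" by simp
  define X where "X = centered_position S \<phi>"
  define d where "d = center_distance S \<phi>"
  have X: "X u = \<phi> u - conformal_center S" for u by (simp add: X_def centered_position_def)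
  have d: "d u = norm (\<phi> u - conformal_center S)" for u by (simp add: d_def center_distance_def centered_position_def)
  define D where "D i = sphere_rotd i \<phi>" for i
  have DX: "rot_deriv i (\<lambda>u. X u $ j) (\<lambda>u. D i u $ j)" for i j
    unfolding X D_def by (rule rot_deriv_component[OF s\<phi> \<rho>])
  define G where "G i u = X u \<bullet> D i u / norm (X u)" for i u
  have Dd: "rot_deriv i d (G i)" for i
    using rot_deriv_norm[OF \<phi> \<rho>, of i "conformal_center S"] by (simp add: d[abs_def] G_def[abs_def] X D_def)
  have sumD: "(\<Sum>i\<in>UNIV. (norm (D i u))\<^sup>2) = 2 * exp (2 * \<rho> u)" if "u \<in> S2" for u
    unfolding D_def by (rule sum_norm_sphere_rotd[OF \<rho> that])
  have bw: "bounded_meas (\<lambda>u. exp (2 * \<rho> u))" by (rule bounded_meas_conformal_factor[OF \<rho>])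
  have total: "integ (\<lambda>u. 2 * exp (2 * \<rho> u)) = area S / (2 * pi)"
    by (simp add: integ_conformal_factor[OF \<phi> \<rho>])
  have bD: "bounded_meas (\<lambda>u. (D i u $ j)\<^sup>2)" for i j
    unfolding power2_eq_square by (intro bounded_meas_mult rot_deriv_bounded_meas[OF DX])
  have norm2: "(norm v)\<^sup>2 = (\<Sum>j\<in>UNIV. (v $ j)\<^sup>2)" for v :: "real^3"
    unfolding power2_norm_eq_inner inner3 by (simp add: power2_eq_square)

  let ?RX = "\<lambda>u. (norm (X u - truncation_vec L X u))\<^sup>2"
  have RX: "?RX u = (\<Sum>j\<in>UNIV. (X u $ j - truncation L (\<lambda>v. X v $ j) u)\<^sup>2)" for u
    by (simp add: norm2 truncation_vec_nth)
  have bR: "bounded_meas (\<lambda>u. (X u $ j - truncation L (\<lambda>v. X v $ j) u)\<^sup>2)" for j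
    by (rule bounded_meas_residual[OF rot_deriv_bounded_meas(1)[OF DX]])
  have bRX: "bounded_meas ?RX" unfolding RX by (intro bounded_meas_sum bR finite)
  have 1: "integ ?RX \<le> area S / (2 * pi * ?c)"
  proof -
    have "integ ?RX = (\<Sum>j\<in>UNIV. integ (\<lambda>u. (X u $ j - truncation L (\<lambda>v. X v $ j) u)\<^sup>2))"
      unfolding RX by (rule integ_sum[OF bR])
    also have "\<dots> \<le> (\<Sum>j\<in>UNIV. integ (\<lambda>u. \<Sum>i\<in>UNIV. (D i u $ j)\<^sup>2) / ?c)"
      by (intro sum_mono spectral_gap DX)
    also have "\<dots> = integ (\<lambda>u. \<Sum>j\<in>UNIV. \<Sum>i\<in>UNIV. (D i u $ j)\<^sup>2) / ?c"
      unfolding sum_divide_distrib[symmetric] by (subst integ_sum) (intro bounded_meas_sum bD finite, rule refl)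
    \<comment> \<open>Exchanging the sums over coordinates and rotations collects the squared norms
      of the \<open>D i u\<close>, whose sum is 2 e^(2 rho).\<close>
    also have "integ (\<lambda>u. \<Sum>j\<in>UNIV. \<Sum>i\<in>UNIV. (D i u $ j)\<^sup>2) = integ (\<lambda>u. 2 * exp (2 * \<rho> u))"
      by (rule integral_round_prob_cong, subst sum.swap) (simp add: norm2[symmetric] sumD)
    finally show ?thesis unfolding total by simp
  qed

  let ?Rd = "\<lambda>u. (d u - truncation L d u)\<^sup>2"
  have bRd: "bounded_meas ?Rd" by (rule bounded_meas_residual[OF rot_deriv_bounded_meas(1)[OF Dd]])
  have 2: "integ ?Rd \<le> area S / (2 * pi * ?c)"
  proof -
    have "integ ?Rd \<le> integ (\<lambda>u. \<Sum>i\<in>UNIV. (G i u)\<^sup>2) / ?c" by (rule spectral_gap[OF Dd])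
    also have "integ (\<lambda>u. \<Sum>i\<in>UNIV. (G i u)\<^sup>2) \<le> integ (\<lambda>u. 2 * exp (2 * \<rho> u))"
    proof (rule integral_mono)
      show "integrable round_prob (\<lambda>u. \<Sum>i\<in>UNIV. (G i u)\<^sup>2)"
        unfolding power2_eq_square
        by (intro bounded_meas_integrable bounded_meas_sum bounded_meas_mult rot_deriv_bounded_meas(2)[OF Dd] finite)
      show "integrable round_prob (\<lambda>u. 2 * exp (2 * \<rho> u))"
        by (intro bounded_meas_integrable bounded_meas_cmult bw)
      fix u assume "u \<in> space round_prob"
      then have u: "u \<in> S2" by (simp add: space_round_prob)
      have "(G i u)\<^sup>2 \<le> (norm (D i u))\<^sup>2" for i
      proof -
        \<comment> \<open>Cauchy-Schwarz away from the zeros of \<open>X\<close>; at a zero the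
          quotient is 0.\<close>
        have "\<bar>G i u\<bar> \<le> norm (D i u)"
        proof (cases "X u = 0")
          case False
          then show ?thesis
            using Cauchy_Schwarz_ineq2[of "X u" "D i u"] by (simp add: G_def divide_le_eq mult.commute)
        qed (simp add: G_def)
        then show ?thesis by (simp add: abs_le_square_iff[symmetric])
      qed
      then have "(\<Sum>i\<in>UNIV. (G i u)\<^sup>2) \<le> (\<Sum>i\<in>UNIV. (norm (D i u))\<^sup>2)" by (intro sum_mono)
      then show "(\<Sum>i\<in>UNIV. (G i u)\<^sup>2) \<le> 2 * exp (2 * \<rho> u)" by (simp add: sumD[OF u])
    qed
    finally show ?thesis unfolding total using c by (simp add: divide_right_mono)
  qed

  show ?thesis
    unfolding X_def[symmetric] d_def[symmetric]
    using 1 2 integral_conf_measure_le[OF \<phi> \<rho> bRX _ c 1] integral_conf_measure_le[OF \<phi> \<rho> bRd _ c 2]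
    by (simp add: mult.assoc)
qed

end
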